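(* In the setting of killed Feller processes described in the context, assume that: (i) $G^D(C_b(D))\subset C_0(D)$; (ii) there exists a positive right eigenfunction $h\in B(D)$ for $G^D$; (iii) $(P_t^D)$ is irreducible. Then $(P_t^D)$ has a unique quasi-stationary distribution (QSD).
   Context: $M$ is a separable, locally compact metric space with metric $d$; $D\subset M$ is a nonempty set with compact closure $K=\overline D$ such that $D$ is open relative to $K$; $\partial_KD=K\setminus D$. $(P_t)_{t\ge0}$ is a Markov Feller semigroup on $M$: a semigroup of Markov operators on $C_0(M)$ (sup-norm closure of continuous compactly supported functions) with $P_tf\to f$ uniformly as $t\to0$ for all $f\in C_0(M)$. $(X_t)$ is an associated càdlàg Markov process on a filtered space with right-continuous complete filtration, with laws $(\mathbb P_x)_{x\in M}$, $\mathbb P_x(X_0=x)=1$. $\tau_D^{out}=\inf\{t\ge0:X_t\notin D\}$. Standing hypothesis: $M\setminus K$ is accessible from every $x\in K$, i.e. for every $x\in K$ there is $t\ge0$ with $P_t(x,M\setminus K)>0$. $B(D)$: bounded measurable functions $D\to\mathbb R$; $C_b(D)$: bounded continuous functions on $D$; $C_0(D)$: sup-norm closure of the continuous compactly supported functions on $D$, equivalently those $f\in C_b(D)$ with $f(x)\to0$ when $d(x,\partial_KD)\to0$. Killed semigroup: $P_t^Df(x)=\mathbb E_x(f(X_t)\mathbf 1_{\tau_D^{out}>t})$ for $f\in B(D)$, $x\in D$. Green kernel: $G^Df(x)=\int_0^\infty P_t^Df(x)\,dt$ (a bounded operator on $B(D)$), and $G^D(x,A)=G^D\mathbf 1_{A\cap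 D}(x)$. A positive right eigenfunction for $G^D$ is $h\in B(D)$ with $h(x)>0$ for all $x\in D$ and $G^Dh=\frac1\lambda h$ for some $\lambda>0$. $(P_t^D)$ is irreducible if there is a nontrivial positive measure $\xi$ on $D$ such that for all $x\in D$ and all Borel $A$, $\xi(A)>0\Rightarrow G^D(x,A)>0$. A QSD for $(P_t^D)$ is a probability measure $\mu$ on $D$ such that, for some $\lambda>0$, $\mu P_t^D=e^{-\lambda t}\mu$ for all $t\ge0$. *)

theory Defs
  imports "HOL-Probability.Probability"
begin

text \<open>
  Functions on a subset \<open>D\<close> of the type \<open>'a\<close> are represented by functions on all of \<open>'a\<close> whose
  values outside \<open>D\<close> are irrelevant.
\<close>

definition bounded_measurable_on :: "'a::topological_space set \<Rightarrow> ('a \<Rightarrow> real) set" where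
  "bounded_measurable_on D =
     {f. f \<in> borel_measurable (restrict_space borel D) \<and> bounded (f ` D)}"

definition bounded_continuous_on :: "'a::topological_space set \<Rightarrow> ('a \<Rightarrow> real) set" where
  "bounded_continuous_on D = {f. continuous_on D f \<and> bounded (f ` D)}"

text \<open>The support is taken relative to \<open>D\<close>.\<close>

definition compactly_supported_on :: "'a::topological_space set \<Rightarrow> ('a \<Rightarrow> real) set" where
  "compactly_supported_on D =
     {f. continuous_on D f \<and> compact (D \<inter> closure {x \<in> D. f x \<noteq> 0})}"

text \<open>The closure of the compactly supported functions inside the bounded continuous
  functions on \<open>D\<close>, for the supremum norm over \<open>D\<close>.\<close>

definition C0_on :: "'a::topological_space set \<Rightarrow> ('a \<Rightarrow> real) set" where
  "C0_on D =
     {f \<in> bounded_continuous_on D.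
        \<forall>\<epsilon>>0. \<exists>g\<in>compactly_supported_on D. \<forall>x\<in>D. \<bar>f x - g x\<bar> < \<epsilon>}"


text \<open>The semigroup is given by its transition kernels \<open>P t x = P\<^sub>t(x, \<cdot>)\<close>, for times \<open>t \<ge> 0\<close>; the
  operator \<open>P\<^sub>t\<close> is integration against the kernel.\<close>

definition kernel_op :: "('a \<Rightarrow> 'a measure) \<Rightarrow> ('a \<Rightarrow> real) \<Rightarrow> 'a \<Rightarrow> real" where
  "kernel_op Q f x = (\<integral>y. f y \<partial>Q x)"

locale markov_feller_semigroup =
  fixes P :: "real \<Rightarrow> 'a::{metric_space, second_countable_topology} \<Rightarrow> 'a measure"
  assumes markov_kernel: "0 \<le> t \<Longrightarrow> P t \<in> borel \<rightarrow>\<^sub>M prob_algebra borel"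
    and at_zero: "P 0 x = return borel x"
    and chapman_kolmogorov: "0 \<le> s \<Longrightarrow> 0 \<le> t \<Longrightarrow> P (s + t) x = P s x \<bind> P t"
    and C0_invariant: "0 \<le> t \<Longrightarrow> f \<in> C0_on UNIV \<Longrightarrow> kernel_op (P t) f \<in> C0_on UNIV"
    and strongly_continuous:
      "f \<in> C0_on UNIV \<Longrightarrow> uniform_limit UNIV (\<lambda>t. kernel_op (P t) f) f (at_right 0)"

text \<open>
  A Markov process with semigroup \<open>P\<close>: one measurable space \<open>\<A>\<close>, one filtration \<open>\<F>\<close> indexed by
  times \<open>t \<ge> 0\<close>, and one law \<open>Pr x\<close> for every starting point \<open>x\<close>. Completeness refers to the
  whole family of laws: every subset of an event that is null under all of them belongs
  to \<open>\<F> 0\<close>, hence to every \<open>\<F> t\<close>.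
\<close>

locale cadlag_markov_process =
  fixes P :: "real \<Rightarrow> 'a::{metric_space, second_countable_topology} \<Rightarrow> 'a measure"
    and \<A> :: "'w measure"
    and \<F> :: "real \<Rightarrow> 'w measure"
    and Pr :: "'a \<Rightarrow> 'w measure"
    and X :: "real \<Rightarrow> 'w \<Rightarrow> 'a"
  assumes law_prob_space: "prob_space (Pr x)"
    and sets_law: "sets (Pr x) = sets \<A>"
    and filtration_subalgebra: "0 \<le> t \<Longrightarrow> subalgebra \<A> (\<F> t)"
    and filtration_mono: "0 \<le> s \<Longrightarrow> s \<le> t \<Longrightarrow> sets (\<F> s) \<subseteq> sets (\<F> t)"
    and filtration_right_continuous: "0 \<le> t \<Longrightarrow> sets (\<F> t) = (\<Inter>s\<in>{t<..}. sets (\<F> s))"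
    and filtration_complete:
      "N \<in> sets \<A> \<Longrightarrow> (\<forall>x. emeasure (Pr x) N = 0) \<Longrightarrow> A \<subseteq> N \<Longrightarrow> A \<in> sets (\<F> 0)"
    and adapted: "0 \<le> t \<Longrightarrow> X t \<in> \<F> t \<rightarrow>\<^sub>M borel"
    and right_continuous_paths:
      "\<omega> \<in> space \<A> \<Longrightarrow> 0 \<le> t \<Longrightarrow> ((\<lambda>s. X s \<omega>) \<longlongrightarrow> X t \<omega>) (at_right t)"
    and left_limits:
      "\<omega> \<in> space \<A> \<Longrightarrow> 0 < t \<Longrightarrow> \<exists>l. ((\<lambda>s. X s \<omega>) \<longlongrightarrow> l) (at_left t)"
    and starting_point: "measure (Pr x) {\<omega> \<in> space \<A>. X 0 \<omega> = x} = 1"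
    and markov_property:
      "0 \<le> s \<Longrightarrow> 0 \<le> t \<Longrightarrow> f \<in> bounded_measurable_on UNIV \<Longrightarrow>
       AE \<omega> in Pr x. real_cond_exp (Pr x) (\<F> t) (\<lambda>\<omega>'. f (X (t + s) \<omega>')) \<omega>
                      = kernel_op (P s) f (X t \<omega>)"


text \<open>With the convention \<open>Inf {} = \<infinity>\<close>.\<close>

definition exit_time :: "(real \<Rightarrow> 'w \<Rightarrow> 'a) \<Rightarrow> 'a set \<Rightarrow> 'w \<Rightarrow> ennreal" where
  "exit_time X D \<omega> = Inf (ennreal ` {t. 0 \<le> t \<and> X t \<omega> \<notin> D})"

definition killed_semigroup ::
  "('a \<Rightarrow> 'w measure) \<Rightarrow> (real \<Rightarrow> 'w \<Rightarrow> 'a) \<Rightarrow> 'a set \<Rightarrow> real \<Rightarrow> ('a \<Rightarrow> real) \<Rightarrow> 'a \<Rightarrow> real" where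
  "killed_semigroup Pr X D t f x =
     (\<integral>\<omega>. f (X t \<omega>) * indicator {\<omega>'. exit_time X D \<omega>' > ennreal t} \<omega> \<partial>Pr x)"

definition green_operator ::
  "('a \<Rightarrow> 'w measure) \<Rightarrow> (real \<Rightarrow> 'w \<Rightarrow> 'a) \<Rightarrow> 'a set \<Rightarrow> ('a \<Rightarrow> real) \<Rightarrow> 'a \<Rightarrow> real" where
  "green_operator Pr X D f x = (LINT t:{0..}|lborel. killed_semigroup Pr X D t f x)"

definition green_kernel ::
  "('a \<Rightarrow> 'w measure) \<Rightarrow> (real \<Rightarrow> 'w \<Rightarrow> 'a) \<Rightarrow> 'a set \<Rightarrow> 'a \<Rightarrow> 'a set \<Rightarrow> real" where
  "green_kernel Pr X D x A = green_operator Pr X D (indicator (A \<inter> D)) x"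

definition positive_right_eigenfunction ::
  "('a::topological_space \<Rightarrow> 'w measure) \<Rightarrow> (real \<Rightarrow> 'w \<Rightarrow> 'a) \<Rightarrow> 'a set \<Rightarrow> ('a \<Rightarrow> real) \<Rightarrow> bool" where
  "positive_right_eigenfunction Pr X D h \<longleftrightarrow>
     h \<in> bounded_measurable_on D \<and> (\<forall>x\<in>D. h x > 0) \<and>
     (\<exists>lam>0. \<forall>x\<in>D. green_operator Pr X D h x = 1 / lam * h x)"

definition killed_irreducible ::
  "('a::topological_space \<Rightarrow> 'w measure) \<Rightarrow> (real \<Rightarrow> 'w \<Rightarrow> 'a) \<Rightarrow> 'a set \<Rightarrow> bool" where
  "killed_irreducible Pr X D \<longleftrightarrow>
     (\<exists>\<xi>. sets \<xi> = sets (restrict_space borel D) \<and> emeasure \<xi> (space \<xi>) > 0 \<and>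
          (\<forall>x\<in>D. \<forall>A\<in>sets \<xi>. emeasure \<xi> A > 0 \<longrightarrow> green_kernel Pr X D x A > 0))"

text \<open>The measure \<open>\<mu> P\<^sub>t\<^sup>D\<close> assigns to \<open>A\<close> the \<open>\<mu>\<close>-integral of \<open>P\<^sub>t\<^sup>D 1\<^sub>A\<close>.\<close>

definition quasi_stationary ::
  "('a::topological_space \<Rightarrow> 'w measure) \<Rightarrow> (real \<Rightarrow> 'w \<Rightarrow> 'a) \<Rightarrow> 'a set \<Rightarrow> 'a measure \<Rightarrow> bool" where
  "quasi_stationary Pr X D \<mu> \<longleftrightarrow>
     sets \<mu> = sets (restrict_space borel D) \<and> prob_space \<mu> \<and>
     (\<exists>lam>0. \<forall>t\<ge>0. \<forall>A\<in>sets \<mu>.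
        (\<integral>x. killed_semigroup Pr X D t (indicator A) x \<partial>\<mu>) = exp (- lam * t) * measure \<mu> A)"

end

theory Submission
  imports Defs
begin

text \<open>
  Write \<open>Q\<^sub>t\<close> for the killed semigroup and \<open>G\<close> for its Green operator. Everything rests on the fact
  that a probability measure \<open>\<mu>\<close> on \<open>D\<close> is a quasi-stationary distribution exactly when it is a left
  eigenmeasure of \<open>G\<close>: integrating \<open>\<mu>Q\<^sub>t = e\<^sup>-\<^sup>\<lambda>\<^sup>t\<mu>\<close> over \<open>t\<close> gives \<open>\<mu>G = \<mu>/\<lambda>\<close>, and conversely
  \<open>\<mu>G = r\<mu>\<close> forces \<open>\<phi>(t) = \<mu>Q\<^sub>tf\<close> to satisfy \<open>r\<phi>(t) = \<integral>\<^sub>t\<^sup>\<infinity>\<phi>\<close>, hence \<open>\<phi>(t) = e\<^sup>-\<^sup>t\<^sup>/\<^sup>r\<phi>(0)\<close>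
  (\<open>green_eigen_if_decay\<close>, \<open>decay_if_green_eigen\<close>).

  Existence of an eigenmeasure (\<open>eigenfunctional_exists\<close>). Let \<open>r\<close> be the infimum of all \<open>s\<close> for which
  the Neumann series \<open>\<Sum>\<^sub>n s\<^sup>-\<^sup>nG\<^sup>n1\<close> is bounded. The right eigenfunction \<open>h\<close> keeps \<open>r\<close> away from \<open>0\<close>.
  Convergence with a bound is an open condition on \<open>s\<close>, so the series blows up as \<open>s\<close> decreases to \<open>r\<close>.
  Normalised partial sums \<open>\<Sum>\<^sub>n s\<^sup>-\<^sup>n\<delta>\<^sub>xG\<^sup>n\<close> are therefore probability measures that are more and more
  nearly eigenmeasures. By compactness of the closure \<open>K\<close> of \<open>D\<close> they have a weak limit \<open>\<nu>\<close> on \<open>K\<close>. As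
  \<open>G\<close> maps bounded continuous functions to functions vanishing at the boundary, \<open>Gf\<close> is a
  legitimate test function on \<open>K\<close>, and \<open>\<nu>(Gf) = r\<nu>(f)\<close> follows; \<open>f = 1\<close> shows that no mass has
  escaped to the boundary.

  Uniqueness (\<open>eigenfunctional_unique\<close>). Testing with \<open>h\<close> shows that all eigenvalues equal the one of
  \<open>h\<close>. For two eigenmeasures, scaled to have the same integral of \<open>h\<close>, a Hahn decomposition of
  the difference together with irreducibility makes one of the two parts vanish, hence both.

  The remaining work turns the process into an analytic object. The Markov property, given for single
  times only, is extended to functionals of the path after time \<open>t\<close> by closing the class of
  admissible functionals under three operations (\<open>markov_functional_start\<close>, \<open>markov_functional_shift\<close>,
  \<open>markov_functional_limit\<close>). The indicator of the event that the path stays in a closed set is of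
  this kind, because a right continuous path does so if it does so at countably many times. The set
  \<open>D\<close> need not be closed, and survival in \<open>D\<close> cannot in general be read off from countably many
  times. It is replaced by staying, slightly beyond \<open>t\<close>, in one of an increasing sequence of closed sets
  that exhaust \<open>D\<close>. The two events differ only by paths that come arbitrarily close to the boundary
  \<open>K - D\<close> and jump away from it at the last moment, and the Feller property makes such paths
  negligible (\<open>slipping_null\<close>, \<open>exit_time_survives\<close>). Accessibility of the complement of \<open>K\<close> gives
  exponential decay of the survival probability, uniformly in the starting point
  (\<open>exponential_decay\<close>), so that \<open>G\<close> is a bounded operator.
\<close>

section \<open>Bounded Borel functions and Daniell functionals\<close>

abbreviation bounded_borel :: "('a::topological_space \<Rightarrow> real) set" where
  "bounded_borel \<equiv> bounded_measurable_on UNIV"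

lemma bounded_borel_iff:
  "f \<in> bounded_borel \<longleftrightarrow> f \<in> borel_measurable borel \<and> (\<exists>b. \<forall>x. \<bar>f x\<bar> \<le> b)"
  by (auto simp: bounded_measurable_on_def bounded_iff)

lemma bounded_borelI:
  "f \<in> borel_measurable borel \<Longrightarrow> (\<And>x. \<bar>f x\<bar> \<le> b) \<Longrightarrow> f \<in> bounded_borel"
  by (auto simp: bounded_borel_iff)

lemma bounded_borel_measurable [measurable_dest]:
  "f \<in> bounded_borel \<Longrightarrow> f \<in> borel_measurable borel"
  by (simp add: bounded_borel_iff)

lemma bounded_borel_bound:
  assumes "f \<in> bounded_borel"
  obtains b where "0 \<le> b" "\<And>x. \<bar>f x\<bar> \<le> b"
  using assms unfolding bounded_borel_iff by (meson abs_ge_zero order_trans)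

lemma bounded_borel_const [simp, intro]: "(\<lambda>x. c) \<in> bounded_borel"
  by (auto simp: bounded_borel_iff)

lemma bounded_borel_indicator [intro]: "A \<in> sets borel \<Longrightarrow> indicator A \<in> bounded_borel"
  by (rule bounded_borelI[where b=1]) (auto simp: indicator_def)

lemma bounded_borel_add [intro]:
  assumes "f \<in> bounded_borel" "g \<in> bounded_borel"
  shows "(\<lambda>x. f x + g x) \<in> bounded_borel"
proof -
  obtain a b where "\<And>x. \<bar>f x\<bar> \<le> a" "\<And>x. \<bar>g x\<bar> \<le> b"
    by (metis assms bounded_borel_bound)
  then show ?thesis
    using assms by (intro bounded_borelI[where b="a+b"]) (auto simp: bounded_borel_iff intro: order_trans[OF abs_triangle_ineq add_mono])
qed

lemma bounded_borel_mult [intro]: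
  assumes "f \<in> bounded_borel" "g \<in> bounded_borel"
  shows "(\<lambda>x. f x * g x) \<in> bounded_borel"
proof -
  obtain a b where "\<And>x. \<bar>f x\<bar> \<le> a" "\<And>x. \<bar>g x\<bar> \<le> b" "0 \<le> a"
    by (metis assms bounded_borel_bound)
  then show ?thesis
    using assms by (intro bounded_borelI[where b="a*b"]) (auto simp: bounded_borel_iff abs_mult intro!: mult_mono)
qed

lemma bounded_borel_cmult [intro]: "f \<in> bounded_borel \<Longrightarrow> (\<lambda>x. c * f x) \<in> bounded_borel"
  by (intro bounded_borel_mult) auto

lemma bounded_borel_diff [intro]:
  "f \<in> bounded_borel \<Longrightarrow> g \<in> bounded_borel \<Longrightarrow> (\<lambda>x. f x - g x) \<in> bounded_borel"
  using bounded_borel_add[OF _ bounded_borel_cmult[of g "-1"], of f] by simp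

lemma bounded_borel_limit:
  assumes "\<And>n. f n \<in> bounded_borel" "\<And>n x. \<bar>f n x\<bar> \<le> b" "\<And>x. (\<lambda>n. f n x) \<longlonglongrightarrow> g x"
  shows "g \<in> bounded_borel"
proof (rule bounded_borelI)
  show "g \<in> borel_measurable borel"
    by (rule borel_measurable_LIMSEQ_real[of borel f]) (use assms in \<open>auto simp: bounded_borel_iff\<close>)
  show "\<bar>g x\<bar> \<le> b" for x
    using tendsto_rabs[OF assms(3)[of x]] by (rule LIMSEQ_le_const2) (use assms(2) in auto)
qed

lemma integrable_bounded_borel:
  assumes "f \<in> bounded_borel" "sets M = sets borel" "finite_measure M"
  shows "integrable M f"
proof -
  interpret finite_measure M by fact
  obtain b where b: "\<And>x. \<bar>f x\<bar> \<le> b" using assms by (metis bounded_borel_bound)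
  have "f \<in> borel_measurable M"
    using assms(1) by (simp add: bounded_borel_iff measurable_cong_sets[OF assms(2) refl])
  then show ?thesis
    using b by (intro integrable_const_bound[where B=b]) auto
qed

lemma open_indicator_approx:
  fixes U :: "'a::metric_space set"
  assumes "open U"
  shows "\<exists>F :: nat \<Rightarrow> 'a \<Rightarrow> real. \<forall>n. continuous_on UNIV (F n) \<and> (\<forall>x. 0 \<le> F n x \<and> F n x \<le> 1) \<and>
    (\<forall>x. x \<notin> U \<longrightarrow> F n x = 0) \<and> (\<forall>x. (\<lambda>n. F n x) \<longlonglongrightarrow> indicator U x)"
proof (cases "U = UNIV")
  case True
  then show ?thesis by (intro exI[of _ "\<lambda>n x. 1"]) simp
next
  case False
  define F where "F n x = min 1 (real n * infdist x (- U))" for n x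
  have cl: "closed (- U)" "- U \<noteq> {}" using assms False by auto
  have "(\<lambda>n. F n x) \<longlonglongrightarrow> indicator U x" for x
  proof (cases "x \<in> U")
    case False
    then show ?thesis by (simp add: F_def)
  next
    case True
    have pos: "0 < infdist x (- U)" by (rule infdist_pos_not_in_closed[OF cl]) (use True in simp)
    obtain m where m: "1 < real m * infdist x (- U)" using reals_Archimedean3[OF pos] by blast
    have "F n x = 1" if "m \<le> n" for n
    proof -
      have "real m * infdist x (- U) \<le> real n * infdist x (- U)" using that pos by (intro mult_right_mono) auto
      then show ?thesis using m by (simp add: F_def)
    qed
    then have "\<forall>\<^sub>F n in sequentially. F n x = 1" by (auto simp: eventually_sequentially)
    then show ?thesis using True by (simp add: tendsto_eventually)
  qed
  moreover have "continuous_on UNIV (F n)" for n unfolding F_def by (intro continuous_intros)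
  ultimately show ?thesis
    by (intro exI[of _ F]) (auto simp: F_def infdist_nonneg)
qed

text \<open>
  The monotone class theorem in functional form: indicators of open sets generate all bounded Borel
  functions under linear combinations and bounded pointwise limits.
\<close>

lemma bounded_borel_induct [consumes 1, case_names open_set add cmult limit]:
  fixes R :: "('a::topological_space \<Rightarrow> real) \<Rightarrow> bool"
  assumes f: "f \<in> bounded_borel"
    and op: "\<And>U. open U \<Longrightarrow> R (indicator U)"
    and add: "\<And>f g. f \<in> bounded_borel \<Longrightarrow> g \<in> bounded_borel \<Longrightarrow> R f \<Longrightarrow> R g \<Longrightarrow> R (\<lambda>x. f x + g x)"
    and cmult: "\<And>f c. f \<in> bounded_borel \<Longrightarrow> R f \<Longrightarrow> R (\<lambda>x. c * f x)"
    and limit: "\<And>F g b. (\<And>n. F n \<in> bounded_borel) \<Longrightarrow> (\<And>n. R (F n)) \<Longrightarrow> (\<And>n x. \<bar>F n x\<bar> \<le> b) \<Longrightarrow>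
      (\<And>x. (\<lambda>n. F n x) \<longlonglongrightarrow> g x) \<Longrightarrow> R g"
  shows "R f"
proof -
  have one: "R (\<lambda>x. 1)"
  proof -
    have "indicator UNIV = (\<lambda>x::'a. 1 :: real)" by auto
    then show ?thesis using op[OF open_UNIV] by simp
  qed
  have zero: "R (\<lambda>x. 0)" using cmult[OF bounded_borel_const one, of 0] by simp
  have ind: "R (indicator A)" if "A \<in> sets borel" for A
  proof -
    have bo: "sets (borel :: 'a measure) = sigma_sets UNIV {S. open S}" by (rule sets_borel)
    have "Int_stable {S :: 'a set. open S}" by (auto simp: Int_stable_def)
    moreover have "{S :: 'a set. open S} \<subseteq> Pow UNIV" by simp
    moreover have "A \<in> sigma_sets UNIV {S. open S}" using that bo by simp
    ultimately show ?thesis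
    proof (induction rule: sigma_sets_induct_disjoint)
      case (basic A) then show ?case using op by simp
    next
      case empty
      have "indicator {} = (\<lambda>x::'a. 0 :: real)" by auto
      then show ?case using zero by simp
    next
      case (compl A)
      then have A: "A \<in> sets borel" using bo by simp
      have "indicator (UNIV - A) = (\<lambda>x. 1 + - 1 * indicator A x :: real)" by (auto simp: indicator_def)
      moreover have "R (\<lambda>x. 1 + - 1 * indicator A x)"
        by (intro add cmult one compl.IH bounded_borel_cmult bounded_borel_indicator A bounded_borel_const)
      ultimately show ?case by simp
    next
      case (union A)
      have A: "A i \<in> sets borel" for i using union.hyps(2) bo by auto
      have fin: "R (indicator (\<Union>i<n. A i))" for n
      proof (induction n)
        case 0
        have "indicator {} = (\<lambda>x::'a. 0 :: real)" by auto
        then show ?case using zero by simp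
      next
        case (Suc n)
        have "A i \<inter> A n = {}" if "i < n" for i
          using union.hyps(1) that by (simp add: disjoint_family_on_def)
        then have "(\<Union>i<n. A i) \<inter> A n = {}" by auto
        then have "indicator (\<Union>i<Suc n. A i) = (\<lambda>x. indicator (\<Union>i<n. A i) x + indicator (A n) x :: real)"
          by (auto simp: lessThan_Suc indicator_def fun_eq_iff)
        moreover have "R (\<lambda>x. indicator (\<Union>i<n. A i) x + indicator (A n) x)"
          by (intro add Suc union.IH bounded_borel_indicator A sets.finite_UN) auto
        ultimately show ?case by simp
      qed
      show ?case
      proof (rule limit[where b=1, OF _ fin])
        show "(\<lambda>n. indicator (\<Union>i<n. A i) x :: real) \<longlonglongrightarrow> indicator (\<Union>i. A i) x" for x
          by (rule LIMSEQ_indicator_UN)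
              show "\<bar>indicator (\<Union>i<n. A i) x :: real\<bar> \<le> 1" for n x by (simp add: indicator_def)
      qed (intro bounded_borel_indicator sets.finite_UN A finite_lessThan)
    qed
  qed
  have nonneg: "(\<exists>b. \<forall>x. u x \<le> b) \<Longrightarrow> R u"
    if "u \<in> borel_measurable borel" "\<And>x. 0 \<le> u x" for u
    using that
  proof (induction u rule: borel_measurable_induct_real)
    case (set A) then show ?case using ind by simp
  next
    case (mult u c)
    show ?case
    proof (cases "c = 0")
      case True then show ?thesis using zero by simp
    next
      case False
      with mult obtain b where b: "\<And>x. c * u x \<le> b" by auto
      then have "u x \<le> b / c" for x
        using False mult by (simp add: field_simps)
      then have "u \<in> bounded_borel" "\<exists>b. \<forall>x. u x \<le> b"
        using mult by (auto intro!: bounded_borelI[where b="b/c"])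
      then show ?thesis using mult cmult by simp
    qed
  next
    case (add u v)
    then obtain b where b: "\<And>x. v x + u x \<le> b" by auto
    have uv: "0 \<le> u x" "0 \<le> v x" for x using add by blast+
    have "u x \<le> b" "v x \<le> b" for x
      using uv[of x] b[of x] by linarith+
    then have "u \<in> bounded_borel" "v \<in> bounded_borel" "\<exists>b. \<forall>x. u x \<le> b" "\<exists>b. \<forall>x. v x \<le> b"
      using add by (auto intro!: bounded_borelI[where b=b])
    then show ?case using add.IH assms(3) by simp
  next
    case (seq U)
    then obtain b where b: "\<And>x. u x \<le> b" by auto
    have Ub: "U i x \<le> b" for i x
      using incseq_le[of "\<lambda>i. U i x" "u x" i] seq.hyps b[of x] by (force simp: incseq_def le_fun_def)
    then have R: "R (U i)" for i
      using seq.IH[of i] by blast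
    have bb: "U i \<in> bounded_borel" for i
      using seq.hyps Ub by (auto intro!: bounded_borelI[where b=b])
    show ?case
      by (rule limit[where b=b, OF bb R]) (use seq.hyps Ub in auto)
  qed
  obtain b where b: "0 \<le> b" "\<And>x. \<bar>f x\<bar> \<le> b" by (rule bounded_borel_bound[OF f]) (rule that; blast)
  have fb: "(\<lambda>x. f x + b) \<in> bounded_borel" using f by auto
  have "R (\<lambda>x. f x + b)"
  proof (rule nonneg)
    show "0 \<le> f x + b" for x using b(2)[of x] by linarith
    show "\<exists>c. \<forall>x. f x + b \<le> c" using b by (metis abs_le_iff add_right_mono)
  qed (use fb in measurable)
  then have "R (\<lambda>x. (f x + b) + (- b) * 1)"
    by (rule add[OF fb bounded_borel_const _ cmult[OF bounded_borel_const one]])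
  then show ?thesis by simp
qed

text \<open>
  These are the functionals \<open>f \<mapsto> \<integral> f d\<mu>\<close> with \<open>\<mu>\<close> a finite Borel measure
  (see \<open>daniell_integral\<close> and \<open>daniell_representation\<close>). Working with the functional rather than the
  measure makes it easy to compose with kernels, to take differences and to restrict to a set.
\<close>

definition daniell :: "(('a::topological_space \<Rightarrow> real) \<Rightarrow> real) \<Rightarrow> bool" where
  "daniell L \<longleftrightarrow>
     (\<forall>f\<in>bounded_borel. \<forall>g\<in>bounded_borel. L (\<lambda>x. f x + g x) = L f + L g) \<and>
     (\<forall>f\<in>bounded_borel. \<forall>c. L (\<lambda>x. c * f x) = c * L f) \<and>
     (\<forall>f\<in>bounded_borel. (\<forall>x. 0 \<le> f x) \<longrightarrow> 0 \<le> L f) \<and>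
     (\<forall>f g b. (\<forall>n. f n \<in> bounded_borel) \<longrightarrow> (\<forall>n x. \<bar>f n x\<bar> \<le> b) \<longrightarrow>
        (\<forall>x. (\<lambda>n. f n x) \<longlonglongrightarrow> g x) \<longrightarrow> (\<lambda>n. L (f n)) \<longlonglongrightarrow> L g)"

lemma daniellD:
  assumes "daniell L"
  shows daniell_add: "f \<in> bounded_borel \<Longrightarrow> g \<in> bounded_borel \<Longrightarrow> L (\<lambda>x. f x + g x) = L f + L g"
    and daniell_cmult: "f \<in> bounded_borel \<Longrightarrow> L (\<lambda>x. c * f x) = c * L f"
    and daniell_nonneg: "f \<in> bounded_borel \<Longrightarrow> (\<And>x. 0 \<le> f x) \<Longrightarrow> 0 \<le> L f"
    and daniell_limit: "(\<And>n. F n \<in> bounded_borel) \<Longrightarrow> (\<And>n x. \<bar>F n x\<bar> \<le> b) \<Longrightarrow>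
        (\<And>x. (\<lambda>n. F n x) \<longlonglongrightarrow> g x) \<Longrightarrow> (\<lambda>n. L (F n)) \<longlonglongrightarrow> L g"
  using assms unfolding daniell_def by blast+

lemma daniellI:
  fixes L :: "('a::topological_space \<Rightarrow> real) \<Rightarrow> real"
  assumes "\<And>f g. f \<in> bounded_borel \<Longrightarrow> g \<in> bounded_borel \<Longrightarrow> L (\<lambda>x. f x + g x) = L f + L g"
    and "\<And>f c. f \<in> bounded_borel \<Longrightarrow> L (\<lambda>x. c * f x) = c * L f"
    and "\<And>f. f \<in> bounded_borel \<Longrightarrow> (\<And>x. 0 \<le> f x) \<Longrightarrow> 0 \<le> L f"
    and "\<And>F g b. (\<And>n. F n \<in> bounded_borel) \<Longrightarrow> (\<And>n x. \<bar>F n x\<bar> \<le> b) \<Longrightarrow>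
        (\<And>x. (\<lambda>n. F n x) \<longlonglongrightarrow> g x) \<Longrightarrow> (\<lambda>n. L (F n)) \<longlonglongrightarrow> L g"
  shows "daniell L"
  unfolding daniell_def
proof (intro conjI ballI allI impI)
  fix F :: "nat \<Rightarrow> 'a \<Rightarrow> real" and g b
  assume "\<forall>n. F n \<in> bounded_borel" "\<forall>n x. \<bar>F n x\<bar> \<le> b" "\<forall>x. (\<lambda>n. F n x) \<longlonglongrightarrow> g x"
  then show "(\<lambda>n. L (F n)) \<longlonglongrightarrow> L g"
    using assms(4)[of F b g] by simp
qed (use assms(1-3) in simp_all)

lemma daniell_diff:
  assumes "daniell L" "f \<in> bounded_borel" "g \<in> bounded_borel"
  shows "L (\<lambda>x. f x - g x) = L f - L g"
  using daniell_add[OF assms(1,2) bounded_borel_cmult[OF assms(3), of "-1"]]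
    daniell_cmult[OF assms(1,3), of "-1"] by simp

lemma daniell_mono:
  assumes "daniell L" "f \<in> bounded_borel" "g \<in> bounded_borel" "\<And>x. f x \<le> g x"
  shows "L f \<le> L g"
  using daniell_nonneg[OF assms(1), of "\<lambda>x. g x - f x"] daniell_diff[OF assms(1,3,2)] assms by auto

lemma daniell_const: "daniell L \<Longrightarrow> L (\<lambda>x. c) = c * L (\<lambda>x. 1)"
  using daniell_cmult[of L "\<lambda>x. 1" c] by simp

lemma daniell_abs_le:
  assumes "daniell L" "f \<in> bounded_borel" "\<And>x. \<bar>f x\<bar> \<le> b"
  shows "\<bar>L f\<bar> \<le> b * L (\<lambda>x. 1)"
proof -
  have "L f \<le> L (\<lambda>x. b)" "L (\<lambda>x. - b) \<le> L f"
    using assms by (auto intro!: daniell_mono[OF assms(1)] simp: abs_le_iff minus_le_iff)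
  then show ?thesis
    using daniell_const[OF assms(1), of b] daniell_const[OF assms(1), of "-b"] by auto
qed

lemma daniell_eval: "daniell (\<lambda>f. f x)"
  unfolding daniell_def by (intro conjI ballI allI impI) (rule refl | erule spec)+

lemma daniell_scale:
  assumes "daniell L" "0 \<le> c"
  shows "daniell (\<lambda>f. c * L f)"
proof (rule daniellI)
  fix F :: "nat \<Rightarrow> 'a \<Rightarrow> real" and g b
  assume F: "\<And>n. F n \<in> bounded_borel" "\<And>n x. \<bar>F n x\<bar> \<le> b" "\<And>x. (\<lambda>n. F n x) \<longlonglongrightarrow> g x"
  show "(\<lambda>n. c * L (F n)) \<longlonglongrightarrow> c * L g"
    by (rule tendsto_mult_left[OF daniell_limit[OF assms(1) F]])
next
  fix f g :: "'a \<Rightarrow> real"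
  assume "f \<in> bounded_borel" "g \<in> bounded_borel"
  then show "c * L (\<lambda>x. f x + g x) = c * L f + c * L g"
    by (simp only: daniell_add[OF assms(1)] distrib_left)
next
  fix f :: "'a \<Rightarrow> real" and a
  assume f: "f \<in> bounded_borel"
  show "c * L (\<lambda>x. a * f x) = a * (c * L f)"
    by (simp only: daniell_cmult[OF assms(1) f] mult.left_commute)
next
  fix f :: "'a \<Rightarrow> real"
  assume "f \<in> bounded_borel" "\<And>x. 0 \<le> f x"
  then show "0 \<le> c * L f"
    using assms(2) daniell_nonneg[OF assms(1), of f] by simp
qed

lemma daniell_sum:
  fixes L :: "'i \<Rightarrow> ('a::topological_space \<Rightarrow> real) \<Rightarrow> real"
  assumes "\<And>i. i \<in> I \<Longrightarrow> daniell (L i)"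
  shows "daniell (\<lambda>f. \<Sum>i\<in>I. L i f)"
proof (rule daniellI)
  fix f :: "'a \<Rightarrow> real" and c
  assume f: "f \<in> bounded_borel"
  show "(\<Sum>i\<in>I. L i (\<lambda>x. c * f x)) = c * (\<Sum>i\<in>I. L i f)"
    unfolding sum_distrib_left by (rule sum.cong[OF refl daniell_cmult[OF assms f]])
next
  fix f g :: "'a \<Rightarrow> real"
  assume fg: "f \<in> bounded_borel" "g \<in> bounded_borel"
  show "(\<Sum>i\<in>I. L i (\<lambda>x. f x + g x)) = (\<Sum>i\<in>I. L i f) + (\<Sum>i\<in>I. L i g)"
    unfolding sum.distrib[symmetric] by (rule sum.cong[OF refl daniell_add[OF assms fg]])
next
  fix F :: "nat \<Rightarrow> 'a \<Rightarrow> real" and g b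
  assume F: "\<And>n. F n \<in> bounded_borel" "\<And>n x. \<bar>F n x\<bar> \<le> b" "\<And>x. (\<lambda>n. F n x) \<longlonglongrightarrow> g x"
  show "(\<lambda>n. \<Sum>i\<in>I. L i (F n)) \<longlonglongrightarrow> (\<Sum>i\<in>I. L i g)"
    by (rule tendsto_sum[OF daniell_limit[OF assms F]])
next
  fix f :: "'a \<Rightarrow> real"
  assume f: "f \<in> bounded_borel" "\<And>x. 0 \<le> f x"
  show "0 \<le> (\<Sum>i\<in>I. L i f)"
    by (rule sum_nonneg[OF daniell_nonneg[OF assms f]])
qed

lemma daniell_integral:
  fixes M :: "'a::topological_space measure"
  assumes "finite_measure M" "sets M = sets borel"
  shows "daniell (\<lambda>f. \<integral>x. f x \<partial>M)"
proof -
  interpret finite_measure M by fact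
  note int = integrable_bounded_borel[OF _ assms(2,1)]
  show ?thesis
  proof (rule daniellI)
    fix F :: "nat \<Rightarrow> 'a \<Rightarrow> real" and g b
    assume F: "\<And>n. F n \<in> bounded_borel" "\<And>n x. \<bar>F n x\<bar> \<le> b" "\<And>x. (\<lambda>n. F n x) \<longlonglongrightarrow> g x"
    have g: "g \<in> bounded_borel" by (rule bounded_borel_limit[OF F])
    have M: "borel_measurable M = borel_measurable borel"
      by (rule measurable_cong_sets[OF assms(2) refl])
    show "(\<lambda>n. \<integral>x. F n x \<partial>M) \<longlonglongrightarrow> (\<integral>x. g x \<partial>M)"
      using F g by (intro integral_dominated_convergence[where w="\<lambda>x. b"]) (auto simp: M bounded_borel_iff)
  next
    fix f g :: "'a \<Rightarrow> real"
    assume "f \<in> bounded_borel" "g \<in> bounded_borel"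
    then show "(\<integral>x. f x + g x \<partial>M) = (\<integral>x. f x \<partial>M) + (\<integral>x. g x \<partial>M)"
      by (simp add: int)
  next
    fix f :: "'a \<Rightarrow> real" and c
    show "(\<integral>x. c * f x \<partial>M) = c * (\<integral>x. f x \<partial>M)"
      by simp
  next
    fix f :: "'a \<Rightarrow> real"
    assume "\<And>x. 0 \<le> f x"
    then show "0 \<le> (\<integral>x. f x \<partial>M)"
      by simp
  qed
qed

lemma daniell_eq_open:
  fixes L L' :: "('a::topological_space \<Rightarrow> real) \<Rightarrow> real"
  assumes L: "daniell L" and L': "daniell L'"
    and eq: "\<And>U. open U \<Longrightarrow> L (indicator U) = L' (indicator U)"
    and f: "f \<in> bounded_borel"
  shows "L f = L' f"
  using f
proof (induction f rule: bounded_borel_induct)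
  case (open_set U)
  then show ?case by (rule eq)
next
  case (add f g)
  then show ?case by (simp only: daniell_add[OF L] daniell_add[OF L'])
next
  case (cmult f c)
  then show ?case by (simp only: daniell_cmult[OF L] daniell_cmult[OF L'])
next
  case (limit F g b)
  have "(\<lambda>n. L (F n)) \<longlonglongrightarrow> L g" "(\<lambda>n. L' (F n)) \<longlonglongrightarrow> L' g"
    by (rule daniell_limit[OF L limit.hyps], rule daniell_limit[OF L' limit.hyps])
  with limit.IH show ?case by (simp add: LIMSEQ_unique)
qed

lemma daniell_indicator_Union:
  assumes L: "daniell L" and A: "range A \<subseteq> sets borel" "disjoint_family A"
  shows "(\<lambda>n. L (indicator (A n))) sums L (indicator (\<Union>n. A n))"
proof -
  have ind: "indicator (\<Union>i<n. A i) = (\<lambda>x. \<Sum>i<n. indicator (A i) x :: real)" for n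
  proof
    show "indicator (\<Union>i<n. A i) x = (\<Sum>i<n. indicator (A i) x :: real)" for x
      by (rule indicator_UN_disjoint) (use A(2) in \<open>auto simp: disjoint_family_on_def\<close>)
  qed
  have "L (indicator (\<Union>i<n. A i)) = (\<Sum>i<n. L (indicator (A i)))" for n
  proof (induction n)
    case 0
    have "indicator {} = (\<lambda>x::'a. 0 :: real)" by auto
    then show ?case using daniell_const[OF L, of 0] by simp
  next
    case (Suc n)
    have "indicator (\<Union>i<Suc n. A i) = (\<lambda>x. indicator (\<Union>i<n. A i) x + indicator (A n) x :: real)"
      unfolding ind by simp
    then have "L (indicator (\<Union>i<Suc n. A i)) = L (indicator (\<Union>i<n. A i)) + L (indicator (A n))"
      using A by (simp add: daniell_add[OF L] bounded_borel_indicator sets.finite_UN image_subset_iff)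
    with Suc show ?case by simp
  qed
  moreover have "(\<lambda>n. L (indicator (\<Union>i<n. A i))) \<longlonglongrightarrow> L (indicator (\<Union>i. A i))"
  proof (rule daniell_limit[OF L, of _ 1])
    show "(\<lambda>n. indicator (\<Union>i<n. A i) x :: real) \<longlonglongrightarrow> indicator (\<Union>i. A i) x" for x
      by (rule LIMSEQ_indicator_UN)
  qed (use A in \<open>auto simp: indicator_def intro!: bounded_borel_indicator\<close>)
  ultimately show ?thesis by (simp add: sums_def)
qed

lemma daniell_representation:
  fixes L :: "('a::topological_space \<Rightarrow> real) \<Rightarrow> real"
  assumes L: "daniell L"
  obtains M where "finite_measure M" "sets M = sets borel"
    "\<And>f. f \<in> bounded_borel \<Longrightarrow> L f = (\<integral>x. f x \<partial>M)"
proof -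
  define M where "M = measure_of UNIV (sets borel) (\<lambda>A. ennreal (L (indicator A)))"
  have L0: "0 \<le> L (indicator A)" if "A \<in> sets borel" for A
    using that by (intro daniell_nonneg[OF L] bounded_borel_indicator) auto
  have sets: "sets M = sets borel"
    unfolding M_def using sets.sigma_sets_eq[of "borel :: 'a measure"] by simp
  have em: "emeasure M A = ennreal (L (indicator A))" if "A \<in> sets borel" for A
    unfolding M_def
  proof (rule emeasure_measure_of_sigma)
    show "sigma_algebra UNIV (sets (borel :: 'a measure))"
      using sets.sigma_algebra_axioms[of "borel :: 'a measure"] by simp
    show "positive (sets borel) (\<lambda>A. ennreal (L (indicator A)))"
    proof -
      have "indicator {} = (\<lambda>x::'a. 0 :: real)" by auto
      then show ?thesis using daniell_const[OF L, of 0] by (simp add: positive_def)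
    qed
    show "countably_additive (sets borel) (\<lambda>A. ennreal (L (indicator A)))"
      unfolding countably_additive_def
    proof safe
      fix A :: "nat \<Rightarrow> 'a set" assume A: "range A \<subseteq> sets borel" "disjoint_family A"
      have "(\<lambda>n. ennreal (L (indicator (A n)))) sums ennreal (L (indicator (\<Union>n. A n)))"
        using daniell_indicator_Union[OF L A] A by (subst sums_ennreal) (auto intro!: L0)
      then show "(\<Sum>i. ennreal (L (indicator (A i)))) = ennreal (L (indicator (\<Union> (range A))))"
        by (rule sums_unique[symmetric])
    qed
  qed fact
  have fin: "finite_measure M"
    using em[of UNIV] by (intro finite_measureI) (simp add: sets_eq_imp_space_eq[OF sets])
  interpret finite_measure M by fact
  have "L f = (\<integral>x. f x \<partial>M)" if "f \<in> bounded_borel" for f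
  proof (rule daniell_eq_open[OF L daniell_integral[OF fin sets] _ that])
    fix A :: "'a set" assume "open A"
    then have "A \<in> sets borel" by simp
    then show "L (indicator A) = (\<integral>x. indicator A x \<partial>M)"
      using em[of A] L0[of A] sets by (simp add: measure_def)
  qed
  with fin sets show ?thesis by (rule that)
qed

section \<open>Weak limits of measures on a compact metric space\<close>

text \<open>
  The digits \<open>0\<close> and \<open>2\<close> in base \<open>3\<close> leave gaps, so that nearby numbers of the Cantor set share
  their leading digits: if the first difference is at place \<open>k\<close>, it contributes \<open>2/3\<^sup>k\<^sup>+\<^sup>1\<close>, and all later
  places together at most half of that.
\<close>

lemma ternary_digits_agree:
  fixes a b :: "nat \<Rightarrow> real"
  assumes a: "\<And>i. a i \<in> {0,1}" and b: "\<And>i. b i \<in> {0,1}"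
    and close: "\<bar>(\<Sum>i. a i * 2 * (1/3)^Suc i) - (\<Sum>i. b i * 2 * (1/3)^Suc i)\<bar> < (1/3)^Suc N"
    and "i \<le> N"
  shows "a i = b i"
proof (rule ccontr)
  assume "a i \<noteq> b i"
  define k where "k = (LEAST i. a i \<noteq> b i)"
  have k: "a k \<noteq> b k" "k \<le> i"
    unfolding k_def using \<open>a i \<noteq> b i\<close> by (rule LeastI, rule Least_le)
  have below: "\<And>j. j < k \<Longrightarrow> a j = b j"
    unfolding k_def using not_less_Least by blast
  define e where "e i = (a i - b i) * 2 * (1/3)^Suc i" for i
  have geo: "(\<lambda>i. 2 * (1/3)^Suc (i + m)) sums ((1/3)^m :: real)" for m
    using sums_mult[OF geometric_sums[of "1/3::real"], of "2 * (1/3)^Suc m"]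
    by (simp add: power_add mult_ac)
  have ab: "\<bar>a i - b i\<bar> \<le> 1" "\<bar>a i\<bar> \<le> 1" "\<bar>b i\<bar> \<le> 1" for i
    using a[of i] b[of i] by auto
  have bnd: "summable (\<lambda>i. f i * 2 * (1/3)^Suc i)" if "\<And>i. \<bar>f i\<bar> \<le> (1::real)" for f
  proof (rule summable_comparison_test'[where N=0])
    show "summable (\<lambda>i. 2 * (1/3)^Suc i :: real)" using sums_summable[OF geo[of 0]] by simp
    show "norm (f n * 2 * (1/3)^Suc n) \<le> 2 * (1/3)^Suc n" for n
      using that[of n] by (simp add: abs_mult)
  qed
  have se: "summable e" unfolding e_def by (rule bnd) (rule ab)
  have eq: "(\<Sum>i. a i * 2 * (1/3)^Suc i) - (\<Sum>i. b i * 2 * (1/3)^Suc i) = suminf e"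
    unfolding suminf_diff[OF bnd[OF ab(2)] bnd[OF ab(3)]] e_def left_diff_distrib ..
  have "suminf e = (\<Sum>n. e (n + Suc k)) + sum e {..<Suc k}"
    by (rule suminf_split_initial_segment[OF se])
  also have "sum e {..<Suc k} = e k" by (simp add: e_def below)
  finally have "suminf e = (\<Sum>n. e (n + Suc k)) + e k" .
  moreover have "\<bar>e k\<bar> = 2 * (1/3)^Suc k"
    using k(1) a[of k] b[of k] by (auto simp: e_def)
  moreover have "\<bar>\<Sum>n. e (n + Suc k)\<bar> \<le> (\<Sum>n. 2 * (1/3)^Suc (n + Suc k))"
  proof -
    have "norm (e (n + Suc k)) \<le> 2 * (1/3)^Suc (n + Suc k)" for n
      using ab(1)[of "n + Suc k"] unfolding e_def by (simp add: abs_mult)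
    moreover have "summable (\<lambda>n. 2 * (1/3)^Suc (n + Suc k) :: real)"
      using geo[of "Suc k"] by (rule sums_summable)
    ultimately show ?thesis
      using norm_suminf_le[of "\<lambda>n. e (n + Suc k)"] by auto
  qed
  moreover have "(\<Sum>n. 2 * (1/3)^Suc (n + Suc k)) = ((1/3)^Suc k :: real)"
    using geo[of "Suc k"] by (rule sums_unique[symmetric])
  ultimately have "(1/3)^Suc k \<le> \<bar>suminf e\<bar>" by linarith
  moreover have "(1/3)^Suc N \<le> ((1/3)^Suc k :: real)"
    using k(2) \<open>i \<le> N\<close> by (intro power_decreasing) auto
  ultimately show False using close eq by linarith
qed

text \<open>
  The code of a point of \<open>K\<close> is a real number, and decoding is uniformly continuous: the ternary digits of \<open>c x\<close> record which members of a countable base contain \<open>x\<close>. Finitely many base sets of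
  diameter less than \<open>e\<close> cover \<open>K\<close>, so agreement in finitely many digits already forces
  distance less than \<open>e\<close>. The code itself is only Borel measurable.
\<close>

lemma compact_real_coding:
  fixes K :: "'a::{metric_space, second_countable_topology} set"
  assumes "compact K"
  shows "\<exists>c :: 'a \<Rightarrow> real. c \<in> borel_measurable borel \<and> (\<forall>x. 0 \<le> c x \<and> c x \<le> 1) \<and>
    (\<forall>e>0. \<exists>d>0. \<forall>x\<in>K. \<forall>y. \<bar>c x - c y\<bar> < d \<longrightarrow> dist x y < e)"
proof -
  obtain \<B> :: "'a set set" where \<B>: "countable \<B>" "topological_basis \<B>"
    using ex_countable_basis by blast
  define B where "B = from_nat_into \<B>"
  have "\<B> \<noteq> {}"
    using topological_basisE[OF \<B>(2) open_UNIV, of undefined] by blast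
  then have range_B: "range B = \<B>"
    unfolding B_def using \<B>(1) by (simp add: range_from_nat_into)
  have open_B: "open (B i)" for i
    using range_B topological_basis_open[OF \<B>(2)] by blast
  define c where "c x = (\<Sum>i. indicator (B i) x * 2 * (1/3)^Suc i :: real)" for x
  have ind: "indicator (B i) x \<in> {0, 1::real}" for i x by (auto simp: indicator_def)
  have geo: "(\<lambda>i. 2 * (1/3)^Suc i) sums (1 :: real)"
    using sums_mult[OF geometric_sums[of "1/3::real"], of "2 * (1/3)"] by (simp add: mult_ac)
  have sm: "summable (\<lambda>i. indicator (B i) x * 2 * (1/3)^Suc i :: real)" for x
    by (rule summable_comparison_test'[OF sums_summable[OF geo], where N=0]) (auto simp: indicator_def)
  show ?thesis
  proof (intro exI[of _ c] conjI allI impI)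
    have "B i \<in> sets borel" for i using open_B by auto
    then show "c \<in> borel_measurable borel" unfolding c_def by measurable
    show "0 \<le> c x" for x unfolding c_def by (rule suminf_nonneg[OF sm]) (auto simp: indicator_def)
    show "c x \<le> 1" for x
    proof -
      have "c x \<le> (\<Sum>i. 2 * (1/3)^Suc i)" unfolding c_def
        by (rule suminf_le[OF _ sm sums_summable[OF geo]]) (auto simp: indicator_def)
      then show "c x \<le> 1" using sums_unique[OF geo] by simp
    qed
    fix e :: real assume "0 < e"
    define I where "I = {i. \<exists>x. B i \<subseteq> ball x (e/2)}"
    have "K \<subseteq> (\<Union>i\<in>I. B i)"
    proof
      fix x assume "x \<in> K"
      obtain B' where "B' \<in> \<B>" "x \<in> B'" "B' \<subseteq> ball x (e/2)"
        using topological_basisE[OF \<B>(2) open_ball, of x x "e/2"] \<open>0 < e\<close> by auto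
      moreover then obtain i where "B' = B i" using range_B by auto
      ultimately show "x \<in> (\<Union>i\<in>I. B i)" unfolding I_def by blast
    qed
    then have "\<exists>C\<subseteq>I. finite C \<and> K \<subseteq> (\<Union>i\<in>C. B i)"
      by (rule compactE_image[OF assms open_B]) blast
    then obtain C where C: "C \<subseteq> I" "finite C" "K \<subseteq> (\<Union>i\<in>C. B i)" by blast
    then obtain N where N: "\<And>i. i \<in> C \<Longrightarrow> i \<le> N"
      by (auto simp: finite_nat_set_iff_bounded_le)
    show "\<exists>d>0. \<forall>x\<in>K. \<forall>y. \<bar>c x - c y\<bar> < d \<longrightarrow> dist x y < e"
    proof (intro exI[of _ "(1/3)^Suc N"] conjI ballI allI impI)
      fix x y assume x: "x \<in> K" and d: "\<bar>c x - c y\<bar> < (1/3)^Suc N"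
      obtain i where i: "i \<in> C" "x \<in> B i" using C x by auto
      have "indicator (B i) x = (indicator (B i) y :: real)"
        by (rule ternary_digits_agree[OF ind ind d[unfolded c_def] N[OF i(1)]])
      then have "y \<in> B i" using i(2) by (auto simp: indicator_def split: if_splits)
      moreover obtain z where "B i \<subseteq> ball z (e/2)" using i C by (auto simp: I_def)
      ultimately have "dist z x < e/2" "dist z y < e/2" using i(2) by auto
      then show "dist x y < e" by (metis dist_commute dist_triangle_half_l)
    qed simp
  qed
qed

text \<open>
  Sequential compactness of the probability measures on a compact metric space, reduced to Helly's
  selection theorem on the real line. The images under the coding \<open>c\<close> have a subsequence
  converging weakly to some \<open>\<rho>\<close>, which lives on the closure \<open>Z\<close> of the codes of \<open>K\<close>. Decoding extends
  to a continuous map \<open>p\<close> from \<open>Z\<close> to \<open>K\<close>, and the image of \<open>\<rho>\<close> under \<open>p\<close> is the limit; a continuous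
  function \<open>f\<close> on \<open>K\<close> is tested through a continuous extension of \<open>f \<circ> p\<close> to the line.
\<close>

lemma weak_limit_on_compact:
  fixes \<nu> :: "nat \<Rightarrow> 'a::{metric_space, second_countable_topology} measure"
  assumes K: "compact K" and prob: "\<And>n. prob_space (\<nu> n)" and sets: "\<And>n. sets (\<nu> n) = sets borel"
    and mass: "\<And>n. measure (\<nu> n) K = 1"
  shows "\<exists>r M. strict_mono r \<and> prob_space M \<and> sets M = sets borel \<and> measure M K = 1 \<and>
    (\<forall>f. continuous_on K f \<longrightarrow>
       (\<lambda>n. \<integral>x. indicator K x * f x \<partial>\<nu> (r n)) \<longlonglongrightarrow> (\<integral>x. indicator K x * f x \<partial>M :: real))"
proof -
  interpret \<nu>: prob_space "\<nu> n" for n by (rule prob)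
  note meas_\<nu> = measurable_cong_sets[OF sets refl]
  obtain c :: "'a \<Rightarrow> real" where c[measurable]: "c \<in> borel_measurable borel"
    and c01: "\<And>x. 0 \<le> c x \<and> c x \<le> 1"
    and c_inv: "\<And>e. 0 < e \<Longrightarrow> \<exists>d>0. \<forall>x\<in>K. \<forall>y. \<bar>c x - c y\<bar> < d \<longrightarrow> dist x y < e"
    using compact_real_coding[OF K] by blast
  have "K \<noteq> {}" using mass[of 0] by auto
  then obtain x0 where x0: "x0 \<in> K" by auto
  have Kb[measurable]: "K \<in> sets borel" using K by (simp add: compact_imp_closed borel_closed)
  have aeK: "AE x in \<nu> n. x \<in> K" for n
    using \<nu>.AE_in_set_eq_1[of K n] mass sets by simp
  define Z where "Z = closure (c ` K)"
  define R where "R z y \<longleftrightarrow> y \<in> K \<and> (\<exists>\<xi>. (\<forall>n. \<xi> n \<in> K) \<and> (\<lambda>n. c (\<xi> n)) \<longlonglongrightarrow> z \<and> \<xi> \<longlonglongrightarrow> y)" for z y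
  have R_ex: "\<exists>y. R z y" if z: "z \<in> Z" for z
  proof -
    obtain w where w: "\<And>n. w n \<in> c ` K" "w \<longlonglongrightarrow> z"
      using z unfolding Z_def closure_sequential by blast
    have "\<forall>n. \<exists>x. x \<in> K \<and> w n = c x" using w(1) by blast
    then obtain \<xi> where \<xi>: "\<And>n. \<xi> n \<in> K" "\<And>n. w n = c (\<xi> n)"
      by (auto dest!: choice)
    obtain y s where "y \<in> K" "strict_mono (s :: nat \<Rightarrow> nat)" "(\<xi> \<circ> s) \<longlonglongrightarrow> y"
      using K \<xi>(1) unfolding compact_def by blast
    moreover have "(\<lambda>n. c ((\<xi> \<circ> s) n)) \<longlonglongrightarrow> z"
      using LIMSEQ_subseq_LIMSEQ[OF w(2) \<open>strict_mono s\<close>] \<xi>(2) by (simp add: o_def)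
    ultimately show ?thesis unfolding R_def using \<xi>(1) by (intro exI[of _ y] conjI exI[of _ "\<xi> \<circ> s"]) auto
  qed
  have R_mod: "\<exists>d>0. \<forall>z z' y y'. R z y \<longrightarrow> R z' y' \<longrightarrow> \<bar>z - z'\<bar> < d \<longrightarrow> dist y y' \<le> e" if pos: "0 < e" for e
  proof -
    obtain d where d: "d > 0" "\<And>x y. x \<in> K \<Longrightarrow> \<bar>c x - c y\<bar> < d \<Longrightarrow> dist x y < e"
      using c_inv[OF pos] by blast
    have "dist y y' \<le> e" if "R z y" "R z' y'" "\<bar>z - z'\<bar> < d" for z z' y y'
    proof -
      obtain \<xi> \<xi>' where \<xi>: "\<And>n. \<xi> n \<in> K" "(\<lambda>n. c (\<xi> n)) \<longlonglongrightarrow> z" "\<xi> \<longlonglongrightarrow> y"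
        "(\<lambda>n. c (\<xi>' n)) \<longlonglongrightarrow> z'" "\<xi>' \<longlonglongrightarrow> y'"
        using \<open>R z y\<close> \<open>R z' y'\<close> unfolding R_def by blast
      have "(\<lambda>n. \<bar>c (\<xi> n) - c (\<xi>' n)\<bar>) \<longlonglongrightarrow> \<bar>z - z'\<bar>"
        by (intro tendsto_intros \<xi>)
      then have "\<forall>\<^sub>F n in sequentially. \<bar>c (\<xi> n) - c (\<xi>' n)\<bar> < d"
        using \<open>\<bar>z - z'\<bar> < d\<close> by (rule order_tendstoD)
      then have "\<forall>\<^sub>F n in sequentially. dist (\<xi> n) (\<xi>' n) \<le> e"
        by eventually_elim (use d(2) \<xi>(1) less_imp_le in blast)
      then show ?thesis
        by (intro tendsto_upperbound[OF tendsto_dist[OF \<xi>(3,5)]]) auto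
    qed
    with d(1) show ?thesis by blast
  qed
  define p where "p z = (if z \<in> Z then SOME y. R z y else x0)" for z
  have p: "R z (p z)" if "z \<in> Z" for z
    using someI_ex[OF R_ex[OF that]] that by (simp add: p_def)
  have pK: "p z \<in> K" for z
    using p[of z] x0 by (cases "z \<in> Z") (auto simp: R_def p_def)
  have cont_p: "continuous_on Z p"
  proof (rule continuous_on_iff[THEN iffD2], intro ballI allI impI)
    fix z e assume z: "z \<in> Z" and "(0::real) < e"
    then obtain d where d: "d > 0" "\<And>z z' y y'. R z y \<Longrightarrow> R z' y' \<Longrightarrow> \<bar>z - z'\<bar> < d \<Longrightarrow> dist y y' \<le> e/2"
      using R_mod[of "e/2"] by auto
    have "dist (p z') (p z) < e" if "z' \<in> Z" "dist z' z < d" for z'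
      using d(2)[OF p[OF that(1)] p[OF z]] that(2) \<open>0 < e\<close> by (simp add: dist_real_def)
    with d(1) show "\<exists>d>0. \<forall>x'\<in>Z. dist x' z < d \<longrightarrow> dist (p x') (p z) < e" by blast
  qed
  have pc: "p (c x) = x" if x: "x \<in> K" for x
  proof -
    have cx: "c x \<in> Z"
      unfolding Z_def by (rule subsetD[OF closure_subset imageI[OF x]])
    have Rx: "R (c x) x"
      unfolding R_def by (intro conjI x exI[of _ "\<lambda>_. x"] allI tendsto_const)
    have "dist (p (c x)) x \<le> e" if e: "0 < e" for e
    proof -
      obtain d where "d > 0" "\<And>z z' y y'. R z y \<Longrightarrow> R z' y' \<Longrightarrow> \<bar>z - z'\<bar> < d \<Longrightarrow> dist y y' \<le> e"
        using R_mod[OF e] by blast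
      then show ?thesis using p[OF cx] Rx by simp
    qed
    then show ?thesis by (metis dense_ge dist_le_zero_iff)
  qed
  have closedZ: "closed Z" and Zb[measurable]: "Z \<in> sets borel" unfolding Z_def by (auto simp: borel_closed)
  have cK: "c x \<in> Z" if "x \<in> K" for x
    unfolding Z_def by (rule subsetD[OF closure_subset imageI[OF that]])
  have p_meas[measurable]: "p \<in> borel_measurable borel"
  proof -
    have "p \<in> borel_measurable (restrict_space borel Z)"
      by (rule borel_measurable_continuous_on_restrict[OF cont_p])
    then have "(\<lambda>z. if z \<in> Z then p z else x0) \<in> borel_measurable borel"
      by (subst measurable_If_restrict_space_iff) auto
    moreover have "(\<lambda>z. if z \<in> Z then p z else x0) = p" by (auto simp: p_def)
    ultimately show ?thesis by simp
  qed
  define \<mu> where "\<mu> n = distr (\<nu> n) borel c" for n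
  have c\<nu>: "c \<in> measurable (\<nu> n) borel" for n using c by (simp add: meas_\<nu>)
  have rd: "real_distribution (\<mu> n)" for n
    unfolding \<mu>_def real_distribution_def real_distribution_axioms_def
    using \<nu>.prob_space_distr[OF c\<nu>] by simp
  have "tight \<mu>" unfolding tight_def
  proof (intro conjI allI impI rd)
    have "measure (\<mu> n) {-1<..1} = 1" for n
    proof -
      have "-1 < c x" "c x \<le> 1" for x using c01[of x] by linarith+
      then have "c -` {-1<..1} = UNIV" by auto
      moreover have "measure (\<mu> n) {-1<..1} = measure (\<nu> n) (c -` {-1<..1} \<inter> space (\<nu> n))"
        unfolding \<mu>_def by (rule measure_distr[OF c\<nu>]) simp
      ultimately show ?thesis using \<nu>.prob_space by simp
    qed
    then show "\<exists>a b. a < b \<and> (\<forall>n. 1 - e < measure (\<mu> n) {a<..b})" if "0 < e" for e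
      using that by (intro exI[of _ "-1"] exI[of _ 1]) simp
  qed
  then obtain r \<rho> where r: "strict_mono (r :: nat \<Rightarrow> nat)" and \<rho>: "real_distribution \<rho>" and weak: "weak_conv_m (\<mu> \<circ> id \<circ> r) \<rho>"
    using tight_imp_convergent_subsubsequence[OF _ strict_mono_id] by blast
  interpret \<rho>: real_distribution \<rho> by fact
  have conv: "(\<lambda>n. \<integral>x. g (c x) \<partial>\<nu> (r n)) \<longlonglongrightarrow> (\<integral>z. g z \<partial>\<rho>)"
    if g: "continuous_on UNIV g" "\<And>z. \<bar>g z\<bar> \<le> B" for g :: "real \<Rightarrow> real" and B
  proof -
    have "(\<lambda>n. integral\<^sup>L ((\<mu> \<circ> id \<circ> r) n) g) \<longlonglongrightarrow> integral\<^sup>L \<rho> g"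
      by (rule weak_conv_imp_integral_bdd_continuous_conv[OF _ \<rho> weak])
        (use g rd in \<open>auto simp: continuous_on_eq_continuous_at\<close>)
    moreover have "integral\<^sup>L (\<mu> m) g = (\<integral>x. g (c x) \<partial>\<nu> m)" for m
      unfolding \<mu>_def using g(1) by (intro integral_distr c\<nu>) (auto intro: borel_measurable_continuous_onI)
    ultimately show ?thesis by simp
  qed
  have aeZ: "AE z in \<rho>. z \<in> Z"
  proof -
    define g where "g z = min 1 (infdist z Z)" for z
    have "continuous_on UNIV g" unfolding g_def by (intro continuous_intros)
    then have gm: "g \<in> borel_measurable borel" by (rule borel_measurable_continuous_onI)
    have g01: "0 \<le> g z" "g z \<le> 1" for z by (auto simp: g_def infdist_nonneg)
    have "(\<lambda>n. \<integral>x. g (c x) \<partial>\<nu> (r n)) \<longlonglongrightarrow> (\<integral>z. g z \<partial>\<rho>)"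
      using \<open>continuous_on UNIV g\<close> g01 by (intro conv[of g 1]) auto
    moreover have "(\<integral>x. g (c x) \<partial>\<nu> n) = 0" for n
    proof -
      have "(\<integral>x. g (c x) \<partial>\<nu> n) = (\<integral>x. 0 \<partial>\<nu> n)"
      proof (rule integral_cong_AE)
        show "(\<lambda>x. g (c x)) \<in> borel_measurable (\<nu> n)"
          by (rule measurable_compose[OF c\<nu> gm])
        show "AE x in \<nu> n. g (c x) = 0"
          using aeK[of n] by eventually_elim (simp add: g_def cK)
      qed simp
      then show ?thesis by simp
    qed
    ultimately have "(\<integral>z. g z \<partial>\<rho>) = 0" by (simp add: LIMSEQ_const_iff)
    then have "AE z in \<rho>. g z = 0"
    proof (subst integral_nonneg_eq_0_iff_AE[symmetric])
      show "integrable \<rho> g"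
        by (rule \<rho>.integrable_const_bound[where B=1]) (use g01 gm in simp_all)
    qed (simp_all add: g01)
    moreover have "Z \<noteq> {}" using cK x0 by auto
    ultimately show ?thesis
      by (elim eventually_mono) (auto simp: g_def min_def in_closed_iff_infdist_zero[OF closedZ] split: if_splits)
  qed
  define M where "M = distr \<rho> borel p"
  have p\<rho>: "p \<in> measurable \<rho> borel" by simp
  show ?thesis
  proof (intro exI[of _ r] exI[of _ M] conjI allI impI r)
    show "prob_space M" unfolding M_def by (rule \<rho>.prob_space_distr[OF p\<rho>])
    show "sets M = sets borel" by (simp add: M_def)
    show "measure M K = 1"
      unfolding M_def using pK \<rho>.prob_space by (simp add: measure_distr vimage_def)
    fix f :: "'a \<Rightarrow> real" assume f: "continuous_on K f"
    have "bounded (f ` K)" using compact_continuous_image[OF f K] by (rule compact_imp_bounded)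
    then obtain b where b: "b > 0" "\<And>x. x \<in> K \<Longrightarrow> \<bar>f x\<bar> \<le> b" by (auto simp: bounded_pos)
    have "continuous_on Z (\<lambda>z. f (p z))"
      by (rule continuous_on_compose2[OF f cont_p]) (use pK in auto)
    then obtain g where g: "continuous_on UNIV g" "\<And>z. z \<in> Z \<Longrightarrow> g z = f (p z)" "\<And>z. norm (g z) \<le> b"
      using Tietze[of Z "\<lambda>z. f (p z)" UNIV b] b pK closedZ by (auto simp: closed_closedin[symmetric])
    have fm[measurable]: "(\<lambda>x. indicator K x * f x) \<in> borel_measurable borel"
      using borel_measurable_continuous_on_indicator[OF Kb f] by simp
    have gm[measurable]: "g \<in> borel_measurable borel" using g(1) by (rule borel_measurable_continuous_onI)
    have "(\<integral>x. g (c x) \<partial>\<nu> n) = (\<integral>x. indicator K x * f x \<partial>\<nu> n)" for n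
    proof (rule integral_cong_AE)
      show "(\<lambda>x. g (c x)) \<in> borel_measurable (\<nu> n)"
        by (rule measurable_compose[OF c\<nu> gm])
      show "(\<lambda>x. indicator K x * f x) \<in> borel_measurable (\<nu> n)"
        using fm by (simp add: meas_\<nu>)
      show "AE x in \<nu> n. g (c x) = indicator K x * f x"
        using aeK[of n] by eventually_elim (simp add: g(2) cK pc)
    qed
    moreover have "(\<integral>z. g z \<partial>\<rho>) = (\<integral>x. indicator K x * f x \<partial>M)"
    proof -
      have "(\<integral>x. indicator K x * f x \<partial>M) = (\<integral>z. indicator K (p z) * f (p z) \<partial>\<rho>)"
        unfolding M_def by (rule integral_distr) auto
      also have "\<dots> = (\<integral>z. g z \<partial>\<rho>)"
      proof (rule integral_cong_AE)
        show "(\<lambda>z. indicator K (p z) * f (p z)) \<in> borel_measurable \<rho>"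
          using measurable_compose[OF p\<rho> fm] by simp
        show "AE z in \<rho>. indicator K (p z) * f (p z) = g z"
          using aeZ by eventually_elim (simp add: g(2) pK)
      qed simp
      finally show ?thesis by simp
    qed
    ultimately show "(\<lambda>n. \<integral>x. indicator K x * f x \<partial>\<nu> (r n)) \<longlonglongrightarrow> (\<integral>x. indicator K x * f x \<partial>M)"
      using conv[OF g(1), of b] g(3) by simp
  qed
qed

section \<open>Uniqueness of eigenfunctionals of a positive kernel\<close>

lemma daniell_restrict:
  fixes L :: "('a::topological_space \<Rightarrow> real) \<Rightarrow> real"
  assumes L: "daniell L" and Y: "Y \<in> sets borel"
  shows "daniell (\<lambda>f. L (\<lambda>x. f x * indicator Y x))"
proof -
  have bb: "(\<lambda>x. f x * indicator Y x) \<in> bounded_borel" if "f \<in> bounded_borel" for f :: "'a \<Rightarrow> real"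
    using that Y by (intro bounded_borel_mult bounded_borel_indicator)
  show ?thesis
  proof (rule daniellI)
    fix f g :: "'a \<Rightarrow> real" assume "f \<in> bounded_borel" "g \<in> bounded_borel"
    from daniell_add[OF L bb[OF this(1)] bb[OF this(2)]]
    show "L (\<lambda>x. (f x + g x) * indicator Y x) = L (\<lambda>x. f x * indicator Y x) + L (\<lambda>x. g x * indicator Y x)"
      by (simp add: distrib_right)
  next
    fix f :: "'a \<Rightarrow> real" and c assume "f \<in> bounded_borel"
    from daniell_cmult[OF L bb[OF this], of c]
    show "L (\<lambda>x. c * f x * indicator Y x) = c * L (\<lambda>x. f x * indicator Y x)"
      by (simp add: mult.assoc)
  next
    fix f :: "'a \<Rightarrow> real" assume "f \<in> bounded_borel" "\<And>x. 0 \<le> f x"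
    then show "0 \<le> L (\<lambda>x. f x * indicator Y x)"
      using daniell_nonneg[OF L bb] by simp
  next
    fix F :: "nat \<Rightarrow> 'a \<Rightarrow> real" and g b
    assume F: "\<And>n. F n \<in> bounded_borel" "\<And>n x. \<bar>F n x\<bar> \<le> b" "\<And>x. (\<lambda>n. F n x) \<longlonglongrightarrow> g x"
    show "(\<lambda>n. L (\<lambda>x. F n x * indicator Y x)) \<longlonglongrightarrow> L (\<lambda>x. g x * indicator Y x)"
    proof (rule daniell_limit[OF L, of _ b])
      show "\<bar>F n x * indicator Y x\<bar> \<le> b" for n x
        using F(2)[of n x] by (cases "x \<in> Y") auto
      show "(\<lambda>n. F n x * indicator Y x) \<longlonglongrightarrow> g x * indicator Y x" for x
        by (intro tendsto_mult tendsto_const F(3))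
    qed (rule bb[OF F(1)])
  qed
qed

lemma daniell_minus:
  fixes L L' :: "('a::topological_space \<Rightarrow> real) \<Rightarrow> real"
  assumes L: "daniell L" and L': "daniell L'"
    and le: "\<And>A. A \<in> sets borel \<Longrightarrow> L' (indicator A) \<le> L (indicator A)"
  shows "daniell (\<lambda>f. L f - L' f)"
proof -
  obtain M where M: "finite_measure M" "sets M = sets borel"
    "\<And>f. f \<in> bounded_borel \<Longrightarrow> L f = (\<integral>x. f x \<partial>M)" by (rule daniell_representation[OF L]) (rule that; blast)
  obtain M' where M': "finite_measure M'" "sets M' = sets borel"
    "\<And>f. f \<in> bounded_borel \<Longrightarrow> L' f = (\<integral>x. f x \<partial>M')" by (rule daniell_representation[OF L']) (rule that; blast)
  interpret M: finite_measure M by fact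
  interpret M': finite_measure M' by fact
  have sp: "space M = UNIV" "space M' = UNIV"
    using sets_eq_imp_space_eq[OF M(2)] sets_eq_imp_space_eq[OF M'(2)] by auto
  have "emeasure M' A \<le> emeasure M A" for A
  proof (cases "A \<in> sets borel")
    case True
    then show ?thesis
      using le[OF True] M(2,3) M'(2,3) bounded_borel_indicator[OF True]
      by (simp add: M.emeasure_eq_measure M'.emeasure_eq_measure)
  qed (simp add: emeasure_notin_sets M'(2))
  then have "M' \<le> M"
    by (simp add: le_measure_iff sp M(2) M'(2) le_fun_def)
  have pos: "0 \<le> L f - L' f" if f: "f \<in> bounded_borel" "\<And>x. 0 \<le> f x" for f
  proof -
    have i: "integrable M f" "integrable M' f"
      using integrable_bounded_borel[OF f(1)] M M' by auto
    have "ennreal (\<integral>x. f x \<partial>M') \<le> ennreal (\<integral>x. f x \<partial>M)"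
      using nn_integral_mono_measure[OF _ \<open>M' \<le> M\<close>, of "\<lambda>x. ennreal (f x)"] M(2) M'(2) f(2) i
      by (simp add: nn_integral_eq_integral)
    then show ?thesis using M(3)[OF f(1)] M'(3)[OF f(1)] f(2) by simp
  qed
  show ?thesis
  proof (rule daniellI)
    fix F :: "nat \<Rightarrow> 'a \<Rightarrow> real" and g b
    assume F: "\<And>n. F n \<in> bounded_borel" "\<And>n x. \<bar>F n x\<bar> \<le> b" "\<And>x. (\<lambda>n. F n x) \<longlonglongrightarrow> g x"
    show "(\<lambda>n. L (F n) - L' (F n)) \<longlonglongrightarrow> L g - L' g"
      by (rule tendsto_diff[OF daniell_limit[OF L F] daniell_limit[OF L' F]])
  next
    fix f g :: "'a \<Rightarrow> real" assume fg: "f \<in> bounded_borel" "g \<in> bounded_borel"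
    show "L (\<lambda>x. f x + g x) - L' (\<lambda>x. f x + g x) = L f - L' f + (L g - L' g)"
      unfolding daniell_add[OF L fg] daniell_add[OF L' fg] by simp
  next
    fix f :: "'a \<Rightarrow> real" and c assume f: "f \<in> bounded_borel"
    show "L (\<lambda>x. c * f x) - L' (\<lambda>x. c * f x) = c * (L f - L' f)"
      unfolding daniell_cmult[OF L f] daniell_cmult[OF L' f] by (simp add: right_diff_distrib)
  next
    fix f :: "'a \<Rightarrow> real" assume "f \<in> bounded_borel" "\<And>x. 0 \<le> f x"
    then show "0 \<le> L f - L' f" by (rule pos)
  qed
qed

text \<open>
  The Hahn decomposition of \<open>L - L'\<close>, stated so that its positive and its negative part are again
  functionals of measures.
\<close>

lemma daniell_Hahn:
  fixes L L' :: "('a::topological_space \<Rightarrow> real) \<Rightarrow> real"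
  assumes L: "daniell L" and L': "daniell L'"
  obtains Y where "Y \<in> sets borel"
    "daniell (\<lambda>f. L (\<lambda>x. f x * indicator Y x) - L' (\<lambda>x. f x * indicator Y x))"
    "daniell (\<lambda>f. L' (\<lambda>x. f x * indicator (-Y) x) - L (\<lambda>x. f x * indicator (-Y) x))"
proof -
  obtain M where M: "finite_measure M" "sets M = sets borel"
    "\<And>f. f \<in> bounded_borel \<Longrightarrow> L f = (\<integral>x. f x \<partial>M)" by (rule daniell_representation[OF L]) (rule that; blast)
  obtain M' where M': "finite_measure M'" "sets M' = sets borel"
    "\<And>f. f \<in> bounded_borel \<Longrightarrow> L' f = (\<integral>x. f x \<partial>M')" by (rule daniell_representation[OF L']) (rule that; blast)
  interpret M: finite_measure M by fact
  interpret M': finite_measure M' by fact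
  have em: "emeasure M A = ennreal (L (indicator A))" "emeasure M' A = ennreal (L' (indicator A))"
    "0 \<le> L (indicator A)" "0 \<le> L' (indicator A)"
    if "A \<in> sets borel" for A
    using that M(2,3) M'(2,3) bounded_borel_indicator[OF that]
    by (simp_all add: M.emeasure_eq_measure M'.emeasure_eq_measure)
  have sM: "sets M' = sets M" using M(2) M'(2) by simp
  obtain Y where Y: "Y \<in> sets borel"
    "\<And>X. X \<in> sets borel \<Longrightarrow> X \<subseteq> Y \<Longrightarrow> emeasure M' X \<le> emeasure M X"
    "\<And>X. X \<in> sets borel \<Longrightarrow> X \<inter> Y = {} \<Longrightarrow> emeasure M X \<le> emeasure M' X"
    using finite_unsigned_Hahn_decomposition[OF M(1) M'(1) sM] unfolding M(2) by blast
  have Yc: "- Y \<in> sets borel" using Y(1) by auto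
  have inter: "(\<lambda>x. indicator A x * indicator B x) = (indicator (A \<inter> B) :: 'a \<Rightarrow> real)" for A B
    by (auto simp: indicator_def)
  show ?thesis
  proof (rule that[OF Y(1)])
    show "daniell (\<lambda>f. L (\<lambda>x. f x * indicator Y x) - L' (\<lambda>x. f x * indicator Y x))"
    proof (rule daniell_minus[OF daniell_restrict[OF L Y(1)] daniell_restrict[OF L' Y(1)]])
      fix A :: "'a set" assume "A \<in> sets borel"
      then have AY: "A \<inter> Y \<in> sets borel" using Y(1) by auto
      show "L' (\<lambda>x. indicator A x * indicator Y x) \<le> L (\<lambda>x. indicator A x * indicator Y x)"
        using Y(2)[OF AY] em[OF AY] by (simp add: inter)
    qed
    show "daniell (\<lambda>f. L' (\<lambda>x. f x * indicator (-Y) x) - L (\<lambda>x. f x * indicator (-Y) x))"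
    proof (rule daniell_minus[OF daniell_restrict[OF L' Yc] daniell_restrict[OF L Yc]])
      fix A :: "'a set" assume "A \<in> sets borel"
      then have AY: "A \<inter> -Y \<in> sets borel" using Y(1) by auto
      show "L (\<lambda>x. indicator A x * indicator (-Y) x) \<le> L' (\<lambda>x. indicator A x * indicator (-Y) x)"
        using Y(3)[OF AY] em[OF AY] by (simp add: inter Int_assoc)
    qed
  qed
qed

lemma daniell_eq_0:
  fixes L :: "('a::topological_space \<Rightarrow> real) \<Rightarrow> real"
  assumes L: "daniell L" and D: "D \<in> sets borel" "L (indicator (-D)) = 0"
    and g: "g \<in> bounded_borel" "\<And>x. 0 \<le> g x" "\<And>x. x \<in> D \<Longrightarrow> 0 < g x" "L g = 0"
    and f: "f \<in> bounded_borel"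
  shows "L f = 0"
proof -
  obtain M where M: "finite_measure M" "sets M = sets borel"
    "\<And>f. f \<in> bounded_borel \<Longrightarrow> L f = (\<integral>x. f x \<partial>M)" by (rule daniell_representation[OF L]) (rule that; blast)
  interpret M: finite_measure M by fact
  have "AE x in M. g x = 0"
    using integrable_bounded_borel[OF g(1) M(2,1)] g(2,4) M(3)[OF g(1)]
    by (subst integral_nonneg_eq_0_iff_AE[symmetric]) auto
  moreover have "AE x in M. x \<notin> -D"
  proof -
    have cD: "-D \<in> sets borel" using D(1) by auto
    then have "emeasure M (-D) = 0"
      using M(3)[OF bounded_borel_indicator[OF cD]] D(2) M(2) by (simp add: M.emeasure_eq_measure)
    then show ?thesis using cD M(2) by (intro AE_not_in) auto
  qed
  ultimately have "AE x in M. f x = 0"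
    by eventually_elim (use g(3) in force)
  then have "(\<integral>x. f x \<partial>M) = 0" by (rule integral_eq_zero_AE)
  then show ?thesis using M(3)[OF f] by simp
qed

text \<open>
  A bounded positive kernel on the whole space, carried by \<open>D\<close> in its second argument, regarded as an
  operator on bounded Borel functions.
\<close>

locale kernel_operator =
  fixes G :: "('a::topological_space \<Rightarrow> real) \<Rightarrow> 'a \<Rightarrow> real" and D :: "'a set"
  assumes daniell_kernel: "daniell (\<lambda>f. G f x)"
    and bounded_kernel: "f \<in> bounded_borel \<Longrightarrow> G f \<in> bounded_borel"
    and D_borel [measurable]: "D \<in> sets borel"
    and kernel_outside: "G (indicator (-D)) x = 0"
begin

lemma kernel_nonneg: "f \<in> bounded_borel \<Longrightarrow> (\<And>x. 0 \<le> f x) \<Longrightarrow> 0 \<le> G f x"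
  by (rule daniell_nonneg[OF daniell_kernel])

lemma kernel_abs_le: "f \<in> bounded_borel \<Longrightarrow> (\<And>x. \<bar>f x\<bar> \<le> b) \<Longrightarrow> \<bar>G f x\<bar> \<le> b * G (\<lambda>x. 1) x"
  by (rule daniell_abs_le[OF daniell_kernel])

lemma daniell_comp_kernel:
  assumes L: "daniell L"
  shows "daniell (\<lambda>f. L (G f))"
proof (rule daniellI)
  fix f g :: "'a \<Rightarrow> real" assume fg: "f \<in> bounded_borel" "g \<in> bounded_borel"
  show "L (G (\<lambda>x. f x + g x)) = L (G f) + L (G g)"
    unfolding daniell_add[OF L bounded_kernel[OF fg(1)] bounded_kernel[OF fg(2)], symmetric]
    by (rule arg_cong[of _ _ L], rule ext) (rule daniell_add[OF daniell_kernel fg])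
next
  fix f :: "'a \<Rightarrow> real" and c assume f: "f \<in> bounded_borel"
  show "L (G (\<lambda>x. c * f x)) = c * L (G f)"
    unfolding daniell_cmult[OF L bounded_kernel[OF f], symmetric]
    by (rule arg_cong[of _ _ L], rule ext) (rule daniell_cmult[OF daniell_kernel f])
next
  fix f :: "'a \<Rightarrow> real" assume "f \<in> bounded_borel" "\<And>x. 0 \<le> f x"
  then show "0 \<le> L (G f)" by (intro daniell_nonneg[OF L] bounded_kernel kernel_nonneg)
next
  fix F :: "nat \<Rightarrow> 'a \<Rightarrow> real" and g b
  assume F: "\<And>n. F n \<in> bounded_borel" "\<And>n x. \<bar>F n x\<bar> \<le> b" "\<And>x. (\<lambda>n. F n x) \<longlonglongrightarrow> g x"
  obtain C where C: "\<And>x. \<bar>G (\<lambda>x. 1) x\<bar> \<le> C"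
    using bounded_kernel[OF bounded_borel_const] by (metis bounded_borel_bound)
  have "0 \<le> b" using F(2)[of 0 undefined] by linarith
  show "(\<lambda>n. L (G (F n))) \<longlonglongrightarrow> L (G g)"
  proof (rule daniell_limit[OF L, of _ "b * C"])
    show "\<bar>G (F n) x\<bar> \<le> b * C" for n x
    proof -
      have "\<bar>G (F n) x\<bar> \<le> b * G (\<lambda>x. 1) x" by (rule kernel_abs_le[OF F(1,2)])
      also have "\<dots> \<le> b * C" using \<open>0 \<le> b\<close> C[of x] by (intro mult_left_mono) auto
      finally show ?thesis .
    qed
    show "(\<lambda>n. G (F n) x) \<longlonglongrightarrow> G g x" for x by (rule daniell_limit[OF daniell_kernel F])
  qed (rule bounded_kernel[OF F(1)])
qed

text \<open>
  Irreducibility is stated for indicators; this transfers it to the weighted indicators that occur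
  once the eigenfunction \<open>h\<close> enters.
\<close>

lemma kernel_positive_on_set:
  assumes h: "h \<in> bounded_borel" "\<And>x. 0 \<le> h x" "\<And>x. x \<in> D \<Longrightarrow> 0 < h x"
    and Y: "Y \<in> sets borel" "0 < G (indicator Y) x"
  shows "0 < G (\<lambda>y. h y * indicator Y y) x"
proof (rule ccontr)
  let ?L = "\<lambda>f. G (\<lambda>y. f y * indicator Y y) x"
  have L: "daniell ?L" by (rule daniell_restrict[OF daniell_kernel Y(1)])
  assume "\<not> 0 < ?L h"
  then have h0: "?L h = 0" using daniell_nonneg[OF L h(1,2)] by auto
  have "?L (indicator (-D)) \<le> G (indicator (-D)) x"
  proof (rule daniell_mono[OF daniell_kernel])
    show "indicator (-D) \<in> bounded_borel" by (rule bounded_borel_indicator) simp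
    then show "(\<lambda>y. indicator (-D) y * indicator Y y) \<in> bounded_borel"
      by (rule bounded_borel_mult[OF _ bounded_borel_indicator[OF Y(1)]])
  qed (auto simp: indicator_def)
  moreover have "0 \<le> ?L (indicator (-D))"
    by (rule daniell_nonneg[OF L bounded_borel_indicator]) auto
  ultimately have L0: "?L (indicator (-D)) = 0" using kernel_outside[of x] by linarith
  have "?L (\<lambda>x. 1) = 0"
    by (rule daniell_eq_0[where D=D and g=h, OF L D_borel L0 h(1) h(2) h(3) h0 bounded_borel_const])
  then show False using Y(2) by simp
qed

text \<open>
  Testing with \<open>h\<close> forces \<open>r1 = r2 = r\<close>. Put \<open>\<nu> = L1 - c L2\<close> with \<open>c\<close> chosen such that \<open>\<nu> h = 0\<close>, let \<open>Y\<close> be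
  a Hahn set of \<open>\<nu>\<close> with positive part \<open>\<nu>\<^sup>+\<close> on \<open>Y\<close> and negative part \<open>\<nu>\<^sup>-\<close> on its complement. Then
  \<open>r \<nu>\<^sup>+(h) = \<nu>(G(h 1\<^sub>Y)) \<le> \<nu>\<^sup>+(G(h 1\<^sub>Y)) \<le> \<nu>\<^sup>+(G h) = r \<nu>\<^sup>+(h)\<close>,
  so equality holds throughout: \<open>\<nu>\<^sup>-(G(h 1\<^sub>Y)) = 0\<close> and \<open>\<nu>\<^sup>+(G(h 1\<^sub>-\<^sub>Y)) = 0\<close>. By irreducibility one of the two integrands is
  positive on all of \<open>D\<close>, hence \<open>\<nu>\<^sup>-\<close> or \<open>\<nu>\<^sup>+\<close> vanishes, and then the other one does because \<open>\<nu> h = 0\<close>.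
\<close>

theorem eigenfunctional_unique:
  assumes h: "h \<in> bounded_borel" "\<And>x. 0 \<le> h x" "\<And>x. x \<in> D \<Longrightarrow> 0 < h x" "\<And>x. G h x = r * h x"
    and irred: "\<And>A. A \<in> sets borel \<Longrightarrow>
      (\<forall>x\<in>D. 0 < G (indicator A) x) \<or> (\<forall>x\<in>D. 0 < G (indicator (-A)) x)"
    and L1: "daniell L1" "L1 (\<lambda>x. 1) = 1" "L1 (indicator (-D)) = 0" "\<And>f. f \<in> bounded_borel \<Longrightarrow> L1 (G f) = r1 * L1 f"
    and L2: "daniell L2" "L2 (\<lambda>x. 1) = 1" "L2 (indicator (-D)) = 0" "\<And>f. f \<in> bounded_borel \<Longrightarrow> L2 (G f) = r2 * L2 f"
    and f: "f \<in> bounded_borel"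
  shows "L1 f = L2 f"
proof -
  have Gh: "G h = (\<lambda>x. r * h x)" using h(4) by auto
  have eig: "r' = r \<and> 0 < L h"
    if L: "daniell L" "L (\<lambda>x. 1) = 1" "L (indicator (-D)) = 0" "\<And>f. f \<in> bounded_borel \<Longrightarrow> L (G f) = r' * L f" for L r'
  proof -
    have "L h \<noteq> 0"
      using daniell_eq_0[where D=D and g=h, OF L(1) D_borel L(3) h(1) h(2) h(3) _ bounded_borel_const, of 1] L(2)
      by linarith
    moreover have "r * L h = r' * L h"
      using L(4)[OF h(1)] daniell_cmult[OF L(1) h(1), of r] by (simp add: Gh)
    moreover have "0 \<le> L h" by (rule daniell_nonneg[OF L(1) h(1,2)])
    ultimately show ?thesis by auto
  qed
  have r1: "r1 = r" "0 < L1 h" using eig[OF L1] by auto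
  have r2: "r2 = r" "0 < L2 h" using eig[OF L2] by auto
  define c where "c = L1 h / L2 h"
  have c: "0 < c" unfolding c_def using r1 r2 by simp
  define L3 where "L3 f = c * L2 f" for f
  have L3: "daniell L3" unfolding L3_def by (rule daniell_scale[OF L2(1)]) (use c in simp)
  have L3h: "L3 h = L1 h" unfolding L3_def c_def using r2 by simp
  have L3G: "L3 (G f) = r * L3 f" if "f \<in> bounded_borel" for f
    unfolding L3_def using L2(4)[OF that] r2(1) by simp
  have L1G: "L1 (G f) = r * L1 f" if "f \<in> bounded_borel" for f
    using L1(4)[OF that] r1(1) by simp
  obtain Y where Y: "Y \<in> sets borel"
    and dp: "daniell (\<lambda>f. L1 (\<lambda>x. f x * indicator Y x) - L3 (\<lambda>x. f x * indicator Y x))" (is "daniell ?p")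
    and dn: "daniell (\<lambda>f. L3 (\<lambda>x. f x * indicator (-Y) x) - L1 (\<lambda>x. f x * indicator (-Y) x))" (is "daniell ?n")
    by (rule daniell_Hahn[OF L1(1) L3])
  have Yc: "-Y \<in> sets borel" using Y by auto
  let ?\<nu> = "\<lambda>f. L1 f - L3 f"
  have bY: "(\<lambda>x. f x * indicator Y x) \<in> bounded_borel" "(\<lambda>x. f x * indicator (-Y) x) \<in> bounded_borel"
    if "f \<in> bounded_borel" for f :: "'a \<Rightarrow> real"
    using that Y Yc by (auto intro!: bounded_borel_mult bounded_borel_indicator)
  have split: "(\<lambda>x. f x * indicator Y x + f x * indicator (-Y) x) = f" for f :: "'a \<Rightarrow> real"
    by (auto simp: indicator_def)
  have split': "f x * indicator Y x + f x * indicator (-Y) x = f x" for f :: "'a \<Rightarrow> real" and x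
    by (auto simp: indicator_def)
  have \<nu>_split: "?\<nu> f = ?p f - ?n f" if "f \<in> bounded_borel" for f
    using daniell_add[OF L1(1) bY[OF that]] daniell_add[OF L3 bY[OF that]] by (simp add: split)
  define u where "u = G (\<lambda>x. h x * indicator Y x)"
  define v where "v = G (\<lambda>x. h x * indicator (-Y) x)"
  have u: "u \<in> bounded_borel" "\<And>x. 0 \<le> u x" and v: "v \<in> bounded_borel" "\<And>x. 0 \<le> v x"
    unfolding u_def v_def using bY[OF h(1)] h(2)
    by (auto intro!: bounded_kernel kernel_nonneg)
  have uv: "u x + v x = r * h x" for x
    using daniell_add[OF daniell_kernel bY[OF h(1)], of x] h(4)[of x] by (simp add: split' u_def v_def)
  have \<nu>h: "?\<nu> h = 0" using L3h by simp
  have ph: "?p h = ?n h" using \<nu>_split[OF h(1)] \<nu>h by simp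
  have "?\<nu> u = r * ?\<nu> (\<lambda>x. h x * indicator Y x)"
    unfolding u_def using L1G[OF bY(1)[OF h(1)]] L3G[OF bY(1)[OF h(1)]] by (simp add: right_diff_distrib)
  then have "?p u - ?n u = r * ?p h" using \<nu>_split[OF u(1)] by simp
  moreover have "?p u + ?p v = r * ?p h"
    using daniell_add[OF dp u(1) v(1)] daniell_cmult[OF dp h(1), of r] by (simp add: uv)
  moreover have "0 \<le> ?p v" "0 \<le> ?n u"
    using daniell_nonneg[OF dp v] daniell_nonneg[OF dn u] by auto
  ultimately have zero: "?p v = 0" "?n u = 0" by linarith+
  have outside: "L1 (\<lambda>x. indicator (-D) x * indicator B x) = 0" "L3 (\<lambda>x. indicator (-D) x * indicator B x) = 0"
    if B: "B \<in> sets borel" for B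
  proof -
    have DB: "(\<lambda>x. indicator (-D) x * indicator B x) \<in> bounded_borel"
      using B by (auto intro!: bounded_borel_mult bounded_borel_indicator)
    have "L (\<lambda>x. indicator (-D) x * indicator B x) = 0" if "daniell L" "L (indicator (-D)) = 0" for L
    proof -
      have "L (\<lambda>x. indicator (-D) x * indicator B x) \<le> L (indicator (-D))"
        by (rule daniell_mono[OF that(1) DB]) (auto simp: indicator_def)
      moreover have "0 \<le> L (\<lambda>x. indicator (-D) x * indicator B x)"
        by (rule daniell_nonneg[OF that(1) DB]) auto
      ultimately show ?thesis using that(2) by simp
    qed
    from this[OF L1(1,3)] this[OF L3] L2(3) show
      "L1 (\<lambda>x. indicator (-D) x * indicator B x) = 0" "L3 (\<lambda>x. indicator (-D) x * indicator B x) = 0"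
      by (auto simp: L3_def)
  qed
  have Dp: "?p (indicator (-D)) = 0" and Dn: "?n (indicator (-D)) = 0"
    using outside[OF Y] outside[OF Yc] by auto
  have both: "?p f = 0 \<and> ?n f = 0" if f: "f \<in> bounded_borel" for f
    using irred[OF Y]
  proof
    assume "\<forall>x\<in>D. 0 < G (indicator Y) x"
    then have pos: "0 < u x" if "x \<in> D" for x
      unfolding u_def using that by (intro kernel_positive_on_set[OF h(1,2,3) Y]) auto
    have n: "?n f = 0" if "f \<in> bounded_borel" for f
      by (rule daniell_eq_0[where D=D and g=u, OF dn D_borel Dn u(1) u(2) pos zero(2) that])
    then have "?p h = 0" using ph h(1) by simp
    then have "?p f = 0"
      by (intro daniell_eq_0[where D=D and g=h, OF dp D_borel Dp h(1) h(2) h(3) _ f])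
    with n[OF f] show ?thesis by blast
  next
    assume "\<forall>x\<in>D. 0 < G (indicator (-Y)) x"
    then have pos: "0 < v x" if "x \<in> D" for x
      unfolding v_def using that by (intro kernel_positive_on_set[OF h(1,2,3) Yc]) auto
    have p: "?p f = 0" if "f \<in> bounded_borel" for f
      by (rule daniell_eq_0[where D=D and g=v, OF dp D_borel Dp v(1) v(2) pos zero(1) that])
    then have "?n h = 0" using ph h(1) by simp
    then have "?n f = 0"
      by (intro daniell_eq_0[where D=D and g=h, OF dn D_borel Dn h(1) h(2) h(3) _ f])
    with p[OF f] show ?thesis by blast
  qed
  have eq: "L1 f = c * L2 f" if "f \<in> bounded_borel" for f
    using \<nu>_split[OF that] both[OF that] by (simp add: L3_def)
  have "c = 1" using eq[OF bounded_borel_const[of 1]] L1(2) L2(2) by simp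
  with eq[OF f] show ?thesis by simp
qed

end

section \<open>Existence of eigenfunctionals\<close>

context kernel_operator
begin

lemma kernel_iterate:
  shows daniell_iterate: "daniell (\<lambda>f. (G ^^ n) f x)"
    and bounded_iterate: "f \<in> bounded_borel \<Longrightarrow> (G ^^ n) f \<in> bounded_borel"
proof (induction n)
  case 0
  show "daniell (\<lambda>f. (G ^^ 0) f x)" using daniell_eval[of x] by simp
  show "f \<in> bounded_borel \<Longrightarrow> (G ^^ 0) f \<in> bounded_borel" by simp
next
  case (Suc n)
  show "daniell (\<lambda>f. (G ^^ Suc n) f x)"
    using daniell_comp_kernel[OF Suc.IH(1)] by (simp add: funpow_swap1)
  show "f \<in> bounded_borel \<Longrightarrow> (G ^^ Suc n) f \<in> bounded_borel"
    using Suc.IH(2) bounded_kernel by simp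
qed

definition neumann_sum :: "real \<Rightarrow> nat \<Rightarrow> 'a \<Rightarrow> real" where
  "neumann_sum s N x = (\<Sum>n<N. (G ^^ n) (\<lambda>_. 1) x / s ^ n)"

lemma iterate_one_nonneg: "0 \<le> (G ^^ n) (\<lambda>_. 1) x"
  by (rule daniell_nonneg[OF daniell_iterate]) auto

lemma bounded_neumann_sum: "neumann_sum s N \<in> bounded_borel"
proof -
  have "(\<lambda>x. \<Sum>n<N. (1 / s ^ n) * (G ^^ n) (\<lambda>_. 1) x) \<in> bounded_borel"
  proof (induction N)
    case (Suc N)
    show ?case
      unfolding sum.lessThan_Suc
      by (intro bounded_borel_add Suc bounded_borel_cmult bounded_iterate bounded_borel_const)
  qed simp
  then show ?thesis by (simp add: neumann_sum_def[abs_def])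
qed

lemma neumann_sum_Suc: "neumann_sum s (Suc N) x = 1 + G (neumann_sum s N) x / s"
proof -
  have "neumann_sum s (Suc N) x = 1 + (\<Sum>n<N. G ((G ^^ n) (\<lambda>_. 1)) x / s ^ Suc n)"
    unfolding neumann_sum_def sum.lessThan_Suc_shift by simp
  also have "(\<Sum>n<N. G ((G ^^ n) (\<lambda>_. 1)) x / s ^ Suc n) = G (neumann_sum s N) x / s"
  proof (induction N)
    case 0
    have "neumann_sum s 0 = (\<lambda>x. 0)" by (simp add: neumann_sum_def[abs_def])
    then show ?case using daniell_const[OF daniell_kernel, of 0 x] by simp
  next
    case (Suc N)
    have p: "(G ^^ N) (\<lambda>_. 1) \<in> bounded_borel" by (rule bounded_iterate[OF bounded_borel_const])
    have "neumann_sum s (Suc N) = (\<lambda>x. neumann_sum s N x + (1 / s ^ N) * (G ^^ N) (\<lambda>_. 1) x)"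
      by (simp add: neumann_sum_def[abs_def])
    then have "G (neumann_sum s (Suc N)) x = G (neumann_sum s N) x + (1 / s ^ N) * G ((G ^^ N) (\<lambda>_. 1)) x"
      by (simp only: daniell_add[OF daniell_kernel bounded_neumann_sum bounded_borel_cmult[OF p]]
          daniell_cmult[OF daniell_kernel p])
    with Suc show ?case by (simp add: add_divide_distrib)
  qed
  finally show ?thesis .
qed

text \<open>
  A bounded \<open>u\<close> of this kind dominates all partial sums of the Neumann series, and the sum of a bounded
  Neumann series is one. The formulation by an inequality makes it easy to see that the set of
  admissible \<open>s\<close> is open.
\<close>

definition supersolution :: "real \<Rightarrow> ('a \<Rightarrow> real) \<Rightarrow> bool" where
  "supersolution s u \<longleftrightarrow> u \<in> bounded_borel \<and> (\<forall>x. 0 \<le> u x \<and> 1 + G u x / s \<le> u x)"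

lemma neumann_sum_le_supersolution:
  assumes "supersolution s u" "0 < s"
  shows "neumann_sum s N x \<le> u x"
proof (induction N arbitrary: x)
  case 0 then show ?case using assms by (simp add: neumann_sum_def supersolution_def)
next
  case (Suc N)
  have "G (neumann_sum s N) x \<le> G u x"
    by (rule daniell_mono[OF daniell_kernel bounded_neumann_sum]) (use Suc assms in \<open>auto simp: supersolution_def\<close>)
  then have "1 + G (neumann_sum s N) x / s \<le> 1 + G u x / s"
    using \<open>0 < s\<close> by (simp add: divide_right_mono)
  also have "\<dots> \<le> u x" using assms by (simp add: supersolution_def)
  finally show ?case by (simp only: neumann_sum_Suc)
qed

text \<open>
  If \<open>s < r\<close>, the Neumann series at \<open>s\<close> dominates \<open>\<Sum>\<^sub>n (r/s)\<^sup>n h/\<parallel>h\<parallel>\<close>, which diverges where \<open>h\<close> is positive.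
\<close>

lemma supersolution_lower_bound:
  assumes h: "h \<in> bounded_borel" "\<And>x. 0 \<le> h x" "0 < h x0" "\<And>x. G h x = r * h x" and "0 < r"
    and u: "supersolution s u" "0 < s"
  shows "r \<le> s"
proof (rule ccontr)
  assume "\<not> r \<le> s"
  obtain b where b: "0 \<le> b" "\<And>x. \<bar>h x\<bar> \<le> b" by (rule bounded_borel_bound[OF h(1)]) (rule that; blast)
  have "0 < b" using b(2)[of x0] h(3) by linarith
  have Gh: "G h = (\<lambda>x. r * h x)" using h(4) by auto
  have it: "(G ^^ n) h = (\<lambda>x. r ^ n * h x)" for n
  proof (induction n)
    case (Suc n)
    have "(G ^^ Suc n) h x = r ^ Suc n * h x" for x
      using daniell_cmult[OF daniell_kernel h(1), of "r ^ n" x] by (simp add: Suc h(4))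
    then show ?case by auto
  qed simp
  have lower: "h x0 / b \<le> (G ^^ n) (\<lambda>_. 1) x0 / s ^ n" for n
  proof -
    have "(G ^^ n) h x0 \<le> (G ^^ n) (\<lambda>_. b) x0"
      by (rule daniell_mono[OF daniell_iterate h(1)]) (use b in \<open>auto simp: abs_le_iff\<close>)
    also have "\<dots> = b * (G ^^ n) (\<lambda>_. 1) x0" by (rule daniell_const[OF daniell_iterate])
    finally have "r ^ n * h x0 \<le> b * (G ^^ n) (\<lambda>_. 1) x0" by (simp add: it)
    moreover have "s ^ n * h x0 \<le> r ^ n * h x0"
      using \<open>\<not> r \<le> s\<close> \<open>0 < s\<close> h(3) by (intro mult_right_mono power_mono) auto
    ultimately have "s ^ n * h x0 \<le> b * (G ^^ n) (\<lambda>_. 1) x0" by linarith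
    then show ?thesis using \<open>0 < s\<close> \<open>0 < b\<close> by (simp add: field_simps)
  qed
  have "real N * (h x0 / b) \<le> u x0" for N
  proof -
    have "real N * (h x0 / b) = (\<Sum>n<N. h x0 / b)" by simp
    also have "\<dots> \<le> neumann_sum s N x0" unfolding neumann_sum_def by (rule sum_mono) (rule lower)
    also have "\<dots> \<le> u x0" by (rule neumann_sum_le_supersolution[OF u])
    finally show ?thesis .
  qed
  moreover have "0 < h x0 / b" using h(3) \<open>0 < b\<close> by simp
  ultimately show False using reals_Archimedean3 by (meson not_less)
qed

text \<open>
  Let \<open>r\<close> be the infimum of the \<open>s\<close> that admit a supersolution. If the claim failed for some \<open>j\<close>, then for
  an admissible \<open>s\<close> slightly above \<open>r\<close> the Neumann series would be bounded by a constant that depends on \<open>j\<close>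
  only: its terms tend to \<open>0\<close>, so the extra term on the left hand side disappears in the limit. Then
  twice the sum \<open>w\<close> is a supersolution for all \<open>s'\<close> with \<open>1/s'\<close> close enough to \<open>1/s\<close>, among them some \<open>s' < r\<close>.
  The term \<open>G\<^sup>N1/s\<^sup>N\<close> appears because it is the boundary term when \<open>G\<close> is applied to a partial sum.
\<close>

lemma neumann_sum_unbounded:
  assumes h: "h \<in> bounded_borel" "\<And>x. 0 \<le> h x" "0 < h x0" "\<And>x. G h x = r0 * h x" and "0 < r0"
  shows "\<exists>r\<ge>r0. \<forall>j::nat. \<exists>s x N. r \<le> s \<and> s \<le> r + 1 / Suc j \<and>
    Suc j * (1 + (G ^^ N) (\<lambda>_. 1) x / s ^ N) < neumann_sum s N x"
proof -
  define I where "I = {s. 0 < s \<and> (\<exists>u. supersolution s u)}"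
  obtain C where C: "0 \<le> C" "\<And>x. \<bar>G (\<lambda>x. 1) x\<bar> \<le> C"
    by (rule bounded_borel_bound[OF bounded_kernel[OF bounded_borel_const[of 1]]]) (rule that; blast)
  have "2 * C + 1 \<in> I"
  proof -
    have "1 + G (\<lambda>x. 2) x / (2 * C + 1) \<le> 2" for x
    proof -
      have "G (\<lambda>x. 2) x = 2 * G (\<lambda>x. 1) x" by (rule daniell_const[OF daniell_kernel])
      also have "\<dots> \<le> 2 * C + 1" using C(2)[of x] by linarith
      finally show ?thesis using C(1) by (simp add: field_simps)
    qed
    then have "supersolution (2 * C + 1) (\<lambda>x. 2)"
      by (simp add: supersolution_def)
    then show ?thesis using C(1) by (auto simp: I_def)
  qed
  then have "I \<noteq> {}" by auto
  have lower: "r0 \<le> s" if "s \<in> I" for s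
    using that supersolution_lower_bound[OF h \<open>0 < r0\<close>] by (auto simp: I_def)
  then have bdd: "bdd_below I" by (auto simp: bdd_below_def)
  define r where "r = Inf I"
  have r0: "r0 \<le> r" unfolding r_def by (rule cInf_greatest[OF \<open>I \<noteq> {}\<close> lower])
  have "0 < r" using r0 \<open>0 < r0\<close> by simp
  have r_le: "r \<le> s" if "s \<in> I" for s unfolding r_def by (rule cInf_lower[OF that bdd])
  show ?thesis
  proof (rule exI[of _ r], intro conjI r0 allI)
    fix j :: nat
    define J where "J = real (Suc j)"
    have "0 < J" by (simp add: J_def)
    show "\<exists>s x N. r \<le> s \<and> s \<le> r + 1 / Suc j \<and>
      Suc j * (1 + (G ^^ N) (\<lambda>_. 1) x / s ^ N) < neumann_sum s N x"
    proof (rule ccontr)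
      assume "\<not> ?thesis"
      then have small: "neumann_sum s N x \<le> J * (1 + (G ^^ N) (\<lambda>_. 1) x / s ^ N)"
        if "r \<le> s" "s \<le> r + 1 / J" for s x N
        using that unfolding J_def by (meson not_le)
      \<comment> \<open>the first entry makes \<open>2 w\<close> a supersolution after the change of \<open>s\<close>, the second keeps \<open>1/r - \<epsilon>\<close> positive\<close>
      define \<epsilon> where "\<epsilon> = min (1 / (4 * J * C + 1)) (1 / (2 * r))"
      have JC: "0 \<le> 4 * J * C" using C(1) \<open>0 < J\<close> by simp
      have \<epsilon>: "0 < \<epsilon>" "\<epsilon> \<le> 1 / (2 * r)" "\<epsilon> \<le> 1 / (4 * J * C + 1)"
      proof -
        have "0 < 4 * J * C + 1" using JC by linarith
        then show "0 < \<epsilon>" "\<epsilon> \<le> 1 / (2 * r)" "\<epsilon> \<le> 1 / (4 * J * C + 1)"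
          unfolding \<epsilon>_def using \<open>0 < r\<close> by simp_all
      qed
      have "1 / (2 * r) < 1 / r" using \<open>0 < r\<close> by (simp add: field_simps)
      then have \<epsilon>r: "\<epsilon> < 1 / r" using \<epsilon>(2) by linarith
      have "r < 1 / (1 / r - \<epsilon>)"
      proof -
        have "r * (1 / r - \<epsilon>) < 1" using \<epsilon>(1) \<open>0 < r\<close> by (simp add: right_diff_distrib)
        then show ?thesis using \<epsilon>r by (simp add: pos_less_divide_eq)
      qed
      then have "Inf I < min (r + 1 / J) (1 / (1 / r - \<epsilon>))"
        using \<open>0 < J\<close> by (simp add: r_def)
      from cInf_lessD[OF \<open>I \<noteq> {}\<close> this]
      obtain s where s: "s \<in> I" "s < r + 1 / J" "s < 1 / (1 / r - \<epsilon>)"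
        by auto
      have "0 < s" "r \<le> s" using s(1) r_le by (auto simp: I_def)
      obtain u where u: "supersolution s u" using s(1) by (auto simp: I_def)
      have mono: "neumann_sum s N x \<le> neumann_sum s (Suc N) x" for N x
        using iterate_one_nonneg[of N x] \<open>0 < s\<close> by (simp add: neumann_sum_def)
      have sm: "summable (\<lambda>n. (G ^^ n) (\<lambda>_. 1) x / s ^ n)" for x
        by (rule bounded_imp_summable[of _ "u x"])
          (use iterate_one_nonneg[of _ x] \<open>0 < s\<close> neumann_sum_le_supersolution[OF u \<open>0 < s\<close>, of "Suc _" x]
            in \<open>auto simp: neumann_sum_def lessThan_Suc_atMost\<close>)
      define w where "w x = (\<Sum>n. (G ^^ n) (\<lambda>_. 1) x / s ^ n)" for x
      have w: "(\<lambda>N. neumann_sum s N x) \<longlonglongrightarrow> w x" for x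
        unfolding neumann_sum_def w_def by (rule summable_LIMSEQ[OF sm])
      have Sw: "neumann_sum s N x \<le> w x" for N x
        by (rule incseq_le[OF incseq_SucI w]) (rule mono)
      have wJ: "w x \<le> 2 * J" for x
      proof -
        have "(\<lambda>N. (G ^^ N) (\<lambda>_. 1) x / s ^ N) \<longlonglongrightarrow> 0" by (rule summable_LIMSEQ_zero[OF sm])
        then have "(\<lambda>N. J * (1 + (G ^^ N) (\<lambda>_. 1) x / s ^ N)) \<longlonglongrightarrow> J * (1 + 0)"
          by (intro tendsto_intros)
        then have "w x \<le> J * (1 + 0)"
          by (rule LIMSEQ_le[OF w]) (use small[OF \<open>r \<le> s\<close>] s(2) in auto)
        then show ?thesis using \<open>0 < J\<close> by simp
      qed
      have S0: "0 \<le> neumann_sum s N x" for N x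
        unfolding neumann_sum_def using iterate_one_nonneg \<open>0 < s\<close> by (intro sum_nonneg) auto
      have SJ: "\<bar>neumann_sum s N x\<bar> \<le> 2 * J" for N x
        using S0[of N x] Sw[of N x] wJ[of x] by simp
      have w0: "0 \<le> w x" for x using S0[of 0 x] Sw[of 0 x] by linarith
      have wb: "w \<in> bounded_borel"
        by (rule bounded_borel_limit[OF bounded_neumann_sum SJ w])
      have "(\<lambda>N. 1 + G (neumann_sum s N) x / s) \<longlonglongrightarrow> 1 + G w x / s" for x
        by (intro tendsto_intros daniell_limit[OF daniell_kernel bounded_neumann_sum SJ w]) (use \<open>0 < s\<close> in simp)
      then have w_eq: "1 + G w x / s = w x" for x
        by (rule LIMSEQ_unique) (use LIMSEQ_Suc[OF w[of x]] in \<open>simp add: neumann_sum_Suc\<close>)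
      \<comment> \<open>chosen such that \<open>1/s' = 1/s + \<epsilon> > 1/r\<close>, that is \<open>s' < r\<close>\<close>
      define s' where "s' = 1 / (1 / s + \<epsilon>)"
      have "0 < s'" unfolding s'_def using \<open>0 < s\<close> \<epsilon>(1) by (intro divide_pos_pos add_pos_pos) auto
      have inv: "1 / s' = 1 / s + \<epsilon>" by (simp add: s'_def)
      have "supersolution s' (\<lambda>x. 2 * w x)"
        unfolding supersolution_def
      proof (intro conjI allI bounded_borel_cmult wb)
        fix x
        show "0 \<le> 2 * w x" using w0 by simp
        have Gw: "0 \<le> G w x" "G w x \<le> 2 * J * C"
        proof -
          have "\<bar>G w x\<bar> \<le> 2 * J * G (\<lambda>x. 1) x"
            by (rule kernel_abs_le[OF wb]) (use w0 wJ in simp)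
          also have "\<dots> \<le> 2 * J * C" using C(2)[of x] \<open>0 < J\<close> by (intro mult_left_mono) auto
          finally show "G w x \<le> 2 * J * C" by simp
          show "0 \<le> G w x" by (rule kernel_nonneg[OF wb w0])
        qed
        have "G (\<lambda>x. 2 * w x) x / s' = 2 * G w x * (1 / s')"
          by (simp add: daniell_cmult[OF daniell_kernel wb])
        also have "\<dots> = 2 * (G w x / s) + 2 * G w x * \<epsilon>" by (simp add: inv distrib_left)
        also have "2 * G w x * \<epsilon> \<le> 4 * J * C * (1 / (4 * J * C + 1))"
        proof (rule mult_mono)
          show "2 * G w x \<le> 4 * J * C" using Gw(2) by linarith
        qed (use \<epsilon> JC in auto)
        also have "\<dots> \<le> 1" using JC by (simp add: field_simps)
        finally show "1 + G (\<lambda>x. 2 * w x) x / s' \<le> 2 * w x" using w_eq[of x] by simp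
      qed
      then have "s' \<in> I" using \<open>0 < s'\<close> by (auto simp: I_def)
      moreover have "s' < r"
      proof -
        have "1 / r - \<epsilon> < 1 / s" using s(3) \<open>0 < s\<close> \<epsilon>r by (simp add: field_simps)
        then have "1 / r < 1 / s'" by (simp add: inv)
        then show ?thesis using \<open>0 < r\<close> \<open>0 < s'\<close> by (simp add: field_simps)
      qed
      ultimately show False using r_le[of s'] by simp
    qed
  qed
qed

end

lemma (in kernel_operator) kernel_restrict:
  assumes f: "f \<in> bounded_borel" "g \<in> bounded_borel" "\<And>x. x \<in> D \<Longrightarrow> f x = g x"
  shows "G f x = G g x"
proof -
  obtain M where M: "finite_measure M" "sets M = sets borel"
    "\<And>f. f \<in> bounded_borel \<Longrightarrow> G f x = (\<integral>y. f y \<partial>M)"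
    by (rule daniell_representation[OF daniell_kernel[of x]]) (rule that; blast)
  interpret M: finite_measure M by fact
  have cD: "-D \<in> sets borel" by simp
  have "emeasure M (-D) = 0"
    using M(3)[OF bounded_borel_indicator[OF cD]] kernel_outside[of x] M(2) by (simp add: M.emeasure_eq_measure)
  then have ae: "AE y in M. y \<notin> -D" using cD M(2) by (intro AE_not_in) auto
  have "(\<integral>y. f y \<partial>M) = (\<integral>y. g y \<partial>M)"
  proof (rule integral_cong_AE)
    show "AE y in M. f y = g y" using ae by eventually_elim (simp add: f(3))
  qed (use f(1,2) in \<open>simp_all add: measurable_cong_sets[OF M(2) refl] bounded_borel_iff\<close>)
  then show ?thesis using M(3) f(1,2) by simp
qed

text \<open>
  The normalised partial sums \<open>L j\<close> at the points provided by \<open>neumann_sum_unbounded\<close> satisfy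
  \<open>L j (G f) = s j L j f + O(1/j)\<close> by telescoping. They are carried by the compact set \<open>K\<close>. Let \<open>M\<close> be a
  weak limit. For \<open>f\<close> continuous on \<open>K\<close> both \<open>f\<close> and \<open>G f\<close> are test functions, so \<open>M(G f) = r M(f)\<close>. For \<open>f\<close> vanishing
  on \<open>K - D\<close> the right hand side only sees the part of \<open>M\<close> on \<open>D\<close>, and approximation of
  indicators of open sets extends \<open>M(G f) = r M(f 1\<^sub>D)\<close> to all bounded Borel \<open>f\<close>. Comparing the two
  identities at \<open>f = 1\<close> gives \<open>M(D) = 1\<close>.
\<close>

theorem eigenfunctional_exists:
  fixes G :: "('a::{metric_space, second_countable_topology} \<Rightarrow> real) \<Rightarrow> 'a \<Rightarrow> real"
  assumes "kernel_operator G D"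
    and K: "compact K" "D \<subseteq> K" "openin (top_of_set K) D"
    and off: "\<And>f x. f \<in> bounded_borel \<Longrightarrow> x \<notin> D \<Longrightarrow> G f x = 0"
    and cont: "\<And>f. f \<in> bounded_borel \<Longrightarrow> continuous_on D f \<Longrightarrow> continuous_on K (G f)"
    and h: "h \<in> bounded_borel" "\<And>x. 0 \<le> h x" "0 < h x0" "\<And>x. G h x = r0 * h x" and "0 < r0"
  shows "\<exists>r>0. \<exists>L. daniell L \<and> L (\<lambda>x. 1) = 1 \<and> L (indicator (-D)) = 0 \<and>
    (\<forall>f\<in>bounded_borel. L (G f) = r * L f)"
proof -
  interpret kernel_operator G D by fact
  obtain r where r: "r0 \<le> r"
    and "\<forall>j::nat. \<exists>s x N. r \<le> s \<and> s \<le> r + 1 / Suc j \<and>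
      Suc j * (1 + (G ^^ N) (\<lambda>_. 1) x / s ^ N) < neumann_sum s N x"
    using neumann_sum_unbounded[OF h \<open>0 < r0\<close>] by blast
  then obtain s x N where s: "\<And>j. r \<le> s j" "\<And>j. s j \<le> r + 1 / Suc j"
    and big: "\<And>j::nat. Suc j * (1 + (G ^^ N j) (\<lambda>_. 1) (x j) / s j ^ N j) < neumann_sum (s j) (N j) (x j)"
    by metis
  have "0 < r" using r \<open>0 < r0\<close> by simp
  have s0: "0 < s j" for j using s(1)[of j] \<open>0 < r\<close> by simp
  define S where "S j = neumann_sum (s j) (N j) (x j)" for j
  define e where "e j = (G ^^ N j) (\<lambda>_. 1) (x j) / s j ^ N j" for j
  have e0: "0 \<le> e j" for j
    unfolding e_def using iterate_one_nonneg s0[of j] by simp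
  have S: "Suc j * (1 + e j) < S j" for j using big unfolding S_def e_def .
  have S1: "1 < S j" for j
  proof -
    have "1 * (1 + 0) \<le> Suc j * (1 + e j)" using e0[of j] by (intro mult_mono) auto
    then show ?thesis using S[of j] by simp
  qed
  define L where "L j f = (1 / S j) * (\<Sum>n<N j. (1 / s j ^ n) * (G ^^ n) f (x j))" for j f
  have dL: "daniell (L j)" for j
    unfolding L_def using S1[of j] s0[of j]
    by (intro daniell_scale daniell_sum daniell_iterate) auto
  have L1: "L j (\<lambda>x. 1) = 1" for j
    using S1[of j] unfolding L_def S_def neumann_sum_def by simp
  have "x j \<in> D" for j
  proof (rule ccontr)
    assume "x j \<notin> D"
    have "neumann_sum (s j) m (x j) \<le> 1" for m
    proof (cases m)
      case (Suc k)
      then show ?thesis using off[OF bounded_neumann_sum \<open>x j \<notin> D\<close>] by (simp add: neumann_sum_Suc)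
    qed (simp add: neumann_sum_def)
    then show False using S1[of j] unfolding S_def by (simp add: not_less[symmetric])
  qed
  have LK: "L j (indicator (-K)) = 0" for j
  proof -
    have Kb: "K \<in> sets borel" using K(1) by (simp add: compact_imp_closed borel_closed)
    have bK: "indicator (-K) \<in> bounded_borel" using Kb by (intro bounded_borel_indicator) auto
    have "G (indicator (-K)) y = G (\<lambda>x. 0) y" for y
      by (rule kernel_restrict[OF bK]) (use K(2) in \<open>auto simp: indicator_def\<close>)
    then have GK: "G (indicator (-K)) = (\<lambda>y. 0)"
      using daniell_const[OF daniell_kernel, of 0] by auto
    have "(G ^^ n) (indicator (-K)) (x j) = 0" for n
    proof (cases n)
      case 0
      then show ?thesis using \<open>x j \<in> D\<close> K(2) by (auto simp: indicator_def)
    next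
      case (Suc m)
      then have "(G ^^ n) (indicator (-K)) (x j) = (G ^^ m) (\<lambda>y. 0) (x j)"
        by (simp add: funpow_swap1 GK)
      also have "\<dots> = 0" using daniell_const[OF daniell_iterate[of m "x j"], of 0] by simp
      finally show ?thesis .
    qed
    then show ?thesis by (simp add: L_def)
  qed
  have almost: "\<bar>L j (G f) - s j * L j f\<bar> \<le> s j * b / Suc j"
    if f: "f \<in> bounded_borel" "\<And>x. \<bar>f x\<bar> \<le> b" for f b j
  proof -
    define p where "p n = (G ^^ n) f (x j) / s j ^ n" for n
    have "0 \<le> b" using f(2)[of x0] by linarith
    have pN: "\<bar>p (N j)\<bar> \<le> b * e j"
      using daniell_abs_le[OF daniell_iterate f, of "N j" "x j"] s0[of j]
      by (simp add: p_def e_def divide_right_mono)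
    have p0: "\<bar>p 0\<bar> \<le> b" using f(2) by (simp add: p_def)
    have "S j * L j (G f) = (\<Sum>n<N j. s j * p (Suc n))"
      using S1[of j] s0[of j] by (simp add: L_def p_def funpow_swap1)
    also have "\<dots> = s j * (\<Sum>n<N j. p (Suc n))" by (simp add: sum_distrib_left)
    also have "(\<Sum>n<N j. p (Suc n)) = (\<Sum>n<N j. p n) + (p (N j) - p 0)"
      using sum_lessThan_telescope[of p "N j"] by (simp add: sum_subtractf)
    also have "(\<Sum>n<N j. p n) = S j * L j f"
      using S1[of j] by (simp add: L_def p_def)
    finally have "S j * (L j (G f) - s j * L j f) = s j * (p (N j) - p 0)"
      by (simp add: algebra_simps)
    then have eq: "L j (G f) - s j * L j f = s j * (p (N j) - p 0) / S j"
      using S1[of j] by (simp add: field_simps)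
    have "\<bar>p (N j) - p 0\<bar> \<le> b * (1 + e j)" using pN p0 by (simp add: distrib_left)
    also have "\<dots> \<le> b * (S j / Suc j)"
      using S[of j] \<open>0 \<le> b\<close> by (intro mult_left_mono) (simp_all add: field_simps)
    finally have "\<bar>p (N j) - p 0\<bar> / S j \<le> b / Suc j"
      using S1[of j] by (simp add: field_simps)
    then have "s j * (\<bar>p (N j) - p 0\<bar> / S j) \<le> s j * (b / Suc j)"
      using s0[of j] by (intro mult_left_mono) auto
    then show ?thesis unfolding eq using S1[of j] s0[of j] by (simp add: abs_mult)
  qed
  have "\<exists>M. finite_measure M \<and> sets M = sets borel \<and> (\<forall>f\<in>bounded_borel. L j f = (\<integral>x. f x \<partial>M))" for j
    by (rule daniell_representation[OF dL[of j]]) blast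
  then obtain \<nu> where \<nu>: "\<And>j. finite_measure (\<nu> j)" "\<And>j. sets (\<nu> j) = sets borel"
    "\<And>j f. f \<in> bounded_borel \<Longrightarrow> L j f = (\<integral>x. f x \<partial>\<nu> j)" by metis
  have Kb: "K \<in> sets borel" using K(1) by (simp add: compact_imp_closed borel_closed)
  have sp: "space (\<nu> j) = UNIV" for j using sets_eq_imp_space_eq[OF \<nu>(2)] by simp
  have prob: "prob_space (\<nu> j)" for j
  proof
    interpret finite_measure "\<nu> j" by (rule \<nu>(1))
    show "emeasure (\<nu> j) (space (\<nu> j)) = 1"
      using \<nu>(3)[OF bounded_borel_const[of 1], of j] L1[of j] by (simp add: emeasure_eq_measure)
  qed
  have mass: "measure (\<nu> j) K = 1" for j
  proof -
    interpret prob_space "\<nu> j" by (rule prob)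
    have "measure (\<nu> j) (-K) = 0"
      using \<nu>(3)[OF bounded_borel_indicator, of "-K" j] LK[of j] Kb \<nu>(2) by simp
    then show ?thesis using prob_compl[of K] Kb \<nu>(2) sp by (simp add: Compl_eq_Diff_UNIV)
  qed
  obtain \<rho> M where \<rho>: "strict_mono (\<rho> :: nat \<Rightarrow> nat)" and M: "prob_space M" "sets M = sets borel" "measure M K = 1"
    and lim: "\<And>f. continuous_on K f \<Longrightarrow>
       (\<lambda>n. \<integral>x. indicator K x * f x \<partial>\<nu> (\<rho> n)) \<longlonglongrightarrow> (\<integral>x. indicator K x * f x \<partial>M :: real)"
    using weak_limit_on_compact[where \<nu>=\<nu>, OF K(1) prob \<nu>(2) mass] by blast
  interpret M: prob_space M by fact
  note dM = daniell_integral[OF M.finite_measure_axioms M(2)]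
  have measM: "f \<in> borel_measurable M" if "f \<in> bounded_borel" for f :: "'a \<Rightarrow> real"
    using that by (simp add: measurable_cong_sets[OF M(2) refl] bounded_borel_iff)
  have aeK: "AE x in M. x \<in> K" using M.AE_in_set_eq_1[of K] M Kb by simp
  have lim': "(\<lambda>n. L (\<rho> n) f) \<longlonglongrightarrow> (\<integral>x. f x \<partial>M)"
    if f: "f \<in> bounded_borel" "continuous_on K f" for f
  proof -
    have "L j f = (\<integral>x. indicator K x * f x \<partial>\<nu> j)" for j
    proof -
      interpret prob_space "\<nu> j" by (rule prob)
      have ae: "AE x in \<nu> j. x \<in> K" using AE_in_set_eq_1[of K] mass Kb \<nu>(2) by simp
      have m: "f \<in> borel_measurable (\<nu> j)" "(\<lambda>x. indicator K x * f x) \<in> borel_measurable (\<nu> j)"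
        using f(1) bounded_borel_mult[OF bounded_borel_indicator[OF Kb] f(1)]
        by (simp_all add: measurable_cong_sets[OF \<nu>(2) refl] bounded_borel_iff)
      have "(\<integral>x. f x \<partial>\<nu> j) = (\<integral>x. indicator K x * f x \<partial>\<nu> j)"
        by (rule integral_cong_AE[OF m]) (use ae in eventually_elim, simp)
      then show ?thesis using \<nu>(3)[OF f(1)] by simp
    qed
    moreover have "(\<integral>x. indicator K x * f x \<partial>M) = (\<integral>x. f x \<partial>M)"
    proof (rule integral_cong_AE)
      show "(\<lambda>x. indicator K x * f x) \<in> borel_measurable M"
        by (rule measM) (intro bounded_borel_mult bounded_borel_indicator Kb f)
      show "AE x in M. indicator K x * f x = f x" using aeK by eventually_elim simp
    qed (rule measM[OF f(1)])
    ultimately show ?thesis using lim[OF f(2)] by simp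
  qed
  have s_lim: "(\<lambda>n. s (\<rho> n)) \<longlonglongrightarrow> r"
  proof -
    have "s \<longlonglongrightarrow> r"
    proof (rule tendsto_sandwich[where f="\<lambda>_. r" and h="\<lambda>j. r + 1 / Suc j"])
      have "(\<lambda>j. r + 1 / Suc j) \<longlonglongrightarrow> r + 0"
        by (intro tendsto_intros LIMSEQ_Suc[OF lim_1_over_n])
      then show "(\<lambda>j. r + 1 / Suc j) \<longlonglongrightarrow> r" by simp
    qed (use s in auto)
    from LIMSEQ_subseq_LIMSEQ[OF this \<rho>] show ?thesis by (simp add: o_def)
  qed
  have eig_cont: "(\<integral>x. G f x \<partial>M) = r * (\<integral>x. f x \<partial>M)"
    if f: "f \<in> bounded_borel" "continuous_on K f" for f
  proof -
    obtain b where b: "0 \<le> b" "\<And>x. \<bar>f x\<bar> \<le> b" by (rule bounded_borel_bound[OF f(1)]) (rule that; blast)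
    have "continuous_on K (G f)" by (rule cont[OF f(1) continuous_on_subset[OF f(2) K(2)]])
    then have "(\<lambda>n. L (\<rho> n) (G f)) \<longlonglongrightarrow> (\<integral>x. G f x \<partial>M)" by (rule lim'[OF bounded_kernel[OF f(1)]])
    moreover have "(\<lambda>n. s (\<rho> n) * L (\<rho> n) f) \<longlonglongrightarrow> r * (\<integral>x. f x \<partial>M)"
      by (intro tendsto_mult s_lim lim' f)
    ultimately have l1: "(\<lambda>n. L (\<rho> n) (G f) - s (\<rho> n) * L (\<rho> n) f) \<longlonglongrightarrow> (\<integral>x. G f x \<partial>M) - r * (\<integral>x. f x \<partial>M)"
      by (rule tendsto_diff)
    have "(\<lambda>n. s (\<rho> n) * b * (1 / Suc (\<rho> n))) \<longlonglongrightarrow> r * b * 0"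
    proof (intro tendsto_intros s_lim)
      show "(\<lambda>n. 1 / Suc (\<rho> n)) \<longlonglongrightarrow> 0"
        using LIMSEQ_subseq_LIMSEQ[OF LIMSEQ_Suc[OF lim_1_over_n] \<rho>] by (simp add: o_def)
    qed
    then have "(\<lambda>n. s (\<rho> n) * b / Suc (\<rho> n)) \<longlonglongrightarrow> 0" by simp
    then have "(\<lambda>n. L (\<rho> n) (G f) - s (\<rho> n) * L (\<rho> n) f) \<longlonglongrightarrow> 0"
      by (rule Lim_null_comparison[rotated]) (use almost[OF f(1) b(2)] in simp)
    from LIMSEQ_unique[OF this l1] show ?thesis by simp
  qed
  let ?La = "\<lambda>f. \<integral>x. G f x \<partial>M"
  let ?Lb = "\<lambda>f. r * (\<integral>x. f x * indicator D x \<partial>M)"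
  have da: "daniell ?La" by (rule daniell_comp_kernel[OF dM])
  have db: "daniell ?Lb"
    by (rule daniell_scale[OF daniell_restrict[OF dM D_borel]]) (use \<open>0 < r\<close> in simp)
  have vanish: "?La f = ?Lb f"
    if f: "f \<in> bounded_borel" "continuous_on K f" "\<And>x. x \<in> K - D \<Longrightarrow> f x = 0" for f
  proof -
    have "(\<integral>x. f x \<partial>M) = (\<integral>x. f x * indicator D x \<partial>M)"
    proof (rule integral_cong_AE)
      show "(\<lambda>x. f x * indicator D x) \<in> borel_measurable M"
        by (rule measM) (intro bounded_borel_mult bounded_borel_indicator D_borel f)
      show "AE x in M. f x = f x * indicator D x"
        using aeK by eventually_elim (use f(3) in \<open>auto simp: indicator_def\<close>)
    qed (rule measM[OF f(1)])
    then show ?thesis using eig_cont[OF f(1,2)] by simp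
  qed
  have "?La f = ?Lb f" if "f \<in> bounded_borel" for f
  proof (rule daniell_eq_open[OF da db _ that])
    fix U :: "'a set" assume "open U"
    obtain W where W: "open W" "D = K \<inter> W" using K(3) by (auto simp: openin_open)
    define C where "C = K - (D \<inter> U)"
    \<comment> \<open>\<open>C\<close> is the set where test functions must vanish; it contains \<open>K - D\<close>, and \<open>D - C = D \<inter> U\<close>\<close>
    have "C = K - (W \<inter> U)" unfolding C_def using W(2) by auto
    then have "closed C" using W(1) \<open>open U\<close> compact_imp_closed[OF K(1)] by auto
    have bU: "indicator U \<in> bounded_borel" using \<open>open U\<close> by (intro bounded_borel_indicator) auto
    have bC: "indicator (-C) \<in> bounded_borel" using \<open>closed C\<close> by (intro bounded_borel_indicator) auto
    have DC: "x \<in> D \<Longrightarrow> indicator U x = (indicator (-C) x :: real)" for x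
      unfolding C_def using K(2) by (auto simp: indicator_def)
    have "G (indicator U) y = G (indicator (-C)) y" for y
      by (rule kernel_restrict[OF bU bC DC])
    then have 1: "?La (indicator U) = ?La (indicator (-C))" by simp
    have "(\<lambda>x. indicator U x * indicator D x) = (\<lambda>x. indicator (-C) x * indicator D x :: real)"
      using DC by (auto simp: indicator_def)
    then have 2: "?Lb (indicator U) = ?Lb (indicator (-C))" by simp
    have "open (- C)" using \<open>closed C\<close> unfolding closed_def .
    from open_indicator_approx[OF this] obtain F :: "nat \<Rightarrow> 'a \<Rightarrow> real"
      where F: "\<forall>n. continuous_on UNIV (F n) \<and> (\<forall>x. 0 \<le> F n x \<and> F n x \<le> 1) \<and>
        (\<forall>x. x \<notin> - C \<longrightarrow> F n x = 0) \<and> (\<forall>x. (\<lambda>n. F n x) \<longlonglongrightarrow> indicator (- C) x)" ..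
    have Fc: "continuous_on UNIV (F n)" and F01: "0 \<le> F n x" "F n x \<le> 1"
      and FC: "x \<in> C \<Longrightarrow> F n x = 0" and Flim: "(\<lambda>n. F n x) \<longlonglongrightarrow> indicator (-C) x" for n x
      using F by simp_all
    have Fabs: "\<bar>F n x\<bar> \<le> 1" for n x using F01[of n x] by simp
    have Fb: "F n \<in> bounded_borel" for n
      by (rule bounded_borelI[OF borel_measurable_continuous_onI[OF Fc] Fabs])
    have "?La (F n) = ?Lb (F n)" for n
      by (rule vanish[OF Fb continuous_on_subset[OF Fc]]) (auto intro!: FC simp: C_def)
    then have "(\<lambda>n. ?La (F n)) \<longlonglongrightarrow> ?Lb (indicator (-C))"
      using daniell_limit[OF db Fb Fabs Flim] by simp
    then have "?La (indicator (-C)) = ?Lb (indicator (-C))"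
      by (rule LIMSEQ_unique[OF daniell_limit[OF da Fb Fabs Flim]])
    then show "?La (indicator U) = ?Lb (indicator U)" unfolding 1 2 .
  qed
  note eig = this
  have "r = r * (\<integral>x. indicator D x \<partial>M)"
    using eig[OF bounded_borel_const[of 1]] eig_cont[OF bounded_borel_const[of 1]] M.prob_space by simp
  then have D1: "measure M D = 1" using \<open>0 < r\<close> M(2) D_borel by simp
  then have aeD: "AE x in M. x \<in> D" using M.AE_in_set_eq_1[of D] M D_borel by simp
  have "(\<integral>x. f x * indicator D x \<partial>M) = (\<integral>x. f x \<partial>M)" if "f \<in> bounded_borel" for f
  proof (rule integral_cong_AE)
    show "(\<lambda>x. f x * indicator D x) \<in> borel_measurable M"
      by (rule measM) (intro bounded_borel_mult bounded_borel_indicator D_borel that)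
    show "AE x in M. f x * indicator D x = f x" using aeD by eventually_elim simp
  qed (rule measM[OF that])
  then have "\<forall>f\<in>bounded_borel. (\<integral>x. G f x \<partial>M) = r * (\<integral>x. f x \<partial>M)" using eig by simp
  moreover have "(\<integral>x. indicator (-D) x \<partial>M) = (0::real)"
    using M.prob_compl[of D] D1 M(2) D_borel sets_eq_imp_space_eq[OF M(2)] by (simp add: Compl_eq_Diff_UNIV)
  ultimately show ?thesis
    using dM \<open>0 < r\<close> M.prob_space by (intro exI[of _ r] conjI exI[of _ "\<lambda>f. \<integral>x. f x \<partial>M"]) auto
qed

section \<open>Transient semigroups and their Green operators\<close>

text \<open>
  Neither continuity at \<open>0\<close> nor \<open>Q 0 f = f\<close> can be demanded of a killed semigroup: from a point of \<open>D\<close> on the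
  boundary of the closure of \<open>D\<close> the process may leave \<open>D\<close> immediately.
\<close>

locale transient_semigroup =
  fixes Q :: "real \<Rightarrow> ('a::{metric_space, second_countable_topology} \<Rightarrow> real) \<Rightarrow> 'a \<Rightarrow> real"
    and D :: "'a set" and C c :: real
  assumes Q_daniell: "0 \<le> t \<Longrightarrow> daniell (\<lambda>f. Q t f x)"
    and Q_measurable: "f \<in> bounded_borel \<Longrightarrow>
      (\<lambda>(x, t). indicator {0..} t * Q t f x) \<in> borel_measurable (borel \<Otimes>\<^sub>M lborel)"
    and Q_semigroup: "0 \<le> s \<Longrightarrow> 0 \<le> t \<Longrightarrow> f \<in> bounded_borel \<Longrightarrow> Q (s + t) f x = Q s (Q t f) x"
    and Q_decay: "0 \<le> t \<Longrightarrow> Q t (\<lambda>_. 1) x \<le> C * exp (- c * t)"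
    and C_nonneg: "0 \<le> C" and c_pos: "0 < c"
    and D_borel: "D \<in> sets borel"
    and Q_outside: "0 \<le> t \<Longrightarrow> Q t (indicator (- D)) x = 0"
    and Q_start: "0 \<le> t \<Longrightarrow> x \<notin> D \<Longrightarrow> Q t (\<lambda>_. 1) x = 0"
begin

definition green :: "('a \<Rightarrow> real) \<Rightarrow> 'a \<Rightarrow> real" where
  "green f x = (\<integral>t. indicator {0..} t * Q t f x \<partial>lborel)"

definition envelope :: "real \<Rightarrow> real" where
  "envelope t = indicator {0..} t * (C * exp (- c * t))"

lemma integrable_exp_half_line:
  assumes "0 < (a::real)"
  shows "integrable lborel (\<lambda>t. indicator {0..} t * exp (- a * t))"
    and "(\<integral>t. indicator {0..} t * exp (- a * t) \<partial>lborel) = 1 / a"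
proof -
  have hi: "((\<lambda>t. exp (- a * t)) has_integral 1 / a) {0..}"
    using has_integral_exp_minus_to_infinity[OF assms, of 0] by simp
  then have "(\<lambda>t. exp (- a * t)) absolutely_integrable_on {0..}"
    by (intro nonnegative_absolutely_integrable_1) (auto simp: integrable_on_def)
  then have "set_integrable lborel {0..} (\<lambda>t. exp (- a * t))"
    unfolding set_integrable_def by (subst (asm) integrable_completion) auto
  then show "integrable lborel (\<lambda>t. indicator {0..} t * exp (- a * t))"
    "(\<integral>t. indicator {0..} t * exp (- a * t) \<partial>lborel) = 1 / a"
    using set_borel_integral_eq_integral(2)[of "{0..}" "\<lambda>t. exp (- a * t)"] integral_unique[OF hi]
    by (simp_all add: set_integrable_def set_lebesgue_integral_def)
qed

lemma integrable_envelope: "integrable lborel envelope"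
proof -
  have "integrable lborel (\<lambda>t. C * (indicator {0..} t * exp (- c * t)))"
    by (rule integrable_mult_right[OF integrable_exp_half_line(1)[OF c_pos]])
  then show ?thesis by (simp add: envelope_def[abs_def] mult_ac)
qed

lemma Q_abs_le:
  assumes "f \<in> bounded_borel" "\<And>x. \<bar>f x\<bar> \<le> b" "0 \<le> t"
  shows "\<bar>Q t f x\<bar> \<le> b * (C * exp (- c * t))"
proof -
  have "0 \<le> b" using assms(2)[of undefined] by linarith
  have "\<bar>Q t f x\<bar> \<le> b * Q t (\<lambda>_. 1) x" by (rule daniell_abs_le[OF Q_daniell assms(1,2)]) fact
  also have "\<dots> \<le> b * (C * exp (- c * t))" using \<open>0 \<le> b\<close> Q_decay[OF assms(3)] by (intro mult_left_mono)
  finally show ?thesis .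
qed

lemma Q_envelope:
  assumes "f \<in> bounded_borel" "\<And>x. \<bar>f x\<bar> \<le> b"
  shows "\<bar>indicator {0..} t * Q t f x\<bar> \<le> b * envelope t"
  using Q_abs_le[OF assms, of t x] by (cases "0 \<le> t") (auto simp: envelope_def)

lemma Q_measurable_time:
  assumes "f \<in> bounded_borel"
  shows "(\<lambda>t. indicator {0..} t * Q t f x) \<in> borel_measurable lborel"
proof -
  have "(\<lambda>t. (x, t)) \<in> measurable lborel (borel \<Otimes>\<^sub>M lborel)" by simp
  from measurable_compose[OF this Q_measurable[OF assms]] show ?thesis by simp
qed

lemma Q_bounded_borel:
  assumes "f \<in> bounded_borel" "0 \<le> t"
  shows "Q t f \<in> bounded_borel"
proof -
  obtain b where b: "0 \<le> b" "\<And>x. \<bar>f x\<bar> \<le> b" by (rule bounded_borel_bound[OF assms(1)]) (rule that; blast)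
  show ?thesis
  proof (rule bounded_borelI)
    have "(\<lambda>x. (x, t)) \<in> measurable borel (borel \<Otimes>\<^sub>M lborel)" by simp
    from measurable_compose[OF this Q_measurable[OF assms(1)]] show "Q t f \<in> borel_measurable borel"
      using assms(2) by simp
    show "\<bar>Q t f x\<bar> \<le> b * (C * exp (- c * t))" for x by (rule Q_abs_le[OF assms(1) b(2) assms(2)])
  qed
qed

lemma integrable_Q:
  assumes "f \<in> bounded_borel"
  shows "integrable lborel (\<lambda>t. indicator {0..} t * Q t f x)"
proof -
  obtain b where b: "0 \<le> b" "\<And>x. \<bar>f x\<bar> \<le> b" by (rule bounded_borel_bound[OF assms(1)]) (rule that; blast)
  show ?thesis
  proof (rule Bochner_Integration.integrable_bound[OF _ Q_measurable_time[OF assms]])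
    show "integrable lborel (\<lambda>t. b * envelope t)" by (rule integrable_mult_right[OF integrable_envelope])
    show "AE t in lborel. norm (indicator {0..} t * Q t f x) \<le> norm (b * envelope t)"
      using order_trans[OF Q_envelope[OF assms b(2)] abs_ge_self] by simp
  qed
qed

lemma Q_vanish_outside:
  assumes "f \<in> bounded_borel" "0 \<le> t" "x \<notin> D"
  shows "Q t f x = 0"
proof -
  obtain b where b: "0 \<le> b" "\<And>x. \<bar>f x\<bar> \<le> b" by (rule bounded_borel_bound[OF assms(1)]) (rule that; blast)
  have "\<bar>Q t f x\<bar> \<le> b * Q t (\<lambda>_. 1) x" by (rule daniell_abs_le[OF Q_daniell assms(1) b(2)]) fact
  then show ?thesis using Q_start[OF assms(2,3)] by simp
qed

lemma green_outside: "f \<in> bounded_borel \<Longrightarrow> x \<notin> D \<Longrightarrow> green f x = 0"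
  unfolding green_def by (subst integral_eq_zero_AE) (auto simp: Q_vanish_outside indicator_def)

lemma daniell_green: "daniell (\<lambda>f. green f x)"
  unfolding green_def
proof (rule daniellI)
  fix f g :: "'a \<Rightarrow> real" assume fg: "f \<in> bounded_borel" "g \<in> bounded_borel"
  have "indicator {0..} t * Q t (\<lambda>x. f x + g x) x = indicator {0..} t * Q t f x + indicator {0..} t * Q t g x" for t :: real
    using daniell_add[OF Q_daniell fg, of t x] by (cases "0 \<le> t") auto
  then show "(\<integral>t. indicator {0..} t * Q t (\<lambda>x. f x + g x) x \<partial>lborel) =
    (\<integral>t. indicator {0..} t * Q t f x \<partial>lborel) + (\<integral>t. indicator {0..} t * Q t g x \<partial>lborel)"
    by (simp add: integrable_Q fg)
next
  fix f :: "'a \<Rightarrow> real" and a assume f: "f \<in> bounded_borel"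
  have "indicator {0..} t * Q t (\<lambda>x. a * f x) x = a * (indicator {0..} t * Q t f x)" for t :: real
    using daniell_cmult[OF Q_daniell f, of t a x] by (cases "0 \<le> t") auto
  then show "(\<integral>t. indicator {0..} t * Q t (\<lambda>x. a * f x) x \<partial>lborel) = a * (\<integral>t. indicator {0..} t * Q t f x \<partial>lborel)"
    by (simp only: integral_mult_right_zero)
next
  fix f :: "'a \<Rightarrow> real" assume f: "f \<in> bounded_borel" "\<And>x. 0 \<le> f x"
  have "0 \<le> indicator {0..} t * Q t f x" for t :: real
    using daniell_nonneg[OF Q_daniell f, of t x] by (cases "0 \<le> t") auto
  then show "0 \<le> (\<integral>t. indicator {0..} t * Q t f x \<partial>lborel)" by simp
next
  fix F :: "nat \<Rightarrow> 'a \<Rightarrow> real" and g b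
  assume F: "\<And>n. F n \<in> bounded_borel" "\<And>n x. \<bar>F n x\<bar> \<le> b" "\<And>x. (\<lambda>n. F n x) \<longlonglongrightarrow> g x"
  have g: "g \<in> bounded_borel" by (rule bounded_borel_limit[OF F])
  show "(\<lambda>n. \<integral>t. indicator {0..} t * Q t (F n) x \<partial>lborel) \<longlonglongrightarrow> (\<integral>t. indicator {0..} t * Q t g x \<partial>lborel)"
  proof (rule integral_dominated_convergence[where w="\<lambda>t. b * envelope t"])
    show "integrable lborel (\<lambda>t. b * envelope t)" by (rule integrable_mult_right[OF integrable_envelope])
    show "AE t in lborel. (\<lambda>n. indicator {0..} t * Q t (F n) x) \<longlonglongrightarrow> indicator {0..} t * Q t g x"
    proof (rule AE_I2)
      fix t :: real
      show "(\<lambda>n. indicator {0..} t * Q t (F n) x) \<longlonglongrightarrow> indicator {0..} t * Q t g x"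
        using daniell_limit[OF Q_daniell F, of t x] by (cases "0 \<le> t") auto
    qed
    show "AE t in lborel. norm (indicator {0..} t * Q t (F n) x) \<le> b * envelope t" for n
      using Q_envelope[OF F(1,2)] by simp
  qed (rule Q_measurable_time[OF g], rule Q_measurable_time[OF F(1)])
qed

lemma green_bounded_borel:
  assumes "f \<in> bounded_borel"
  shows "green f \<in> bounded_borel"
proof -
  obtain b where b: "0 \<le> b" "\<And>x. \<bar>f x\<bar> \<le> b" by (rule bounded_borel_bound[OF assms(1)]) (rule that; blast)
  show ?thesis
  proof (rule bounded_borelI)
    show "green f \<in> borel_measurable borel"
      unfolding green_def[abs_def]
      by (rule lborel.borel_measurable_lebesgue_integral) (rule Q_measurable[OF assms])
    show "\<bar>green f x\<bar> \<le> (\<integral>t. b * envelope t \<partial>lborel)" for x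
      unfolding green_def real_norm_def[symmetric]
      by (rule Bochner_Integration.integral_norm_bound_integral[OF integrable_Q[OF assms] integrable_mult_right[OF integrable_envelope]])
        (use Q_envelope[OF assms b(2)] in simp)
  qed
qed

sublocale kernel_operator green D
proof
  show "daniell (\<lambda>f. green f x)" for x by (rule daniell_green)
  show "green f \<in> bounded_borel" if "f \<in> bounded_borel" for f by (rule green_bounded_borel[OF that])
  show "D \<in> sets borel" by (rule D_borel)
  show "green (indicator (-D)) x = 0" for x
    unfolding green_def by (subst integral_eq_zero_AE) (auto simp: Q_outside indicator_def[of "{0..}"])
qed

lemma green_Fubini:
  assumes L: "daniell L" and f: "f \<in> bounded_borel"
  shows "integrable lborel (\<lambda>t. indicator {0..} t * L (Q t f))"
    and "L (green f) = (\<integral>t. indicator {0..} t * L (Q t f) \<partial>lborel)"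
proof -
  obtain M where M: "finite_measure M" "sets M = sets borel"
    "\<And>f. f \<in> bounded_borel \<Longrightarrow> L f = (\<integral>x. f x \<partial>M)" by (rule daniell_representation[OF L]) (rule that; blast)
  interpret M: finite_measure M by fact
  interpret P: pair_sigma_finite M lborel ..
  obtain b where b: "0 \<le> b" "\<And>x. \<bar>f x\<bar> \<le> b" by (rule bounded_borel_bound[OF f]) (rule that; blast)
  have meas: "(\<lambda>(x, t). indicator {0..} t * Q t f x) \<in> borel_measurable (M \<Otimes>\<^sub>M lborel)"
    using Q_measurable[OF f] by (simp add: measurable_cong_sets[OF sets_pair_measure_cong[OF M(2) refl] refl])
  have int: "integrable (M \<Otimes>\<^sub>M lborel) (\<lambda>(x, t). indicator {0..} t * Q t f x)"
  proof (rule P.Fubini_integrable[OF meas])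
    show "AE x in M. integrable lborel (\<lambda>t. case (x, t) of (x, t) \<Rightarrow> indicator {0..} t * Q t f x)"
      using integrable_Q[OF f] by simp
    show "integrable M (\<lambda>x. \<integral>t. norm (case (x, t) of (x, t) \<Rightarrow> indicator {0..} t * Q t f x) \<partial>lborel)"
    proof (rule M.integrable_const_bound[where B="\<integral>t. b * envelope t \<partial>lborel"])
      have "norm (\<integral>t. norm (case (x, t) of (x, t) \<Rightarrow> indicator {0..} t * Q t f x) \<partial>lborel) \<le> (\<integral>t. b * envelope t \<partial>lborel)" for x
        using integrable_Q[OF f, of x] Q_envelope[OF f b(2)]
        by (intro Bochner_Integration.integral_norm_bound_integral integrable_mult_right[OF integrable_envelope]) auto
      then show "AE x in M. norm (\<integral>t. norm (case (x, t) of (x, t) \<Rightarrow> indicator {0..} t * Q t f x) \<partial>lborel) \<le> (\<integral>t. b * envelope t \<partial>lborel)"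
        by (intro AE_I2)
      show "(\<lambda>x. \<integral>t. norm (case (x, t) of (x, t) \<Rightarrow> indicator {0..} t * Q t f x) \<partial>lborel) \<in> borel_measurable M"
        by (rule lborel.borel_measurable_lebesgue_integral) (use meas in \<open>simp add: case_prod_beta'\<close>)
    qed
  qed
  have sec: "(\<integral>x. indicator {0..} t * Q t f x \<partial>M) = indicator {0..} t * L (Q t f)" for t
    using M(3)[OF Q_bounded_borel[OF f, of t]] by (cases "0 \<le> t") auto
  have "L (green f) = (\<integral>x. \<integral>t. indicator {0..} t * Q t f x \<partial>lborel \<partial>M)"
    using M(3)[OF green_bounded_borel[OF f]] by (simp add: green_def)
  also have "\<dots> = (\<integral>t. \<integral>x. indicator {0..} t * Q t f x \<partial>M \<partial>lborel)"
    by (rule P.Fubini_integral[OF int, symmetric])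
  finally show "L (green f) = (\<integral>t. indicator {0..} t * L (Q t f) \<partial>lborel)" by (simp only: sec)
  show "integrable lborel (\<lambda>t. indicator {0..} t * L (Q t f))"
    using P.integrable_snd[OF int] by (simp only: sec)
qed

lemma green_eigen_if_decay:
  assumes L: "daniell L" and f: "f \<in> bounded_borel" and "0 < lam"
    and "\<And>t. 0 \<le> t \<Longrightarrow> L (Q t f) = exp (- lam * t) * L f"
  shows "L (green f) = 1 / lam * L f"
proof -
  have eq: "indicator {0..} t * L (Q t f) = indicator {0..} t * exp (- lam * t) * L f" for t
    using assms(4)[of t] by (cases "0 \<le> t") auto
  then have "L (green f) = (\<integral>t. indicator {0..} t * exp (- lam * t) * L f \<partial>lborel)"
    by (simp only: green_Fubini(2)[OF L f] eq)
  also have "\<dots> = (\<integral>t. indicator {0..} t * exp (- lam * t) \<partial>lborel) * L f"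
    by (rule integral_mult_left_zero)
  finally show ?thesis by (simp only: integrable_exp_half_line(2)[OF \<open>0 < lam\<close>])
qed

text \<open>
  With \<open>\<phi> t = L (Q t f)\<close>, the eigenvalue equation for \<open>Q t f\<close> reads \<open>r \<phi> t = \<integral>\<^sub>t\<^sup>\<infinity> \<phi>\<close>. The right hand side is
  continuous in \<open>t\<close>, hence so is \<open>\<phi>\<close>, hence the right hand side is differentiable and \<open>\<phi>' = - \<phi>/r\<close>. At \<open>t = 0\<close> the integral is
  also \<open>L (green f) = r L f\<close>, which gives \<open>\<phi> 0 = L f\<close> although \<open>Q 0\<close> may differ from the identity.
\<close>

lemma decay_if_green_eigen:
  assumes L: "daniell L" and "0 < r" and eig: "\<And>f. f \<in> bounded_borel \<Longrightarrow> L (green f) = r * L f"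
    and f: "f \<in> bounded_borel" and "0 \<le> t"
  shows "L (Q t f) = exp (- t / r) * L f"
proof -
  define \<phi> where "\<phi> t = L (Q t f)" for t
  have int: "set_integrable lborel {0..} \<phi>"
    using green_Fubini(1)[OF L f] by (simp add: set_integrable_def \<phi>_def)
  have tail: "r * \<phi> t = (LINT u:{t..}|lborel. \<phi> u)" if "0 \<le> t" for t
  proof -
    have "L (Q s (Q t f)) = \<phi> (s + t)" if "0 \<le> s" for s
    proof -
      have "Q (s + t) f = Q s (Q t f)" by (rule ext) (rule Q_semigroup[OF that \<open>0 \<le> t\<close> f])
      then show ?thesis by (simp add: \<phi>_def)
    qed
    then have eq: "indicator {0..} s * L (Q s (Q t f)) = indicator {t..} (t + 1 * s) * \<phi> (t + 1 * s)" for s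
      by (cases "0 \<le> s") (auto simp: add.commute)
    have "r * \<phi> t = L (green (Q t f))" unfolding \<phi>_def by (rule eig[OF Q_bounded_borel[OF f that], symmetric])
    also have "\<dots> = (\<integral>s. indicator {t..} (t + 1 * s) * \<phi> (t + 1 * s) \<partial>lborel)"
      by (simp only: green_Fubini(2)[OF L Q_bounded_borel[OF f that]] eq)
    also have "\<dots> = (\<integral>u. indicator {t..} u * \<phi> u \<partial>lborel)"
      using lborel_integral_real_affine[of 1 "\<lambda>u. indicator {t..} u * \<phi> u" t] by simp
    finally show ?thesis by (simp add: set_lebesgue_integral_def)
  qed
  have int_t: "set_integrable lborel {t..} \<phi>" if "0 \<le> t" for t
    by (rule set_integrable_subset[OF int]) (use that in auto)
  have hk: "(\<phi> has_integral r * \<phi> t) {t..}" if "0 \<le> t" for t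
    using set_borel_integral_eq_integral[OF int_t[OF that]] tail[OF that] by (simp add: has_integral_iff)
  have ion: "\<phi> integrable_on {0..b}" for b
    using set_borel_integral_eq_integral(1)[OF set_integrable_subset[OF int, of "{0..b}"]] by simp
  have \<phi>_eq: "\<phi> t = \<phi> 0 - integral {0..t} \<phi> / r" if "0 \<le> t" for t
  proof -
    have "(\<phi> has_integral integral {0..t} \<phi> + r * \<phi> t) ({0..t} \<union> {t..})"
    proof (rule has_integral_Un[OF integrable_integral[OF ion] hk[OF that]])
      have "{0..t} \<inter> {t..} = {t}" using that by auto
      then show "negligible ({0..t} \<inter> {t..})" by simp
    qed
    moreover have "{0..t} \<union> {t..} = {0..}" using that by auto
    ultimately have "integral {0..t} \<phi> + r * \<phi> t = r * \<phi> 0"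
      using hk[of 0] by (simp add: has_integral_unique)
    then show ?thesis using \<open>0 < r\<close> by (simp add: field_simps)
  qed
  have "\<phi> 0 = L f"
  proof -
    have "r * L f = L (green f)" by (rule eig[OF f, symmetric])
    also have "\<dots> = (LINT u:{0..}|lborel. \<phi> u)"
      using green_Fubini(2)[OF L f] by (simp add: set_lebesgue_integral_def \<phi>_def)
    also have "\<dots> = r * \<phi> 0" using tail[of 0] by simp
    finally show ?thesis using \<open>0 < r\<close> by simp
  qed
  have cont: "continuous_on {0..t} \<phi>"
  proof -
    have "continuous_on {0..t} (\<lambda>u. \<phi> 0 - integral {0..u} \<phi> / r)"
      by (intro continuous_intros indefinite_integral_continuous_1 ion) (use \<open>0 < r\<close> in simp)
    then show ?thesis by (rule continuous_on_eq) (rule \<phi>_eq[symmetric], simp)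
  qed
  have der: "(\<phi> has_real_derivative - \<phi> u / r) (at u within {0..t})" if u: "u \<in> {0..t}" for u
  proof -
    have "((\<lambda>u. integral {0..u} \<phi>) has_real_derivative \<phi> u) (at u within {0..t})"
      using integral_has_real_derivative[OF cont u] .
    then have "((\<lambda>u. \<phi> 0 - integral {0..u} \<phi> / r) has_real_derivative 0 - \<phi> u / r) (at u within {0..t})"
      by (intro DERIV_diff DERIV_const DERIV_cdivide)
    then have "(\<phi> has_real_derivative 0 - \<phi> u / r) (at u within {0..t})"
      by (rule has_field_derivative_transform_within[OF _ zero_less_one u]) (rule \<phi>_eq[symmetric], simp)
    then show ?thesis by simp
  qed
  have "((\<lambda>u. \<phi> u * exp (u / r)) has_real_derivative 0) (at u within {0..t})" if "u \<in> {0..t}" for u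
    using \<open>0 < r\<close> by (auto intro!: derivative_eq_intros der[OF that])
  then obtain k where k: "\<And>u. u \<in> {0..t} \<Longrightarrow> \<phi> u * exp (u / r) = k"
    using has_field_derivative_zero_constant[of "{0..t}" "\<lambda>u. \<phi> u * exp (u / r)"] by auto
  have "\<phi> t * exp (t / r) = \<phi> 0" using k[of t] k[of 0] \<open>0 \<le> t\<close> by simp
  then have "\<phi> t = exp (- t / r) * \<phi> 0" by (simp add: exp_minus field_simps)
  then show ?thesis using \<open>\<phi> 0 = L f\<close> by (simp add: \<phi>_def)
qed

end

section \<open>Markov property for functionals of the path\<close>

lemma grid_point:
  fixes u \<delta> :: real
  assumes "0 \<le> u" "0 < \<delta>"
  obtains j :: nat where "u \<le> real j * \<delta>" "real j * \<delta> < u + \<delta>"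
proof (rule that[of "nat \<lceil>u / \<delta>\<rceil>"])
  have j: "real (nat \<lceil>u / \<delta>\<rceil>) = of_int \<lceil>u / \<delta>\<rceil>" using assms by simp
  have "u / \<delta> \<le> of_int \<lceil>u / \<delta>\<rceil>" "of_int \<lceil>u / \<delta>\<rceil> < u / \<delta> + 1" by linarith+
  then show "u \<le> real (nat \<lceil>u / \<delta>\<rceil>) * \<delta>" "real (nat \<lceil>u / \<delta>\<rceil>) * \<delta> < u + \<delta>"
    unfolding j using mult_right_mono[of "u / \<delta>" _ \<delta>] mult_strict_right_mono[of _ "u / \<delta> + 1" \<delta>] assms(2)
    by (fastforce simp: distrib_right)+
qed

locale feller_process = markov_feller_semigroup P + cadlag_markov_process P \<A> \<F> Pr X
  for P :: "real \<Rightarrow> 'a::{metric_space, second_countable_topology} \<Rightarrow> 'a measure"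
    and \<A> :: "'w measure" and \<F> :: "real \<Rightarrow> 'w measure" and Pr :: "'a \<Rightarrow> 'w measure"
    and X :: "real \<Rightarrow> 'w \<Rightarrow> 'a"
begin

lemma prob_Pr: "prob_space (Pr x)" by (rule law_prob_space)

lemma space_Pr [simp]: "space (Pr x) = space \<A>"
  by (rule sets_eq_imp_space_eq[OF sets_law])

lemma measurable_Pr: "measurable (Pr x) N = measurable \<A> N"
  by (rule measurable_cong_sets[OF sets_law refl])

lemma measurable_filtration: "0 \<le> t \<Longrightarrow> f \<in> measurable (\<F> t) N \<Longrightarrow> f \<in> measurable \<A> N"
  by (rule measurable_from_subalg[OF filtration_subalgebra])

lemma X_measurable: "0 \<le> t \<Longrightarrow> X t \<in> measurable \<A> borel"
  by (rule measurable_filtration[OF _ adapted])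

lemma AE_start: "AE \<omega> in Pr x. X 0 \<omega> = x"
proof -
  interpret prob_space "Pr x" by (rule prob_Pr)
  have "X 0 \<in> borel_measurable (Pr x)" using X_measurable[of 0] by (simp add: measurable_Pr)
  then have "{\<omega> \<in> space (Pr x). X 0 \<omega> = x} \<in> sets (Pr x)"
    using measurable_sets[of "X 0" "Pr x" borel "{x}"] by (simp add: vimage_def Int_def conj_commute)
  then show ?thesis
    using prob_Collect_eq_1[of "\<lambda>\<omega>. X 0 \<omega> = x"] starting_point[of x] by simp
qed

lemma integrable_bounded:
  assumes "Y \<in> borel_measurable \<A>" "\<And>\<omega>. \<bar>Y \<omega>\<bar> \<le> (b::real)"
  shows "integrable (Pr x) Y"
proof -
  interpret prob_space "Pr x" by (rule prob_Pr)
  show ?thesis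
    by (rule integrable_const_bound[where B=b]) (use assms in \<open>simp_all add: measurable_Pr\<close>)
qed

lemma kernel_op_bounded_borel:
  assumes "f \<in> bounded_borel" "0 \<le> t"
  shows "kernel_op (P t) f \<in> bounded_borel"
proof -
  obtain b where b: "0 \<le> b" "\<And>x. \<bar>f x\<bar> \<le> b" by (rule bounded_borel_bound[OF assms(1)]) (rule that; blast)
  have k: "P t \<in> borel \<rightarrow>\<^sub>M subprob_algebra borel"
    by (rule measurable_prob_algebraD[OF markov_kernel[OF assms(2)]])
  have f: "f \<in> borel_measurable borel" using assms(1) by (simp add: bounded_borel_iff)
  show ?thesis
  proof (rule bounded_borelI)
    show "kernel_op (P t) f \<in> borel_measurable borel"
      unfolding kernel_op_def[abs_def]
      by (rule measurable_compose[OF k integral_measurable_subprob_algebra[OF f]])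
    fix x
    have "P t x \<in> space (prob_algebra borel)" by (rule measurable_space[OF markov_kernel[OF assms(2)]]) simp
    then have Ptx: "prob_space (P t x)" "sets (P t x) = sets borel" by (auto simp: space_prob_algebra)
    interpret prob_space "P t x" by (rule Ptx)
    show "\<bar>kernel_op (P t) f x\<bar> \<le> b"
      using daniell_abs_le[OF daniell_integral[OF finite_measure_axioms Ptx(2)] assms(1) b(2)] prob_space
      by (simp add: kernel_op_def)
  qed
qed

lemma markov_expectation:
  assumes f: "f \<in> bounded_borel" and st: "0 \<le> s" "0 \<le> t"
    and Y: "Y \<in> borel_measurable (\<F> t)" "\<And>\<omega>. \<bar>Y \<omega>\<bar> \<le> b"
  shows "(\<integral>\<omega>. Y \<omega> * f (X (t + s) \<omega>) \<partial>Pr x) = (\<integral>\<omega>. Y \<omega> * kernel_op (P s) f (X t \<omega>) \<partial>Pr x)"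
proof -
  interpret prob_space "Pr x" by (rule prob_Pr)
  have "subalgebra (Pr x) (\<F> t)"
    using filtration_subalgebra[OF st(2)] by (simp add: subalgebra_def sets_law)
  then interpret finite_measure_subalgebra "Pr x" "\<F> t" by unfold_locales
  obtain a where a: "0 \<le> a" "\<And>x. \<bar>f x\<bar> \<le> a" by (rule bounded_borel_bound[OF f]) (rule that; blast)
  have fm: "f \<in> borel_measurable borel" using f by (simp add: bounded_borel_iff)
  have Ym: "Y \<in> borel_measurable \<A>" by (rule measurable_filtration[OF st(2) Y(1)])
  have fX: "(\<lambda>\<omega>. f (X (t + s) \<omega>)) \<in> borel_measurable \<A>"
    by (rule measurable_compose[OF X_measurable fm]) (use st in simp)
  have int: "integrable (Pr x) (\<lambda>\<omega>. Y \<omega> * f (X (t + s) \<omega>))"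
  proof (rule integrable_bounded)
    show "(\<lambda>\<omega>. Y \<omega> * f (X (t + s) \<omega>)) \<in> borel_measurable \<A>" using Ym fX by (rule borel_measurable_times)
    show "\<bar>Y \<omega> * f (X (t + s) \<omega>)\<bar> \<le> b * a" for \<omega>
      unfolding abs_mult using Y(2)[of \<omega>] a by (intro mult_mono) auto
  qed
  have km: "kernel_op (P s) f \<in> borel_measurable borel"
    using kernel_op_bounded_borel[OF f st(1)] by (simp add: bounded_borel_iff)
  have "(\<integral>\<omega>. Y \<omega> * f (X (t + s) \<omega>) \<partial>Pr x) =
    (\<integral>\<omega>. Y \<omega> * real_cond_exp (Pr x) (\<F> t) (\<lambda>\<omega>. f (X (t + s) \<omega>)) \<omega> \<partial>Pr x)"
    by (rule real_cond_exp_intg(2)[OF int Y(1), symmetric]) (use fX in \<open>simp add: measurable_Pr\<close>)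
  also have "\<dots> = (\<integral>\<omega>. Y \<omega> * kernel_op (P s) f (X t \<omega>) \<partial>Pr x)"
  proof (rule integral_cong_AE)
    show "(\<lambda>\<omega>. Y \<omega> * real_cond_exp (Pr x) (\<F> t) (\<lambda>\<omega>. f (X (t + s) \<omega>)) \<omega>) \<in> borel_measurable (Pr x)"
      using Ym by (intro borel_measurable_times borel_measurable_cond_exp2) (simp add: measurable_Pr)
    show "(\<lambda>\<omega>. Y \<omega> * kernel_op (P s) f (X t \<omega>)) \<in> borel_measurable (Pr x)"
      unfolding measurable_Pr
      by (intro borel_measurable_times Ym measurable_compose[OF X_measurable km] st)
    show "AE \<omega> in Pr x. Y \<omega> * real_cond_exp (Pr x) (\<F> t) (\<lambda>\<omega>. f (X (t + s) \<omega>)) \<omega> = Y \<omega> * kernel_op (P s) f (X t \<omega>)"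
      using markov_property[OF st f, of x] by eventually_elim simp
  qed
  finally show ?thesis .
qed

definition path_mean :: "((real \<Rightarrow> 'a) \<Rightarrow> real) \<Rightarrow> 'a \<Rightarrow> real" where
  "path_mean H x = (\<integral>\<omega>. H (\<lambda>u. X u \<omega>) \<partial>Pr x)"

text \<open>
  The Markov property at every deterministic time \<open>t\<close> for the functional \<open>H\<close> of the path after
  \<open>t\<close>. It is formulated through the laws of the process, since there are no shift operators on the sample space.
\<close>

definition markov_functional :: "((real \<Rightarrow> 'a) \<Rightarrow> real) \<Rightarrow> bool" where
  "markov_functional H \<longleftrightarrow>
     (\<exists>b. \<forall>p. \<bar>H p\<bar> \<le> b) \<and>
     (\<forall>t\<ge>0. (\<lambda>\<omega>. H (\<lambda>u. X (t + u) \<omega>)) \<in> borel_measurable \<A>) \<and>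
     path_mean H \<in> bounded_borel \<and>
     (\<forall>x t Y b. 0 \<le> t \<longrightarrow> Y \<in> borel_measurable (\<F> t) \<longrightarrow> (\<forall>\<omega>. \<bar>Y \<omega>\<bar> \<le> b) \<longrightarrow>
        (\<integral>\<omega>. Y \<omega> * H (\<lambda>u. X (t + u) \<omega>) \<partial>Pr x) = (\<integral>\<omega>. Y \<omega> * path_mean H (X t \<omega>) \<partial>Pr x))"

lemma markov_functionalD:
  assumes "markov_functional H"
  shows markov_functional_bounded: "\<exists>b. \<forall>p. \<bar>H p\<bar> \<le> b"
    and markov_functional_measurable: "0 \<le> t \<Longrightarrow> (\<lambda>\<omega>. H (\<lambda>u. X (t + u) \<omega>)) \<in> borel_measurable \<A>"
    and markov_functional_mean: "path_mean H \<in> bounded_borel"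
  using assms unfolding markov_functional_def by simp_all

lemma markov_functional_expectation:
  assumes "markov_functional H"
  shows "0 \<le> t \<Longrightarrow> Y \<in> borel_measurable (\<F> t) \<Longrightarrow> (\<And>\<omega>. \<bar>Y \<omega>\<bar> \<le> b) \<Longrightarrow>
      (\<integral>\<omega>. Y \<omega> * H (\<lambda>u. X (t + u) \<omega>) \<partial>Pr x) = (\<integral>\<omega>. Y \<omega> * path_mean H (X t \<omega>) \<partial>Pr x)"
  using assms unfolding markov_functional_def by blast

lemma markov_functional_one: "markov_functional (\<lambda>p. 1)"
proof -
  interpret prob_space "Pr x" for x by (rule prob_Pr)
  have pm: "path_mean (\<lambda>p. 1) = (\<lambda>x. 1)" using prob_space by (auto simp: path_mean_def)
  show ?thesis unfolding markov_functional_def pm by auto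
qed

lemma path_mean_start:
  assumes H: "markov_functional H" and f: "f \<in> bounded_borel"
  shows "path_mean (\<lambda>p. f (p 0) * H p) x = f x * path_mean H x"
proof -
  have fm: "f \<in> borel_measurable borel" using f by (simp add: bounded_borel_iff)
  have Hm: "(\<lambda>\<omega>. H (\<lambda>u. X u \<omega>)) \<in> borel_measurable \<A>"
    using markov_functional_measurable[OF H, of 0] by simp
  have "path_mean (\<lambda>p. f (p 0) * H p) x = (\<integral>\<omega>. f x * H (\<lambda>u. X u \<omega>) \<partial>Pr x)"
    unfolding path_mean_def
  proof (rule integral_cong_AE)
    show "(\<lambda>\<omega>. f (X 0 \<omega>) * H (\<lambda>u. X u \<omega>)) \<in> borel_measurable (Pr x)"
      unfolding measurable_Pr
      by (intro borel_measurable_times Hm measurable_compose[OF X_measurable fm]) simp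
    show "(\<lambda>\<omega>. f x * H (\<lambda>u. X u \<omega>)) \<in> borel_measurable (Pr x)"
      unfolding measurable_Pr by (intro borel_measurable_times Hm borel_measurable_const)
    show "AE \<omega> in Pr x. f (X 0 \<omega>) * H (\<lambda>u. X u \<omega>) = f x * H (\<lambda>u. X u \<omega>)"
      using AE_start[of x] by eventually_elim simp
  qed
  then show ?thesis by (simp add: path_mean_def)
qed

lemma markov_functional_start:
  assumes H: "markov_functional H" and f: "f \<in> bounded_borel"
  shows "markov_functional (\<lambda>p. f (p 0) * H p)"
proof -
  have fm: "f \<in> borel_measurable borel" using f by (simp add: bounded_borel_iff)
  obtain a where a: "0 \<le> a" "\<And>x. \<bar>f x\<bar> \<le> a" by (rule bounded_borel_bound[OF f]) (rule that; blast)
  obtain b where b: "\<And>p. \<bar>H p\<bar> \<le> b" using markov_functional_bounded[OF H] by auto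
  have pm: "path_mean (\<lambda>p. f (p 0) * H p) = (\<lambda>x. f x * path_mean H x)"
    using path_mean_start[OF H f] by auto
  show ?thesis
    unfolding markov_functional_def pm
  proof (intro conjI allI impI)
    have "\<bar>f (p 0) * H p\<bar> \<le> a * b" for p
      unfolding abs_mult using a b by (intro mult_mono) auto
    then show "\<exists>b. \<forall>p. \<bar>f (p 0) * H p\<bar> \<le> b" by blast
    show "(\<lambda>\<omega>. f (X (t + 0) \<omega>) * H (\<lambda>u. X (t + u) \<omega>)) \<in> borel_measurable \<A>" if "0 \<le> t" for t
      using that by (intro borel_measurable_times markov_functional_measurable[OF H] measurable_compose[OF X_measurable fm]) auto
    show "(\<lambda>x. f x * path_mean H x) \<in> bounded_borel"
      by (rule bounded_borel_mult[OF f markov_functional_mean[OF H]])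
    fix x t Y and c :: real
    assume t: "0 \<le> t" and Y: "Y \<in> borel_measurable (\<F> t)" "\<forall>\<omega>. \<bar>Y \<omega>\<bar> \<le> c"
    have "(\<lambda>\<omega>. Y \<omega> * f (X t \<omega>)) \<in> borel_measurable (\<F> t)"
      by (intro borel_measurable_times Y measurable_compose[OF adapted[OF t] fm])
    moreover have "\<bar>Y \<omega> * f (X t \<omega>)\<bar> \<le> c * a" for \<omega>
      unfolding abs_mult using Y(2)[rule_format, of \<omega>] a by (intro mult_mono) auto
    ultimately have "(\<integral>\<omega>. (Y \<omega> * f (X t \<omega>)) * H (\<lambda>u. X (t + u) \<omega>) \<partial>Pr x) =
        (\<integral>\<omega>. (Y \<omega> * f (X t \<omega>)) * path_mean H (X t \<omega>) \<partial>Pr x)"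
      by (rule markov_functional_expectation[OF H t])
    then show "(\<integral>\<omega>. Y \<omega> * (f (X (t + 0) \<omega>) * H (\<lambda>u. X (t + u) \<omega>)) \<partial>Pr x) =
        (\<integral>\<omega>. Y \<omega> * (f (X t \<omega>) * path_mean H (X t \<omega>)) \<partial>Pr x)"
      by (simp add: mult.assoc)
  qed
qed

lemma shifted_expectation:
  assumes H: "markov_functional H" and "0 \<le> d" and t: "0 \<le> t"
    and Y: "Y \<in> borel_measurable (\<F> t)" "\<And>\<omega>. \<bar>Y \<omega>\<bar> \<le> c"
  shows "(\<integral>\<omega>. Y \<omega> * H (\<lambda>u. X (t + (d + u)) \<omega>) \<partial>Pr x) =
    (\<integral>\<omega>. Y \<omega> * kernel_op (P d) (path_mean H) (X t \<omega>) \<partial>Pr x)"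
proof -
  have "Y \<in> borel_measurable (\<F> (t + d))"
    by (rule measurable_from_subalg[OF _ Y(1)])
      (use filtration_mono[of t "t + d"] filtration_subalgebra[of t] filtration_subalgebra[of "t + d"] \<open>0 \<le> d\<close> t
        in \<open>auto simp: subalgebra_def\<close>)
  then have "(\<integral>\<omega>. Y \<omega> * H (\<lambda>u. X ((t + d) + u) \<omega>) \<partial>Pr x) = (\<integral>\<omega>. Y \<omega> * path_mean H (X (t + d) \<omega>) \<partial>Pr x)"
    using \<open>0 \<le> d\<close> t Y(2) by (intro markov_functional_expectation[OF H]) auto
  also have "\<dots> = (\<integral>\<omega>. Y \<omega> * kernel_op (P d) (path_mean H) (X t \<omega>) \<partial>Pr x)"
    by (rule markov_expectation[OF markov_functional_mean[OF H] \<open>0 \<le> d\<close> t Y])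
  finally show ?thesis by (simp add: add.assoc)
qed

lemma markov_functional_shift:
  assumes H: "markov_functional H" and d: "0 \<le> d"
  shows "markov_functional (\<lambda>p. H (\<lambda>u. p (d + u)))"
proof -
  interpret prob_space "Pr x" for x by (rule prob_Pr)
  have k: "kernel_op (P d) (path_mean H) \<in> bounded_borel"
    by (rule kernel_op_bounded_borel[OF markov_functional_mean[OF H] d])
  have pm: "path_mean (\<lambda>p. H (\<lambda>u. p (d + u))) = kernel_op (P d) (path_mean H)"
  proof
    fix x
    have "path_mean (\<lambda>p. H (\<lambda>u. p (d + u))) x = (\<integral>\<omega>. 1 * H (\<lambda>u. X (0 + (d + u)) \<omega>) \<partial>Pr x)"
      by (simp add: path_mean_def)
    also have "\<dots> = (\<integral>\<omega>. 1 * kernel_op (P d) (path_mean H) (X 0 \<omega>) \<partial>Pr x)"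
      by (rule shifted_expectation[OF H d, where c=1]) auto
    also have "\<dots> = (\<integral>\<omega>. kernel_op (P d) (path_mean H) x \<partial>Pr x)"
    proof (rule integral_cong_AE)
      show "(\<lambda>\<omega>. 1 * kernel_op (P d) (path_mean H) (X 0 \<omega>)) \<in> borel_measurable (Pr x)"
        using measurable_compose[OF X_measurable[of 0], of "kernel_op (P d) (path_mean H)" borel] k
        by (simp add: measurable_Pr bounded_borel_iff)
      show "AE \<omega> in Pr x. 1 * kernel_op (P d) (path_mean H) (X 0 \<omega>) = kernel_op (P d) (path_mean H) x"
        using AE_start[of x] by eventually_elim simp
    qed simp
    finally show "path_mean (\<lambda>p. H (\<lambda>u. p (d + u))) x = kernel_op (P d) (path_mean H) x"
      using prob_space by simp
  qed
  show ?thesis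
    unfolding markov_functional_def pm
  proof (intro conjI allI impI k)
    show "\<exists>b. \<forall>p. \<bar>H (\<lambda>u. p (d + u))\<bar> \<le> b" using markov_functional_bounded[OF H] by blast
    show "(\<lambda>\<omega>. H (\<lambda>u. X (t + (d + u)) \<omega>)) \<in> borel_measurable \<A>" if "0 \<le> t" for t
      using markov_functional_measurable[OF H, of "t + d"] that d by (simp add: add.assoc)
    show "(\<integral>\<omega>. Y \<omega> * H (\<lambda>u. X (t + (d + u)) \<omega>) \<partial>Pr x) =
      (\<integral>\<omega>. Y \<omega> * kernel_op (P d) (path_mean H) (X t \<omega>) \<partial>Pr x)"
      if "0 \<le> t" "Y \<in> borel_measurable (\<F> t)" "\<forall>\<omega>. \<bar>Y \<omega>\<bar> \<le> c" for x t Y and c :: real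
      by (rule shifted_expectation[OF H d that(1,2), of c]) (use that(3) in simp)
  qed
qed

lemma markov_functional_limit:
  assumes H: "\<And>n. markov_functional (H n)" and b: "\<And>n p. \<bar>H n p\<bar> \<le> b" "\<And>p. \<bar>H' p\<bar> \<le> b"
    and lim: "\<And>t \<omega>. 0 \<le> t \<Longrightarrow> \<omega> \<in> space \<A> \<Longrightarrow> (\<lambda>n. H n (\<lambda>u. X (t + u) \<omega>)) \<longlonglongrightarrow> H' (\<lambda>u. X (t + u) \<omega>)"
  shows "markov_functional H'"
proof -
  interpret prob_space "Pr x" for x by (rule prob_Pr)
  have Hm: "(\<lambda>\<omega>. H n (\<lambda>u. X (t + u) \<omega>)) \<in> borel_measurable \<A>" if "0 \<le> t" for n t
    by (rule markov_functional_measurable[OF H that])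
  have Hm': "(\<lambda>\<omega>. H' (\<lambda>u. X (t + u) \<omega>)) \<in> borel_measurable \<A>" if "0 \<le> t" for t
    by (rule borel_measurable_LIMSEQ_real[OF lim[OF that] Hm[OF that]])
  have pm_lim: "(\<lambda>n. path_mean (H n) x) \<longlonglongrightarrow> path_mean H' x" for x
    unfolding path_mean_def
  proof (rule integral_dominated_convergence[where w="\<lambda>_. b"])
    show "(\<lambda>\<omega>. H' (\<lambda>u. X u \<omega>)) \<in> borel_measurable (Pr x)" using Hm'[of 0] by (simp add: measurable_Pr)
    show "(\<lambda>\<omega>. H n (\<lambda>u. X u \<omega>)) \<in> borel_measurable (Pr x)" for n using Hm[of 0] by (simp add: measurable_Pr)
    show "AE \<omega> in Pr x. (\<lambda>n. H n (\<lambda>u. X u \<omega>)) \<longlonglongrightarrow> H' (\<lambda>u. X u \<omega>)"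
      using lim[of 0] by (intro AE_I2) simp
  qed (use b in auto)
  have pb: "\<bar>path_mean G x\<bar> \<le> b" if "\<And>p. \<bar>G p\<bar> \<le> b" "(\<lambda>\<omega>. G (\<lambda>u. X u \<omega>)) \<in> borel_measurable \<A>" for G x
  proof -
    have "\<bar>path_mean G x\<bar> \<le> (\<integral>\<omega>. \<bar>G (\<lambda>u. X u \<omega>)\<bar> \<partial>Pr x)"
      unfolding path_mean_def by (rule integral_abs_bound)
    also have "\<dots> \<le> (\<integral>\<omega>. b \<partial>Pr x)"
      using integrable_bounded[OF that(2), of b] that(1) by (intro integral_mono) auto
    finally show ?thesis using prob_space by simp
  qed
  have pbn: "\<bar>path_mean (H n) x\<bar> \<le> b" for n x using Hm[of 0] by (intro pb b) simp
  have pm: "path_mean H' \<in> bounded_borel"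
    by (rule bounded_borel_limit[OF markov_functional_mean[OF H] pbn pm_lim])
  have pmb: "\<bar>path_mean H' x\<bar> \<le> b" for x using Hm'[of 0] by (intro pb b) simp
  show "markov_functional H'"
    unfolding markov_functional_def
  proof (intro conjI allI impI pm)
    show "\<exists>b. \<forall>p. \<bar>H' p\<bar> \<le> b" using b(2) by blast
    show "(\<lambda>\<omega>. H' (\<lambda>u. X (t + u) \<omega>)) \<in> borel_measurable \<A>" if "0 \<le> t" for t by (rule Hm'[OF that])
    fix x t Y and c :: real
    assume t: "0 \<le> t" and Y: "Y \<in> borel_measurable (\<F> t)" and c: "\<forall>\<omega>. \<bar>Y \<omega>\<bar> \<le> c"
    have Ym: "Y \<in> borel_measurable \<A>" by (rule measurable_filtration[OF t Y])
    have Yb: "\<bar>Y \<omega> * z\<bar> \<le> c * b" if "\<bar>z\<bar> \<le> b" for \<omega> z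
      unfolding abs_mult using c[rule_format, of \<omega>] that by (intro mult_mono) auto
    have 1: "(\<lambda>n. \<integral>\<omega>. Y \<omega> * H n (\<lambda>u. X (t + u) \<omega>) \<partial>Pr x) \<longlonglongrightarrow> (\<integral>\<omega>. Y \<omega> * H' (\<lambda>u. X (t + u) \<omega>) \<partial>Pr x)"
    proof (rule integral_dominated_convergence[where w="\<lambda>_. c * b"])
      show "AE \<omega> in Pr x. (\<lambda>n. Y \<omega> * H n (\<lambda>u. X (t + u) \<omega>)) \<longlonglongrightarrow> Y \<omega> * H' (\<lambda>u. X (t + u) \<omega>)"
        using lim[OF t] by (intro AE_I2 tendsto_mult tendsto_const) simp
    qed (use Yb b Ym Hm[OF t] Hm'[OF t] in \<open>simp_all add: measurable_Pr\<close>)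
    have pmm: "(\<lambda>\<omega>. g (X t \<omega>)) \<in> borel_measurable \<A>" if "g \<in> bounded_borel" for g :: "'a \<Rightarrow> real"
      by (rule measurable_compose[OF X_measurable[OF t]]) (use that in \<open>simp add: bounded_borel_iff\<close>)
    have 2: "(\<lambda>n. \<integral>\<omega>. Y \<omega> * path_mean (H n) (X t \<omega>) \<partial>Pr x) \<longlonglongrightarrow> (\<integral>\<omega>. Y \<omega> * path_mean H' (X t \<omega>) \<partial>Pr x)"
    proof (rule integral_dominated_convergence[where w="\<lambda>_. c * b"])
      show "AE \<omega> in Pr x. (\<lambda>n. Y \<omega> * path_mean (H n) (X t \<omega>)) \<longlonglongrightarrow> Y \<omega> * path_mean H' (X t \<omega>)"
        by (intro AE_I2 tendsto_mult tendsto_const pm_lim)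
    qed (use Yb pbn Ym pmm[OF pm] pmm[OF markov_functional_mean[OF H]] in \<open>simp_all add: measurable_Pr\<close>)
    have "(\<integral>\<omega>. Y \<omega> * H n (\<lambda>u. X (t + u) \<omega>) \<partial>Pr x) = (\<integral>\<omega>. Y \<omega> * path_mean (H n) (X t \<omega>) \<partial>Pr x)" for n
      by (rule markov_functional_expectation[OF H t Y c[rule_format]])
    with 1 2 show "(\<integral>\<omega>. Y \<omega> * H' (\<lambda>u. X (t + u) \<omega>) \<partial>Pr x) = (\<integral>\<omega>. Y \<omega> * path_mean H' (X t \<omega>) \<partial>Pr x)"
      by (simp add: LIMSEQ_unique)
  qed
qed

lemma right_continuous_open:
  assumes "\<omega> \<in> space \<A>" "0 \<le> t" "open U" "X t \<omega> \<in> U"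
  obtains e where "0 < e" "\<And>s. t \<le> s \<Longrightarrow> s < t + e \<Longrightarrow> X s \<omega> \<in> U"
proof -
  have "\<forall>\<^sub>F s in at_right t. X s \<omega> \<in> U"
    by (rule topological_tendstoD[OF right_continuous_paths[OF assms(1,2)] assms(3,4)])
  then obtain c where c: "t < c" "\<And>s. t < s \<Longrightarrow> s < c \<Longrightarrow> X s \<omega> \<in> U"
    unfolding eventually_at_right_field by blast
  show ?thesis
    by (rule that[of "c - t"]) (use c assms(4) in \<open>auto simp: order_le_less\<close>)
qed

definition stays :: "'a set \<Rightarrow> real \<Rightarrow> (real \<Rightarrow> 'a) set" where
  "stays C s = {p. \<forall>u\<in>{0..<s}. p u \<in> C}"

text \<open>
  By right continuity, a path stays in the closed set \<open>C\<close> during \<open>[0, s)\<close> if it does so at the points of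
  all sufficiently fine grids. For the grid of mesh \<open>s/(k+1)\<close>, the functional is obtained from \<open>H\<close> by \<open>k+1\<close>
  rounds of shifting by the mesh and multiplying with the indicator of \<open>C\<close> at time \<open>0\<close>; the mesh divides \<open>s\<close>, so the
  shifts add up to \<open>s\<close>.
\<close>

lemma markov_functional_stays:
  assumes C: "closed C" and H: "markov_functional H" and s: "0 \<le> s"
  shows "markov_functional (\<lambda>p. indicator (stays C s) p * H (\<lambda>u. p (s + u)))"
proof (cases "s = 0")
  case True
  then show ?thesis using H by (simp add: stays_def)
next
  case False
  then have "0 < s" using s by simp
  have iC: "indicator C \<in> (bounded_borel :: ('a \<Rightarrow> real) set)" using C by (intro bounded_borel_indicator) auto
  define step where "step \<delta> H p = indicator C (p 0) * H (\<lambda>u. p (\<delta> + u))" for \<delta> :: real and H :: "(real \<Rightarrow> 'a) \<Rightarrow> real" and p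
  define chain where "chain k \<delta> = (step \<delta> ^^ k) H" for k \<delta>
  have chain: "chain k \<delta> p = (\<Prod>j<k. indicator C (p (real j * \<delta>))) * H (\<lambda>u. p (real k * \<delta> + u))" for k \<delta> p
  proof (induction k arbitrary: p)
    case 0 then show ?case by (simp add: chain_def)
  next
    case (Suc k)
    have "chain (Suc k) \<delta> p = indicator C (p 0) * chain k \<delta> (\<lambda>u. p (\<delta> + u))"
      by (simp add: chain_def step_def)
    also have "\<dots> = (indicator C (p 0) * (\<Prod>j<k. indicator C (p (real (Suc j) * \<delta>)))) * H (\<lambda>u. p (real (Suc k) * \<delta> + u))"
      by (simp add: Suc algebra_simps)
    finally show ?case by (simp only: prod.lessThan_Suc_shift) simp
  qed
  have mf: "markov_functional (chain k \<delta>)" if "0 \<le> \<delta>" for k \<delta>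
  proof (induction k)
    case (Suc k)
    show ?case
      using markov_functional_start[OF markov_functional_shift[OF Suc that] iC]
      by (simp add: chain_def step_def[abs_def])
  qed (simp add: chain_def H)
  obtain b where b: "\<And>p. \<bar>H p\<bar> \<le> b" using markov_functional_bounded[OF H] by auto
  define \<delta> where "\<delta> k = s / real (Suc k)" for k
  have \<delta>: "0 < \<delta> k" "real (Suc k) * \<delta> k = s" for k using \<open>0 < s\<close> by (simp_all add: \<delta>_def)
  have prod01: "0 \<le> (\<Prod>j<k. indicator C (p (real j * d)) :: real)" "(\<Prod>j<k. indicator C (p (real j * d)) :: real) \<le> 1" for k d and p :: "real \<Rightarrow> 'a"
    by (auto intro!: prod_nonneg prod_le_1)
  have b0: "0 \<le> b" using b[of undefined] by linarith
  show ?thesis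
  proof (rule markov_functional_limit[where b=b])
    show "markov_functional (chain (Suc k) (\<delta> k))" for k by (rule mf) (use \<delta>(1)[of k] in simp)
    show "\<bar>chain (Suc k) (\<delta> k) p\<bar> \<le> b" for k p
      using mult_mono[OF prod01(2)[of p "\<delta> k" "Suc k"] b[of "\<lambda>u. p (real (Suc k) * \<delta> k + u)"]] prod01(1)[of p "\<delta> k" "Suc k"]
      unfolding chain abs_mult by simp
    show "\<bar>indicator (stays C s) p * H (\<lambda>u. p (s + u))\<bar> \<le> b" for p
      using b[of "\<lambda>u. p (s + u)"] b0 by (simp add: indicator_def)
    fix t :: real and \<omega> assume t: "0 \<le> t" and \<omega>: "\<omega> \<in> space \<A>"
    let ?p = "\<lambda>u. X (t + u) \<omega>"
    show "(\<lambda>k. chain (Suc k) (\<delta> k) ?p) \<longlonglongrightarrow> indicator (stays C s) ?p * H (\<lambda>u. ?p (s + u))"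
    proof (cases "?p \<in> stays C s")
      case True
      have "chain (Suc k) (\<delta> k) ?p = H (\<lambda>u. ?p (s + u))" for k
      proof -
        have "?p (real j * \<delta> k) \<in> C" if "j < Suc k" for j
        proof -
          have "real j * \<delta> k < real (Suc k) * \<delta> k" using that \<delta>(1)[of k] by (intro mult_strict_right_mono) auto
          then show ?thesis using True \<delta>[of k] by (auto simp: stays_def)
        qed
        then have "(\<Prod>j<Suc k. indicator C (?p (real j * \<delta> k))) = (1 :: real)"
          by (intro prod.neutral) auto
        then show ?thesis unfolding chain \<delta>(2) by simp
      qed
      then show ?thesis using True by simp
    next
      case False
      then obtain u where u: "0 \<le> u" "u < s" "X (t + u) \<omega> \<in> - C" by (auto simp: stays_def)
      obtain e where e: "0 < e" "\<And>v. t + u \<le> v \<Longrightarrow> v < t + u + e \<Longrightarrow> X v \<omega> \<in> - C"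
        by (rule right_continuous_open[OF \<omega> _ _ u(3)]) (use t u C in auto)
      have "(\<lambda>k. s * (1 / real (Suc k))) \<longlonglongrightarrow> s * 0"
        by (intro tendsto_intros LIMSEQ_Suc[OF lim_1_over_n])
      then have "\<forall>\<^sub>F k in sequentially. \<delta> k < min e (s - u)"
        by (intro order_tendstoD(2)) (use e u in \<open>auto simp: \<delta>_def\<close>)
      then have "\<forall>\<^sub>F k in sequentially. chain (Suc k) (\<delta> k) ?p = 0"
      proof eventually_elim
        case (elim k)
        obtain j where j: "u \<le> real j * \<delta> k" "real j * \<delta> k < u + \<delta> k"
          by (rule grid_point[OF u(1) \<delta>(1)])
        have "X (t + real j * \<delta> k) \<omega> \<in> - C" using j elim by (intro e(2)) auto
        moreover have "j < Suc k"
        proof -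
          have "real j * \<delta> k < real (Suc k) * \<delta> k" using j elim \<delta>(2)[of k] by linarith
          then show ?thesis using \<delta>(1)[of k] by (simp only: mult_less_cancel_right_pos of_nat_less_iff)
        qed
        ultimately have "(\<Prod>j<Suc k. indicator C (?p (real j * \<delta> k)) :: real) = 0"
          by (intro prod_zero bexI[of _ j]) (auto simp: indicator_def)
        then show ?case unfolding chain by simp
      qed
      then show ?thesis using False by (simp add: tendsto_eventually)
    qed
  qed
qed

end

section \<open>The killed semigroup\<close>

locale killed_feller_process = feller_process P \<A> \<F> Pr X
  for P :: "real \<Rightarrow> 'a::{metric_space, second_countable_topology} \<Rightarrow> 'a measure"
    and \<A> :: "'w measure" and \<F> :: "real \<Rightarrow> 'w measure" and Pr :: "'a \<Rightarrow> 'w measure"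
    and X :: "real \<Rightarrow> 'w \<Rightarrow> 'a" +
  fixes D :: "'a set"
  assumes open_in_closure: "openin (top_of_set (closure D)) D"
begin

definition margin :: "nat \<Rightarrow> 'a set" where
  "margin n = (\<Union>y\<in>closure D - D. ball y (1 / Suc n))"

text \<open>
  The cores are closed and increase to \<open>D\<close>; that they are obtained from the closure of \<open>D\<close> by removing an
  open neighbourhood of the relative boundary is what links leaving all of them to approaching the boundary.
\<close>

definition core :: "nat \<Rightarrow> 'a set" where
  "core n = closure D - margin n"

lemma D_open_set: obtains W where "open W" "D = closure D \<inter> W"
  using open_in_closure by (auto simp: openin_open)

lemma D_in_borel: "D \<in> sets borel"
proof -
  obtain W where W: "open W" "D = closure D \<inter> W" by (rule D_open_set)
  have "closure D \<inter> W \<in> sets borel" using W(1) by (intro sets.Int) auto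
  with W(2) show ?thesis by simp
qed

lemma open_margin: "open (margin n)" unfolding margin_def by auto

lemma closed_core: "closed (core n)"
  unfolding core_def by (intro closed_Diff closed_closure open_margin)

lemma margin_antimono: "m \<le> n \<Longrightarrow> margin n \<subseteq> margin m"
  unfolding margin_def by (intro UN_mono subset_ball) (auto simp: frac_le)

lemma core_mono: "m \<le> n \<Longrightarrow> core m \<subseteq> core n"
  unfolding core_def using margin_antimono by blast

lemma core_subset: "core n \<subseteq> D"
proof
  fix x assume x: "x \<in> core n"
  show "x \<in> D"
  proof (rule ccontr)
    assume "x \<notin> D"
    then have "x \<in> closure D - D" using x by (simp add: core_def)
    then have "x \<in> margin n" unfolding margin_def by (rule UN_I) simp
    then show False using x by (simp add: core_def)
  qed
qed

text \<open>
  A description of \<open>\<tau>\<^sub>D > t\<close>, up to negligible paths, by events of staying in closed sets. They have to extend beyond \<open>t\<close> by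
  a positive amount, because \<open>\<tau>\<^sub>D > t\<close> excludes that the path leaves \<open>D\<close> immediately after \<open>t\<close>.
\<close>

definition survives :: "real \<Rightarrow> (real \<Rightarrow> 'a) set" where
  "survives t = (\<Union>n. stays (core n) (t + 1 / Suc n))"

definition killed :: "real \<Rightarrow> ('a \<Rightarrow> real) \<Rightarrow> (real \<Rightarrow> 'a) \<Rightarrow> real" where
  "killed t f p = f (p t) * indicator (survives t) p"

text \<open>
  The killed semigroup, with \<open>\<tau>\<^sub>D > t\<close> replaced by \<open>survives t\<close> (see \<open>killed_semigroup_eq_Q\<close>).
\<close>

definition Q :: "real \<Rightarrow> ('a \<Rightarrow> real) \<Rightarrow> 'a \<Rightarrow> real" where
  "Q t f = path_mean (killed t f)"

lemma Q_eq: "Q t f x = (\<integral>\<omega>. f (X t \<omega>) * indicator (survives t) (\<lambda>u. X u \<omega>) \<partial>Pr x)"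
  by (simp add: Q_def path_mean_def killed_def)

lemma stays_split:
  assumes "0 \<le> s" "0 \<le> e"
  shows "p \<in> stays C (s + e) \<longleftrightarrow> p \<in> stays C s \<and> (\<lambda>u. p (s + u)) \<in> stays C e"
proof
  assume "p \<in> stays C (s + e)"
  then show "p \<in> stays C s \<and> (\<lambda>u. p (s + u)) \<in> stays C e"
    using assms by (auto simp: stays_def)
next
  assume a: "p \<in> stays C s \<and> (\<lambda>u. p (s + u)) \<in> stays C e"
  have "p u \<in> C" if "0 \<le> u" "u < s + e" for u
  proof (cases "u < s")
    case True
    then show ?thesis using a that by (auto simp: stays_def)
  next
    case False
    then have "p (s + (u - s)) \<in> C" using a that unfolding stays_def by (auto dest!: bspec[where x="u - s"])
    then show ?thesis by simp
  qed
  then show "p \<in> stays C (s + e)" by (auto simp: stays_def)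
qed

lemma stays_antimono: "C \<subseteq> C' \<Longrightarrow> s' \<le> s \<Longrightarrow> stays C s \<subseteq> stays C' s'"
  by (auto simp: stays_def subset_iff)

lemma stays_core_mono: "m \<le> n \<Longrightarrow> stays (core m) (t + 1 / Suc m) \<subseteq> stays (core n) (t + 1 / Suc n)"
  by (intro stays_antimono core_mono) (auto simp: frac_le)

lemma survives_antimono: "s \<le> t \<Longrightarrow> survives t \<subseteq> survives s"
  unfolding survives_def by (intro UN_mono stays_antimono) auto

lemma survives_in_D: "p \<in> survives t \<Longrightarrow> 0 \<le> u \<Longrightarrow> u \<le> t \<Longrightarrow> p u \<in> D"
proof -
  assume "p \<in> survives t" and u: "0 \<le> u" "u \<le> t"
  then obtain n where "p \<in> stays (core n) (t + 1 / Suc n)" by (auto simp: survives_def)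
  moreover have "u \<in> {0..<t + 1 / Suc n}" using u by (simp add: add.commute add_pos_nonneg le_less_trans less_add_same_cancel1)
  ultimately show "p u \<in> D" using core_subset unfolding stays_def by blast
qed

lemma survives_split:
  assumes "0 \<le> s" "0 \<le> t"
  shows "p \<in> survives (s + t) \<longleftrightarrow> p \<in> survives s \<and> (\<lambda>u. p (s + u)) \<in> survives t"
proof
  assume "p \<in> survives (s + t)"
  then obtain n where n: "p \<in> stays (core n) (s + (t + 1 / Suc n))" by (auto simp: survives_def add.assoc)
  then have "(\<lambda>u. p (s + u)) \<in> stays (core n) (t + 1 / Suc n)"
    using assms by (subst (asm) stays_split) auto
  moreover have "p \<in> stays (core n) (s + 1 / Suc n)"
    using n stays_antimono[of "core n" "core n" "s + 1 / Suc n" "s + (t + 1 / Suc n)"] assms by auto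
  ultimately show "p \<in> survives s \<and> (\<lambda>u. p (s + u)) \<in> survives t"
    unfolding survives_def by blast
next
  assume a: "p \<in> survives s \<and> (\<lambda>u. p (s + u)) \<in> survives t"
  then obtain m n where m: "p \<in> stays (core m) (s + 1 / Suc m)" and n: "(\<lambda>u. p (s + u)) \<in> stays (core n) (t + 1 / Suc n)"
    by (auto simp: survives_def)
  define k where "k = max m n"
  have "p \<in> stays (core k) s"
    using stays_antimono[OF core_mono[of m k], of s "s + 1 / Suc m"] m by (auto simp: k_def)
  moreover have "(\<lambda>u. p (s + u)) \<in> stays (core k) (t + 1 / Suc k)"
    using stays_core_mono[of n k t] n by (auto simp: k_def)
  ultimately have "p \<in> stays (core k) (s + (t + 1 / Suc k))"
    using assms by (subst stays_split) auto
  then show "p \<in> survives (s + t)" unfolding survives_def by (auto simp: add.assoc)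
qed

lemma markov_functional_killed:
  assumes f: "f \<in> bounded_borel" and t: "0 \<le> t"
  shows "markov_functional (killed t f)"
proof -
  obtain b where b: "0 \<le> b" "\<And>x. \<bar>f x\<bar> \<le> b" by (rule bounded_borel_bound[OF f]) (rule that; blast)
  define e where "e n = 1 / real (Suc n)" for n
  have e: "0 < e n" for n by (simp add: e_def)
  define H where "H n p = f (p t) * indicator (stays (core n) (t + e n)) p" for n and p :: "real \<Rightarrow> 'a"
  have mf: "markov_functional (H n)" for n
  proof -
    have "markov_functional (\<lambda>p. indicator (stays (core n) t) p *
        (f (p (t + 0)) * (indicator (stays (core n) (e n)) (\<lambda>u. p (t + u)) * 1)))"
      using markov_functional_stays[OF closed_core markov_functional_start[OF markov_functional_stays[OF closed_core markov_functional_one] f] t]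
        e[of n] by simp
    moreover have "(\<lambda>p. indicator (stays (core n) t) p *
        (f (p (t + 0)) * (indicator (stays (core n) (e n)) (\<lambda>u. p (t + u)) * 1))) = H n"
      using stays_split[OF t less_imp_le[OF e[of n]]] by (auto simp: H_def indicator_def fun_eq_iff)
    ultimately show ?thesis by simp
  qed
  show ?thesis
  proof (rule markov_functional_limit[where b=b, OF mf])
    show "\<bar>H n p\<bar> \<le> b" for n p using b by (simp add: H_def indicator_def)
    show "\<bar>killed t f p\<bar> \<le> b" for p using b by (simp add: killed_def indicator_def)
    fix s :: real and \<omega>
    have "(\<lambda>n. indicator (stays (core n) (t + e n)) p :: real) \<longlonglongrightarrow> indicator (survives t) p" for p
      unfolding survives_def e_def
      by (rule LIMSEQ_indicator_incseq) (unfold incseq_def, intro allI impI stays_core_mono)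
    then show "(\<lambda>n. H n (\<lambda>u. X (s + u) \<omega>)) \<longlonglongrightarrow> killed t f (\<lambda>u. X (s + u) \<omega>)"
      unfolding H_def killed_def by (intro tendsto_mult tendsto_const)
  qed
qed

lemma stays_event:
  assumes "closed C"
  shows "{\<omega> \<in> space \<A>. (\<lambda>u. X u \<omega>) \<in> stays C s} = {\<omega> \<in> space \<A>. \<forall>q\<in>\<rat> \<inter> {0..<s}. X q \<omega> \<in> C}"
proof (intro Collect_cong conj_cong refl iffI)
  fix \<omega> assume \<omega>: "\<omega> \<in> space \<A>" and r: "\<forall>q\<in>\<rat> \<inter> {0..<s}. X q \<omega> \<in> C"
  show "(\<lambda>u. X u \<omega>) \<in> stays C s"
  proof (rule ccontr)
    assume "(\<lambda>u. X u \<omega>) \<notin> stays C s"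
    then obtain u where u: "0 \<le> u" "u < s" "X u \<omega> \<in> - C" by (auto simp: stays_def)
    obtain e where e: "0 < e" "\<And>v. u \<le> v \<Longrightarrow> v < u + e \<Longrightarrow> X v \<omega> \<in> - C"
      by (rule right_continuous_open[OF \<omega> u(1) _ u(3)]) (use assms in auto)
    obtain q where "q \<in> \<rat>" "u < q" "q < min s (u + e)"
      using Rats_dense_in_real[of u "min s (u + e)"] u e by auto
    then show False using r e(2)[of q] u by auto
  qed
qed (auto simp: stays_def)

text \<open>
  Survival until \<open>t\<close> looks a little into the future of \<open>t\<close>; right continuity of the filtration
  compensates for that.
\<close>

lemma survives_filtration:
  assumes t: "0 \<le> t"
  shows "{\<omega> \<in> space \<A>. (\<lambda>u. X u \<omega>) \<in> survives t} \<in> sets (\<F> t)"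
proof -
  have sp: "space (\<F> v) = space \<A>" if "0 \<le> v" for v
    using filtration_subalgebra[OF that] by (simp add: subalgebra_def)
  have "{\<omega> \<in> space \<A>. (\<lambda>u. X u \<omega>) \<in> survives t} \<in> sets (\<F> v)" if v: "t < v" for v
  proof -
    have v0: "0 \<le> v" using t v by simp
    obtain N where N: "1 / real (Suc N) < v - t"
      using nat_approx_posE[of "v - t"] v by auto
    have S: "{\<omega> \<in> space \<A>. (\<lambda>u. X u \<omega>) \<in> stays (core n) w} \<in> sets (\<F> v)" if "w \<le> v" for n w
    proof -
      have "{\<omega> \<in> space (\<F> v). X q \<omega> \<in> core n} \<in> sets (\<F> v)" if q: "q \<in> \<rat> \<inter> {0..<w}" for q
      proof -
        have "X q \<in> measurable (\<F> v) borel"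
          by (rule measurable_from_subalg[OF _ adapted])
            (use q \<open>w \<le> v\<close> filtration_mono[of q v] sp[of q] sp[OF v0] in \<open>auto simp: subalgebra_def\<close>)
        then show ?thesis
          using measurable_sets[of "X q" "\<F> v" borel "core n"] closed_core[of n]
          by (simp add: vimage_def Int_def conj_commute)
      qed
      then have "{\<omega> \<in> space (\<F> v). \<forall>q\<in>\<rat> \<inter> {0..<w}. X q \<omega> \<in> core n} \<in> sets (\<F> v)"
        by (rule sets.sets_Collect_countable_All') (auto intro: countable_subset[OF _ countable_rat])
      then show ?thesis unfolding stays_event[OF closed_core] by (simp add: sp[OF v0])
    qed
    have "{\<omega> \<in> space \<A>. (\<lambda>u. X u \<omega>) \<in> survives t} =
      (\<Union>n. {\<omega> \<in> space \<A>. (\<lambda>u. X u \<omega>) \<in> stays (core (N + n)) (t + 1 / Suc (N + n))})"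
    proof -
      have "survives t = (\<Union>n. stays (core (N + n)) (t + 1 / Suc (N + n)))"
      proof
        show "survives t \<subseteq> (\<Union>n. stays (core (N + n)) (t + 1 / Suc (N + n)))"
          unfolding survives_def
        proof (rule UN_least)
          fix m
          show "stays (core m) (t + 1 / Suc m) \<subseteq> (\<Union>n. stays (core (N + n)) (t + 1 / Suc (N + n)))"
            using stays_core_mono[of m "N + m" t] by auto
        qed
        show "(\<Union>n. stays (core (N + n)) (t + 1 / Suc (N + n))) \<subseteq> survives t"
          unfolding survives_def
        proof (rule UN_least)
          fix n
          show "stays (core (N + n)) (t + 1 / Suc (N + n)) \<subseteq> (\<Union>n. stays (core n) (t + 1 / Suc n))"
            by (rule UN_upper[of "N + n" UNIV "\<lambda>n. stays (core n) (t + 1 / Suc n)"]) simp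
        qed
      qed
      then show ?thesis by auto
    qed
    also have "\<dots> \<in> sets (\<F> v)"
    proof (rule sets.countable_nat_UN, rule image_subsetI)
      fix n
      have "1 / real (Suc (N + n)) \<le> 1 / real (Suc N)" by (simp add: frac_le)
      then show "{\<omega> \<in> space \<A>. (\<lambda>u. X u \<omega>) \<in> stays (core (N + n)) (t + 1 / Suc (N + n))} \<in> sets (\<F> v)"
        using N by (intro S) linarith
    qed
    finally show ?thesis .
  qed
  then show ?thesis unfolding filtration_right_continuous[OF t] by auto
qed

lemma survives_measurable:
  assumes "0 \<le> t"
  shows "(\<lambda>\<omega>. indicator (survives t) (\<lambda>u. X u \<omega>) :: real) \<in> borel_measurable (\<F> t)"
proof -
  have sp: "space (\<F> t) = space \<A>"
    using filtration_subalgebra[OF assms] by (simp add: subalgebra_def)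
  have "(\<lambda>\<omega>. indicator {\<omega> \<in> space \<A>. (\<lambda>u. X u \<omega>) \<in> survives t} \<omega> :: real) \<in> borel_measurable (\<F> t)"
    by (rule borel_measurable_indicator[OF survives_filtration[OF assms]])
  then show ?thesis
    by (rule measurable_cong[THEN iffD1, rotated]) (auto simp: sp indicator_def)
qed

lemma killed_measurable:
  assumes "f \<in> bounded_borel" "0 \<le> t"
  shows "(\<lambda>\<omega>. f (X t \<omega>) * indicator (survives t) (\<lambda>u. X u \<omega>)) \<in> borel_measurable \<A>"
  using markov_functional_measurable[OF markov_functional_killed[OF assms], of 0] by (simp add: killed_def)

text \<open>
  Survival until \<open>s + t\<close> splits into survival until \<open>s\<close>, which is known at time \<open>s\<close>, and survival of the
  shifted path until \<open>t\<close>, to which the Markov property at time \<open>s\<close> applies.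
\<close>

lemma killed_semigroup_property:
  assumes s: "0 \<le> s" and t: "0 \<le> t" and f: "f \<in> bounded_borel"
  shows "Q (s + t) f x = Q s (Q t f) x"
proof -
  have "Q (s + t) f x = (\<integral>\<omega>. indicator (survives s) (\<lambda>u. X u \<omega>) * killed t f (\<lambda>u. X (s + u) \<omega>) \<partial>Pr x)"
    unfolding Q_eq
    by (rule Bochner_Integration.integral_cong[OF refl])
      (auto simp: killed_def indicator_def survives_split[OF s t])
  also have "\<dots> = (\<integral>\<omega>. indicator (survives s) (\<lambda>u. X u \<omega>) * path_mean (killed t f) (X s \<omega>) \<partial>Pr x)"
    by (rule markov_functional_expectation[OF markov_functional_killed[OF f t] s survives_measurable[OF s], of 1])
      (auto simp: indicator_def)
  also have "\<dots> = Q s (Q t f) x"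
    unfolding Q_eq[of s] by (simp add: Q_def mult.commute)
  finally show ?thesis .
qed

lemma daniell_Q:
  assumes t: "0 \<le> t"
  shows "daniell (\<lambda>f. Q t f x)"
  unfolding Q_eq
proof (rule daniellI)
  interpret prob_space "Pr x" by (rule prob_Pr)
  have int: "integrable (Pr x) (\<lambda>\<omega>. f (X t \<omega>) * indicator (survives t) (\<lambda>u. X u \<omega>))" if f: "f \<in> bounded_borel" for f
  proof -
    obtain b where b: "0 \<le> b" "\<And>x. \<bar>f x\<bar> \<le> b" by (rule bounded_borel_bound[OF f]) (rule that; blast)
    show ?thesis by (rule integrable_bounded[OF killed_measurable[OF f t], of b]) (use b in \<open>auto simp: indicator_def\<close>)
  qed
  {
    fix f g :: "'a \<Rightarrow> real" assume "f \<in> bounded_borel" "g \<in> bounded_borel"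
    then show "(\<integral>\<omega>. (f (X t \<omega>) + g (X t \<omega>)) * indicator (survives t) (\<lambda>u. X u \<omega>) \<partial>Pr x) =
      (\<integral>\<omega>. f (X t \<omega>) * indicator (survives t) (\<lambda>u. X u \<omega>) \<partial>Pr x) + (\<integral>\<omega>. g (X t \<omega>) * indicator (survives t) (\<lambda>u. X u \<omega>) \<partial>Pr x)"
      unfolding distrib_right by (intro Bochner_Integration.integral_add int)
  next
    fix f :: "'a \<Rightarrow> real" and c
    show "(\<integral>\<omega>. c * f (X t \<omega>) * indicator (survives t) (\<lambda>u. X u \<omega>) \<partial>Pr x) =
      c * (\<integral>\<omega>. f (X t \<omega>) * indicator (survives t) (\<lambda>u. X u \<omega>) \<partial>Pr x)"
      by (simp only: mult.assoc integral_mult_right_zero)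
  next
    fix f :: "'a \<Rightarrow> real" assume "\<And>x. 0 \<le> f x"
    then show "0 \<le> (\<integral>\<omega>. f (X t \<omega>) * indicator (survives t) (\<lambda>u. X u \<omega>) \<partial>Pr x)"
      by (intro Bochner_Integration.integral_nonneg) simp
  next
    fix F :: "nat \<Rightarrow> 'a \<Rightarrow> real" and g b
    assume F: "\<And>n. F n \<in> bounded_borel" "\<And>n x. \<bar>F n x\<bar> \<le> b" "\<And>x. (\<lambda>n. F n x) \<longlonglongrightarrow> g x"
    have g: "g \<in> bounded_borel" by (rule bounded_borel_limit[OF F])
    have b0: "0 \<le> b" using F(2)[of 0 undefined] by linarith
    show "(\<lambda>n. \<integral>\<omega>. F n (X t \<omega>) * indicator (survives t) (\<lambda>u. X u \<omega>) \<partial>Pr x) \<longlonglongrightarrow>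
      (\<integral>\<omega>. g (X t \<omega>) * indicator (survives t) (\<lambda>u. X u \<omega>) \<partial>Pr x)"
    proof (rule integral_dominated_convergence[where w="\<lambda>_. b"])
      show "AE \<omega> in Pr x. (\<lambda>n. F n (X t \<omega>) * indicator (survives t) (\<lambda>u. X u \<omega>)) \<longlonglongrightarrow> g (X t \<omega>) * indicator (survives t) (\<lambda>u. X u \<omega>)"
        by (intro AE_I2 tendsto_mult tendsto_const F(3))
      show "AE \<omega> in Pr x. norm (F n (X t \<omega>) * indicator (survives t) (\<lambda>u. X u \<omega>)) \<le> b" for n
        using F(2) b0 by (intro AE_I2) (simp add: indicator_def)
    qed (use killed_measurable[OF F(1) t] killed_measurable[OF g t] in \<open>simp_all add: measurable_Pr\<close>)
  }
qed

lemma Q_outside_zero: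
  assumes "0 \<le> t"
  shows "Q t (indicator (- D)) x = 0"
proof -
  have z: "indicator (- D) (X t \<omega>) * indicator (survives t) (\<lambda>u. X u \<omega>) = (0 :: real)" for \<omega>
    using survives_in_D[of "\<lambda>u. X u \<omega>" t t] assms by (auto simp: indicator_def)
  show ?thesis unfolding Q_eq z by simp
qed

lemma Q_start_zero:
  assumes "0 \<le> t" "x \<notin> D"
  shows "Q t (\<lambda>_. 1) x = 0"
  unfolding Q_eq
proof (rule integral_eq_zero_AE)
  show "AE \<omega> in Pr x. 1 * indicator (survives t) (\<lambda>u. X u \<omega>) = (0 :: real)"
    using AE_start[of x]
  proof eventually_elim
    case (elim \<omega>)
    then show ?case using survives_in_D[of "\<lambda>u. X u \<omega>" t 0] assms by (auto simp: indicator_def)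
  qed
qed

lemma Q_right_continuous:
  assumes f: "f \<in> bounded_borel" "continuous_on UNIV f" and t: "0 \<le> t"
    and s: "\<And>n. t < s n" "s \<longlonglongrightarrow> t"
  shows "(\<lambda>n. Q (s n) f x) \<longlonglongrightarrow> Q t f x"
proof -
  interpret prob_space "Pr x" by (rule prob_Pr)
  obtain b where b: "0 \<le> b" "\<And>x. \<bar>f x\<bar> \<le> b" by (rule bounded_borel_bound[OF f(1)]) (rule that; blast)
  have s0: "0 \<le> s n" for n using s(1)[of n] t by simp
  have fs: "filterlim s (at_right t) sequentially"
    unfolding filterlim_at using s by (auto intro: always_eventually)
  have surv: "(\<lambda>n. indicator (survives (s n)) p :: real) \<longlonglongrightarrow> indicator (survives t) p" for p
  proof (cases "p \<in> survives t")
    case False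
    then have "p \<notin> survives (s n)" for n using survives_antimono[OF less_imp_le[OF s(1)[of n]]] by auto
    then show ?thesis using False by simp
  next
    case True
    then obtain n where n: "p \<in> stays (core n) (t + 1 / Suc n)" by (auto simp: survives_def)
    \<comment> \<open>half of the time \<open>1/(n+1)\<close> to spare is used up by \<open>s k\<close>, the other half remains as the margin for \<open>m = 2n+1\<close>\<close>
    have "\<forall>\<^sub>F k in sequentially. s k < t + 1 / (2 * Suc n)"
      by (rule order_tendstoD(2)[OF s(2)]) simp
    then have "\<forall>\<^sub>F k in sequentially. indicator (survives (s k)) p = (1 :: real)"
    proof eventually_elim
      case (elim k)
      define m where "m = 2 * n + 1"
      have m: "1 / real (Suc m) = 1 / (2 * Suc n)" by (simp add: m_def field_simps)
      have "1 / (2 * real (Suc n)) + 1 / (2 * real (Suc n)) = 1 / Suc n" by (simp add: field_simps)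
      then have "s k + 1 / Suc m \<le> t + 1 / Suc n" using elim m by simp
      then have "p \<in> stays (core m) (s k + 1 / Suc m)"
        using stays_antimono[OF core_mono[of n m], of "s k + 1 / Suc m" "t + 1 / Suc n"] n by (auto simp: m_def)
      then have "p \<in> survives (s k)" unfolding survives_def by blast
      then show ?case by simp
    qed
    then show ?thesis using True by (simp add: tendsto_eventually)
  qed
  show ?thesis
    unfolding Q_eq
  proof (rule integral_dominated_convergence[where w="\<lambda>_. b"])
    show "(\<lambda>\<omega>. f (X t \<omega>) * indicator (survives t) (\<lambda>u. X u \<omega>)) \<in> borel_measurable (Pr x)"
      "(\<lambda>\<omega>. f (X (s n) \<omega>) * indicator (survives (s n)) (\<lambda>u. X u \<omega>)) \<in> borel_measurable (Pr x)" for n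
      using killed_measurable[OF f(1) t] killed_measurable[OF f(1) s0[of n]] by (simp_all add: measurable_Pr)
    show "integrable (Pr x) (\<lambda>\<omega>. b)" by simp
    show "AE \<omega> in Pr x. norm (f (X (s n) \<omega>) * indicator (survives (s n)) (\<lambda>u. X u \<omega>)) \<le> b" for n
      using b by (intro AE_I2) (simp add: indicator_def)
    show "AE \<omega> in Pr x. (\<lambda>n. f (X (s n) \<omega>) * indicator (survives (s n)) (\<lambda>u. X u \<omega>))
        \<longlonglongrightarrow> f (X t \<omega>) * indicator (survives t) (\<lambda>u. X u \<omega>)"
    proof (intro AE_I2 tendsto_mult surv)
      fix \<omega> assume "\<omega> \<in> space (Pr x)"
      then have "(\<lambda>n. X (s n) \<omega>) \<longlonglongrightarrow> X t \<omega>"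
        using filterlim_compose[OF right_continuous_paths fs] t by simp
      then show "(\<lambda>n. f (X (s n) \<omega>)) \<longlonglongrightarrow> f (X t \<omega>)"
        by (rule continuous_on_tendsto_compose[OF f(2)]) auto
    qed
  qed
qed

text \<open>
  For continuous \<open>f\<close> the function \<open>t \<mapsto> Q t f x\<close> is right continuous, so it is the limit of functions that
  are constant in \<open>t\<close> on the cells of a grid; \<open>\<tau> k t\<close> is the first point of the grid of mesh \<open>1/(k+1)\<close> strictly after \<open>t\<close>.
  The general case follows by a monotone class argument.
\<close>

lemma Q_jointly_measurable:
  assumes "f \<in> bounded_borel"
  shows "(\<lambda>(x, t). indicator {0..} t * Q t f x) \<in> borel_measurable (borel \<Otimes>\<^sub>M lborel)"
  using assms
proof (induction f rule: bounded_borel_induct)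
  case (add f g)
  have "(\<lambda>(x, t). indicator {0..} t * Q t (\<lambda>x. f x + g x) x) =
    (\<lambda>z. (case z of (x, t) \<Rightarrow> indicator {0..} t * Q t f x) + (case z of (x, t) \<Rightarrow> indicator {0..} t * Q t g x))"
    using daniell_add[OF daniell_Q add.hyps] by (auto simp: fun_eq_iff indicator_def)
  then show ?case using borel_measurable_add[OF add.IH] by simp
next
  case (cmult f c)
  have "(\<lambda>(x, t). indicator {0..} t * Q t (\<lambda>x. c * f x) x) =
    (\<lambda>z. c * (case z of (x, t) \<Rightarrow> indicator {0..} t * Q t f x))"
    using daniell_cmult[OF daniell_Q cmult.hyps] by (auto simp: fun_eq_iff indicator_def)
  then show ?case using borel_measurable_times[OF borel_measurable_const cmult.IH] by simp
next
  case (limit F g b)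
  show ?case
  proof (rule borel_measurable_LIMSEQ_real[OF _ limit.IH])
    fix z :: "'a \<times> real"
    obtain x t where z: "z = (x, t)" by (cases z)
    show "(\<lambda>n. case z of (x, t) \<Rightarrow> indicator {0..} t * Q t (F n) x) \<longlonglongrightarrow> (case z of (x, t) \<Rightarrow> indicator {0..} t * Q t g x)"
      unfolding z using daniell_limit[OF daniell_Q limit.hyps, of t x] by (cases "0 \<le> t") auto
  qed
next
  case (open_set U)
  have cont: "(\<lambda>(x, t). indicator {0..} t * Q t f x) \<in> borel_measurable (borel \<Otimes>\<^sub>M lborel)"
    if f: "f \<in> bounded_borel" "continuous_on UNIV f" for f
  proof -
    define \<tau> where "\<tau> k t = real (Suc (nat \<lfloor>real (Suc k) * t\<rfloor>)) / real (Suc k)" for k :: nat and t :: real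
    have \<tau>: "t < \<tau> k t" "\<tau> k t \<le> t + 1 / Suc k" if "0 \<le> t" for k t
    proof -
      define m where "m = real (Suc k)"
      have m: "0 < m" by (simp add: m_def)
      have "real (Suc (nat \<lfloor>m * t\<rfloor>)) = of_int \<lfloor>m * t\<rfloor> + 1" using m that by simp
      then have "m * t < real (Suc (nat \<lfloor>m * t\<rfloor>))" "real (Suc (nat \<lfloor>m * t\<rfloor>)) \<le> m * t + 1"
        by linarith+
      moreover have "(t + 1 / m) * m = m * t + 1" using m by (simp add: field_simps)
      ultimately show "t < \<tau> k t" "\<tau> k t \<le> t + 1 / Suc k"
        unfolding \<tau>_def m_def[symmetric] using m by (simp_all only: pos_less_divide_eq pos_divide_le_eq mult.commute[of t m])
    qed
    show ?thesis
    proof (rule borel_measurable_LIMSEQ_real)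
      fix k
      show "(\<lambda>(x, t). indicator {0..} t * Q (\<tau> k t) f x) \<in> borel_measurable (borel \<Otimes>\<^sub>M lborel)"
      proof -
        have "(\<lambda>z. Q (real (Suc i) / real (Suc k)) f (fst z)) \<in> borel_measurable (borel \<Otimes>\<^sub>M lborel)" for i
        proof -
          have "Q (real (Suc i) / real (Suc k)) f \<in> borel_measurable borel"
            using markov_functional_mean[OF markov_functional_killed[OF f(1), of "real (Suc i) / real (Suc k)"]]
            by (simp add: Q_def bounded_borel_iff)
          then show ?thesis by (rule measurable_compose[OF measurable_fst])
        qed
        moreover have "(\<lambda>z. nat \<lfloor>real (Suc k) * snd z\<rfloor>) \<in> measurable (borel \<Otimes>\<^sub>M lborel) (count_space UNIV)"
          by measurable
        ultimately have "(\<lambda>z. Q (real (Suc (nat \<lfloor>real (Suc k) * snd z\<rfloor>)) / real (Suc k)) f (fst z)) \<in> borel_measurable (borel \<Otimes>\<^sub>M lborel)"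
          by (rule measurable_compose_countable)
        moreover have "(\<lambda>z. indicator {0..} (snd z) :: real) \<in> borel_measurable ((borel :: 'a measure) \<Otimes>\<^sub>M (lborel :: real measure))"
          by (rule measurable_compose[OF measurable_snd], rule borel_measurable_indicator) simp
        ultimately show ?thesis by (simp add: case_prod_beta' \<tau>_def)
      qed
    next
      fix z :: "'a \<times> real"
      obtain x t where z: "z = (x, t)" by (cases z)
      have "(\<lambda>k. Q (\<tau> k t) f x) \<longlonglongrightarrow> Q t f x" if "0 \<le> t"
      proof (rule Q_right_continuous[OF f that])
        show "t < \<tau> k t" for k by (rule \<tau>(1)[OF that])
        have "(\<lambda>k. t + 1 / real (Suc k)) \<longlonglongrightarrow> t + 0" by (intro tendsto_intros LIMSEQ_Suc[OF lim_1_over_n])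
        then show "(\<lambda>k. \<tau> k t) \<longlonglongrightarrow> t"
          by (intro tendsto_sandwich[of "\<lambda>_. t" "\<lambda>k. \<tau> k t" sequentially "\<lambda>k. t + 1 / real (Suc k)"])
            (use \<tau>[OF that] in \<open>auto intro!: always_eventually less_imp_le\<close>)
      qed
      then show "(\<lambda>k. case z of (x, t) \<Rightarrow> indicator {0..} t * Q (\<tau> k t) f x) \<longlonglongrightarrow> (case z of (x, t) \<Rightarrow> indicator {0..} t * Q t f x)"
        unfolding z by (cases "0 \<le> t") auto
    qed
  qed
  from open_indicator_approx[OF open_set] obtain F :: "nat \<Rightarrow> 'a \<Rightarrow> real"
    where F: "\<forall>n. continuous_on UNIV (F n) \<and> (\<forall>x. 0 \<le> F n x \<and> F n x \<le> 1) \<and>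
      (\<forall>x. x \<notin> U \<longrightarrow> F n x = 0) \<and> (\<forall>x. (\<lambda>n. F n x) \<longlonglongrightarrow> indicator U x)" ..
  have Fc: "continuous_on UNIV (F n)" and F01: "0 \<le> F n x" "F n x \<le> 1"
    and Flim: "(\<lambda>n. F n x) \<longlonglongrightarrow> indicator U x" for n x
    using F by simp_all
  have Fabs: "\<bar>F n x\<bar> \<le> 1" for n x using F01[of n x] by simp
  have Fb: "F n \<in> bounded_borel" for n
    by (rule bounded_borelI[OF borel_measurable_continuous_onI[OF Fc] Fabs])
  show ?case
  proof (rule borel_measurable_LIMSEQ_real[OF _ cont[OF Fb Fc]])
    fix z :: "'a \<times> real"
    obtain x t where z: "z = (x, t)" by (cases z)
    show "(\<lambda>n. case z of (x, t) \<Rightarrow> indicator {0..} t * Q t (F n) x) \<longlonglongrightarrow> (case z of (x, t) \<Rightarrow> indicator {0..} t * Q t (indicator U) x)"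
      unfolding z using daniell_limit[OF daniell_Q Fb Fabs Flim, of t x] by (cases "0 \<le> t") auto
  qed
qed

end

section \<open>Paths that slip away from a closed set\<close>

definition bump :: "nat \<Rightarrow> 'a::metric_space set \<Rightarrow> 'a \<Rightarrow> real" where
  "bump m C x = max 0 (min 1 (2 - real (Suc m) * infdist x C))"

lemma bump_continuous: "continuous_on UNIV (bump m C)"
  unfolding bump_def[abs_def] by (intro continuous_intros)

lemma bump_range: "0 \<le> bump m C x" "bump m C x \<le> 1"
  by (simp_all add: bump_def)

lemma bump_bounded_borel: "bump m C \<in> bounded_borel"
  by (rule bounded_borelI[OF borel_measurable_continuous_onI[OF bump_continuous], of _ _ 1])
    (use bump_range[of m C] in simp)

lemma bump_eq_1: "infdist x C \<le> 1 / Suc m \<Longrightarrow> bump m C x = 1"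
  by (simp add: bump_def field_simps)

lemma bump_eq_0: "2 / Suc m \<le> infdist x C \<Longrightarrow> bump m C x = 0"
  by (simp add: bump_def field_simps)

lemma bump_in_C0:
  fixes C :: "'a::metric_space set"
  assumes lc: "locally compact (UNIV :: 'a set)" and C: "compact C" "C \<noteq> {}"
  shows "\<exists>m0. \<forall>m\<ge>m0. bump m C \<in> C0_on UNIV"
proof -
  obtain U V where U: "open U" "C \<subseteq> U" "U \<subseteq> V" and V: "compact V"
  proof -
    define \<U> where "\<U> = {u :: 'a set. open u \<and> (\<exists>v. compact v \<and> u \<subseteq> v)}"
    have "C \<subseteq> \<Union>\<U>"
    proof
      fix x assume "x \<in> C"
      have "openin (top_of_set UNIV) (UNIV :: 'a set) \<and> x \<in> UNIV" by simp
      then obtain u v where "open u" "compact v" "x \<in> u" "u \<subseteq> v"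
        using lc unfolding locally_def by (metis open_openin subtopology_UNIV)
      then show "x \<in> \<Union>\<U>" unfolding \<U>_def by blast
    qed
    then obtain \<V> where \<V>: "\<V> \<subseteq> \<U>" "finite \<V>" "C \<subseteq> \<Union>\<V>"
      by (rule compactE[OF C(1)]) (auto simp: \<U>_def)
    have "\<forall>u\<in>\<V>. \<exists>v. compact v \<and> u \<subseteq> v" using \<V>(1) by (auto simp: \<U>_def)
    then obtain v where v: "\<And>u. u \<in> \<V> \<Longrightarrow> compact (v u) \<and> u \<subseteq> v u" by metis
    show ?thesis
    proof (rule that[of "\<Union>\<V>" "\<Union>u\<in>\<V>. v u"])
      show "open (\<Union>\<V>)" using \<V>(1) by (auto simp: \<U>_def)
      show "\<Union>\<V> \<subseteq> (\<Union>u\<in>\<V>. v u)" using v by blast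
      show "compact (\<Union>u\<in>\<V>. v u)" using \<V>(2) v by (intro compact_UN) auto
    qed (rule \<V>(3))
  qed
  obtain e where e: "0 < e" "(\<Union>x\<in>C. ball x e) \<subseteq> U"
    using compact_subset_open_imp_ball_epsilon_subset[OF C(1) U(1,2)] by blast
  obtain m0 where m0: "1 / real (Suc m0) < e / 2"
    using nat_approx_posE[of "e / 2"] e(1) by auto
  have "bump m C \<in> C0_on UNIV" if "m0 \<le> m" for m
  proof -
    have "1 / real (Suc m) \<le> 1 / real (Suc m0)" using that by (simp add: frac_le)
    then have m: "2 / real (Suc m) < e" using m0 by linarith
    have "{x \<in> UNIV. bump m C x \<noteq> 0} \<subseteq> V"
    proof safe
      fix x assume "bump m C x \<noteq> 0"
      then have "infdist x C < 2 / Suc m" using bump_eq_0[of m x C] by linarith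
      then have "infdist x C < e" using m by linarith
      then have "(INF a\<in>C. dist x a) < e" using C(2) by (simp add: infdist_def)
      then obtain a where "a \<in> C" "dist x a < e"
        using C(2) by (subst (asm) cINF_less_iff) auto
      then have "x \<in> ball a e" by (simp add: dist_commute)
      then show "x \<in> V" using e(2) U(3) \<open>a \<in> C\<close> by blast
    qed
    then have "closure {x \<in> UNIV. bump m C x \<noteq> 0} \<subseteq> V"
      by (rule closure_minimal) (rule compact_imp_closed[OF V])
    then have "compact (closure {x \<in> UNIV. bump m C x \<noteq> 0})"
      using compact_Int_closed[OF V closed_closure, of "{x \<in> UNIV. bump m C x \<noteq> 0}"] by (simp add: Int_absorb1)
    then have cs: "bump m C \<in> compactly_supported_on UNIV"
      by (simp add: compactly_supported_on_def bump_continuous)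
    have "bump m C \<in> bounded_continuous_on UNIV"
      using bump_range[of m C] by (auto simp: bounded_continuous_on_def bump_continuous bounded_iff intro!: exI[of _ 1])
    then show ?thesis unfolding C0_on_def using cs by (auto intro!: bexI[of _ "bump m C"])
  qed
  then show ?thesis by blast
qed

definition event_liminf :: "(nat \<Rightarrow> 'w set) \<Rightarrow> 'w set" where
  "event_liminf A = (\<Union>k. \<Inter>n\<in>{k..}. A n)"

lemma event_liminfI: "\<forall>\<^sub>F n in sequentially. \<omega> \<in> A n \<Longrightarrow> \<omega> \<in> event_liminf A"
  by (auto simp: event_liminf_def eventually_sequentially)

lemma event_liminf_measurable:
  assumes "\<And>n. A n \<in> sets M"
  shows "event_liminf A \<in> sets M"
  unfolding event_liminf_def
proof (rule sets.countable_nat_UN, rule image_subsetI)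
  fix k
  show "(\<Inter>n\<in>{k..}. A n) \<in> sets M" by (rule sets.countable_INT') (use assms in auto)
qed

lemma emeasure_event_liminf_le:
  assumes A: "\<And>n. A n \<in> sets M" and le: "\<forall>\<^sub>F n in sequentially. emeasure M (A n) \<le> c"
  shows "emeasure M (event_liminf A) \<le> c"
proof -
  let ?B = "\<lambda>k. \<Inter>n\<in>{k..}. A n"
  have B: "?B k \<in> sets M" for k by (rule sets.countable_INT') (use A in auto)
  have "(SUP k. emeasure M (?B k)) = emeasure M (\<Union>k. ?B k)"
  proof (rule SUP_emeasure_incseq)
    show "incseq ?B" by (rule incseq_SucI) auto
  qed (use B in auto)
  moreover have "emeasure M (?B k) \<le> c" for k
  proof -
    have "\<forall>\<^sub>F n in sequentially. k \<le> n \<and> emeasure M (A n) \<le> c"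
      using le eventually_ge_at_top[of k] by eventually_elim simp
    then obtain n where "k \<le> n" "emeasure M (A n) \<le> c"
      using eventually_happens[of _ sequentially] by auto
    moreover have "emeasure M (?B k) \<le> emeasure M (A n)"
      by (rule emeasure_mono[OF _ A]) (use \<open>k \<le> n\<close> in auto)
    ultimately show ?thesis by simp
  qed
  ultimately show ?thesis unfolding event_liminf_def by (metis SUP_least)
qed

context feller_process
begin

lemma expectation_kernel:
  assumes f: "f \<in> bounded_borel" and t: "0 \<le> t"
  shows "(\<integral>\<omega>. f (X t \<omega>) \<partial>Pr x) = kernel_op (P t) f x"
proof -
  interpret prob_space "Pr x" by (rule prob_Pr)
  have k: "kernel_op (P t) f \<in> borel_measurable borel"
    using kernel_op_bounded_borel[OF f t] by (simp add: bounded_borel_iff)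
  have "(\<integral>\<omega>. f (X t \<omega>) \<partial>Pr x) = (\<integral>\<omega>. 1 * kernel_op (P t) f (X 0 \<omega>) \<partial>Pr x)"
    using markov_expectation[OF f t, of 0 "\<lambda>_. 1" 1 x] by simp
  also have "\<dots> = (\<integral>\<omega>. kernel_op (P t) f x \<partial>Pr x)"
  proof (rule integral_cong_AE)
    show "(\<lambda>\<omega>. 1 * kernel_op (P t) f (X 0 \<omega>)) \<in> borel_measurable (Pr x)"
      using measurable_compose[OF X_measurable[of 0] k] by (simp add: measurable_Pr)
    show "AE \<omega> in Pr x. 1 * kernel_op (P t) f (X 0 \<omega>) = kernel_op (P t) f x"
      using AE_start[of x] by eventually_elim simp
  qed simp
  finally show ?thesis using prob_space by simp
qed

definition first_entrance :: "'a set \<Rightarrow> real \<Rightarrow> nat \<Rightarrow> 'w set" where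
  "first_entrance V \<delta> j = {\<omega> \<in> space \<A>. X (real j * \<delta>) \<omega> \<in> V \<and> (\<forall>i<j. X (real i * \<delta>) \<omega> \<notin> V)}"

text \<open>
  Meant for functions \<open>f\<close> that are \<open>1\<close> on \<open>V\<close>: at time \<open>s\<close> after its first visit to \<open>V\<close> along the grid of mesh \<open>\<delta>\<close>
  the path is well away from \<open>V\<close>.
\<close>

definition quick_escape :: "'a set \<Rightarrow> ('a \<Rightarrow> real) \<Rightarrow> real \<Rightarrow> real \<Rightarrow> 'w set" where
  "quick_escape V f s \<delta> = (\<Union>j. first_entrance V \<delta> j \<inter> {\<omega> \<in> space \<A>. f (X (real j * \<delta> + s) \<omega>) < 1/2})"

lemma X_event:
  assumes "0 \<le> u" "u \<le> t" "B \<in> sets borel"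
  shows "{\<omega> \<in> space \<A>. X u \<omega> \<in> B} \<in> sets (\<F> t)"
proof -
  have sp: "space (\<F> u) = space \<A>" "space (\<F> t) = space \<A>"
    using filtration_subalgebra[of u] filtration_subalgebra[of t] assms by (auto simp: subalgebra_def)
  have "X u \<in> measurable (\<F> t) borel"
    by (rule measurable_from_subalg[OF _ adapted]) (use assms filtration_mono[of u t] sp in \<open>auto simp: subalgebra_def\<close>)
  from measurable_sets[OF this assms(3)] show ?thesis
    by (simp add: sp vimage_def Int_def conj_commute)
qed

lemma first_entrance_measurable:
  assumes "open V" "0 \<le> \<delta>"
  shows "first_entrance V \<delta> j \<in> sets (\<F> (real j * \<delta>))"
proof -
  have j0: "0 \<le> real j * \<delta>" using assms(2) by simp
  have sp: "space (\<F> (real j * \<delta>)) = space \<A>"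
    using filtration_subalgebra[OF j0] by (simp add: subalgebra_def)
  have E: "{\<omega> \<in> space \<A>. X (real i * \<delta>) \<omega> \<in> B} \<in> sets (\<F> (real j * \<delta>))" if "i \<le> j" "B \<in> sets borel" for i B
    by (rule X_event) (use that assms(2) in \<open>auto intro: mult_right_mono\<close>)
  have "first_entrance V \<delta> j = {\<omega> \<in> space \<A>. X (real j * \<delta>) \<omega> \<in> V} \<inter>
      {\<omega> \<in> space (\<F> (real j * \<delta>)). \<forall>i\<in>{..<j}. X (real i * \<delta>) \<omega> \<in> - V}"
    unfolding first_entrance_def sp by auto
  also have "\<dots> \<in> sets (\<F> (real j * \<delta>))"
  proof (intro sets.Int E sets.sets_Collect_countable_All')
    show "{\<omega> \<in> space (\<F> (real j * \<delta>)). X (real i * \<delta>) \<omega> \<in> - V} \<in> sets (\<F> (real j * \<delta>))" if "i \<in> {..<j}" for i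
      unfolding sp by (rule E) (use that assms(1) in auto)
  qed (use assms(1) in auto)
  finally show ?thesis .
qed

lemma sets_filtration: "0 \<le> t \<Longrightarrow> A \<in> sets (\<F> t) \<Longrightarrow> A \<in> sets \<A>"
  using filtration_subalgebra[of t] by (auto simp: subalgebra_def)

lemma quick_escape_measurable:
  assumes V: "open V" and f: "f \<in> bounded_borel" and "0 \<le> s" "0 \<le> \<delta>"
  shows "first_entrance V \<delta> j \<inter> {\<omega> \<in> space \<A>. f (X (real j * \<delta> + s) \<omega>) < 1/2} \<in> sets \<A>"
    and "quick_escape V f s \<delta> \<in> sets \<A>"
proof -
  have j0: "0 \<le> real j * \<delta>" for j using assms(4) by simp
  show *: "first_entrance V \<delta> j \<inter> {\<omega> \<in> space \<A>. f (X (real j * \<delta> + s) \<omega>) < 1/2} \<in> sets \<A>" for j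
  proof (rule sets.Int)
    show "first_entrance V \<delta> j \<in> sets \<A>"
      by (rule sets_filtration[OF j0 first_entrance_measurable[OF V assms(4)]])
    have fm: "f \<in> borel_measurable borel" using f by (simp add: bounded_borel_iff)
    have "{y. f y < 1/2} \<in> sets borel" using measurable_sets[OF fm, of "{..<1/2}"] by (simp add: vimage_def)
    from X_event[OF _ order_refl this, of "real j * \<delta> + s"]
    show "{\<omega> \<in> space \<A>. f (X (real j * \<delta> + s) \<omega>) < 1/2} \<in> sets \<A>"
      using j0[of j] assms(3) by (auto intro!: sets_filtration[of "real j * \<delta> + s"])
  qed
  show "quick_escape V f s \<delta> \<in> sets \<A>"
    unfolding quick_escape_def by (rule sets.countable_nat_UN, rule image_subsetI) (rule *)
qed

text \<open>
  On the event that the first visit happens at the grid time \<open>j \<delta>\<close>, the Markov property at that time gives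
  \<open>E[f(X\<^bsub>j\<delta>+s\<^esub>)] \<ge> 1 - \<epsilon>\<close>, because \<open>P\<^sub>s f\<close> is \<open>\<epsilon>\<close>-close to \<open>f\<close> and \<open>f = 1\<close> on \<open>V\<close>. Markov's inequality turns this into the
  bound \<open>2 \<epsilon>\<close> for the conditional probability that \<open>f < 1/2\<close>; the events for different \<open>j\<close> are
  disjoint. Only deterministic times are involved, so the strong Markov property is avoided.
\<close>

lemma emeasure_quick_escape_le:
  assumes V: "open V" and f: "f \<in> bounded_borel" "\<And>y. f y \<le> 1" "\<And>y. y \<in> V \<Longrightarrow> f y = 1"
    and "0 \<le> s" "0 \<le> \<delta>" and close: "\<And>y. \<bar>kernel_op (P s) f y - f y\<bar> \<le> \<epsilon>"
  shows "emeasure (Pr x) (quick_escape V f s \<delta>) \<le> ennreal (2 * \<epsilon>)"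
proof -
  interpret prob_space "Pr x" by (rule prob_Pr)
  let ?E = "first_entrance V \<delta>"
  let ?B = "\<lambda>j. {\<omega> \<in> space \<A>. f (X (real j * \<delta> + s) \<omega>) < 1/2}"
  have j0: "0 \<le> real j * \<delta>" for j using \<open>0 \<le> \<delta>\<close> by simp
  have \<epsilon>: "0 \<le> \<epsilon>" using close[of undefined] by linarith
  have EF: "?E j \<in> sets (\<F> (real j * \<delta>))" for j by (rule first_entrance_measurable[OF V \<open>0 \<le> \<delta>\<close>])
  then have EA: "?E j \<in> sets \<A>" for j by (rule sets_filtration[OF j0])
  have EB: "?E j \<inter> ?B j \<in> sets \<A>" for j by (rule quick_escape_measurable(1)[OF V f(1) \<open>0 \<le> s\<close> \<open>0 \<le> \<delta>\<close>])
  obtain b where b: "0 \<le> b" "\<And>x. \<bar>f x\<bar> \<le> b" by (rule bounded_borel_bound[OF f(1)]) (rule that; blast)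
  have fm: "f \<in> borel_measurable borel" using f(1) by (simp add: bounded_borel_iff)
  have bound: "measure (Pr x) (?E j \<inter> ?B j) \<le> 2 * \<epsilon> * measure (Pr x) (?E j)" for j
  proof -
    let ?I = "\<lambda>\<omega>. indicator (?E j) \<omega> :: real"
    have Im: "?I \<in> borel_measurable \<A>" by (rule borel_measurable_indicator[OF EA])
    have fX: "(\<lambda>\<omega>. f (X u \<omega>)) \<in> borel_measurable \<A>" if "0 \<le> u" for u
      by (rule measurable_compose[OF X_measurable[OF that] fm])
    have kX: "(\<lambda>\<omega>. kernel_op (P s) f (X u \<omega>)) \<in> borel_measurable \<A>" if "0 \<le> u" for u
      by (rule measurable_compose[OF X_measurable[OF that]])
        (use kernel_op_bounded_borel[OF f(1) \<open>0 \<le> s\<close>] in \<open>simp add: bounded_borel_iff\<close>)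
    have iI: "integrable (Pr x) ?I" by (rule integrable_bounded[OF Im, where b=1]) (simp add: indicator_def)
    have js: "0 \<le> real j * \<delta> + s" using j0[of j] \<open>0 \<le> s\<close> by simp
    have iIf: "integrable (Pr x) (\<lambda>\<omega>. ?I \<omega> * f (X (real j * \<delta> + s) \<omega>))"
      by (rule integrable_bounded[OF borel_measurable_times[OF Im fX[OF js]], where b=b]) (use b in \<open>simp add: indicator_def\<close>)
    have kb: "kernel_op (P s) f y \<ge> - (b + \<epsilon>)" "kernel_op (P s) f y \<le> b + \<epsilon>" for y
      using close[of y] b(2)[of y] by linarith+
    have iIk: "integrable (Pr x) (\<lambda>\<omega>. ?I \<omega> * kernel_op (P s) f (X (real j * \<delta>) \<omega>))"
      by (rule integrable_bounded[OF borel_measurable_times[OF Im kX[OF j0]], where b="b + \<epsilon>"])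
        (use kb b(1) \<epsilon> in \<open>auto simp: indicator_def abs_le_iff minus_le_iff\<close>)
    have "(\<integral>\<omega>. ?I \<omega> * f (X (real j * \<delta> + s) \<omega>) \<partial>Pr x) = (\<integral>\<omega>. ?I \<omega> * kernel_op (P s) f (X (real j * \<delta>) \<omega>) \<partial>Pr x)"
      by (rule markov_expectation[OF f(1) \<open>0 \<le> s\<close> j0 borel_measurable_indicator[OF EF], where b=1]) (simp add: indicator_def)
    also have "\<dots> \<ge> (\<integral>\<omega>. (1 - \<epsilon>) * ?I \<omega> \<partial>Pr x)"
    proof (rule integral_mono)
      fix \<omega>
      show "(1 - \<epsilon>) * ?I \<omega> \<le> ?I \<omega> * kernel_op (P s) f (X (real j * \<delta>) \<omega>)"
      proof (cases "\<omega> \<in> ?E j")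
        case True
        then have "f (X (real j * \<delta>) \<omega>) = 1" using f(3) by (simp add: first_entrance_def)
        then show ?thesis using True close[of "X (real j * \<delta>) \<omega>"] by simp
      qed simp
    qed (use iI iIk in auto)
    finally have 1: "(1 - \<epsilon>) * measure (Pr x) (?E j) \<le> (\<integral>\<omega>. ?I \<omega> * f (X (real j * \<delta> + s) \<omega>) \<partial>Pr x)"
      using EA by (simp add: sets_law)
    have "(\<integral>\<omega>. indicator (?E j \<inter> ?B j) \<omega> \<partial>Pr x) \<le> (\<integral>\<omega>. 2 * (?I \<omega> - ?I \<omega> * f (X (real j * \<delta> + s) \<omega>)) \<partial>Pr x)"
    proof (rule integral_mono)
      show "integrable (Pr x) (indicator (?E j \<inter> ?B j) :: 'w \<Rightarrow> real)"
        by (rule integrable_bounded[OF borel_measurable_indicator[OF EB], where b=1]) (simp add: indicator_def)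
      show "integrable (Pr x) (\<lambda>\<omega>. 2 * (?I \<omega> - ?I \<omega> * f (X (real j * \<delta> + s) \<omega>)))"
        using iI iIf by simp
      fix \<omega>
      show "indicator (?E j \<inter> ?B j) \<omega> \<le> 2 * (?I \<omega> - ?I \<omega> * f (X (real j * \<delta> + s) \<omega>))"
        using f(2)[of "X (real j * \<delta> + s) \<omega>"] by (auto simp: indicator_def)
    qed
    also have "\<dots> = 2 * (measure (Pr x) (?E j) - (\<integral>\<omega>. ?I \<omega> * f (X (real j * \<delta> + s) \<omega>) \<partial>Pr x))"
      using iI iIf EA by (simp add: sets_law)
    also have "\<dots> \<le> 2 * (\<epsilon> * measure (Pr x) (?E j))"
      using 1 by (simp add: left_diff_distrib)
    finally show ?thesis using EB by (simp add: sets_law)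
  qed
  have disj: "disjoint_family ?E"
    unfolding disjoint_family_on_def
  proof (intro ballI impI)
    fix i j :: nat assume "i \<noteq> j"
    then consider "i < j" | "j < i" by linarith
    then show "?E i \<inter> ?E j = {}" by cases (auto simp: first_entrance_def)
  qed
  have "emeasure (Pr x) (quick_escape V f s \<delta>) \<le> (\<Sum>j. emeasure (Pr x) (?E j \<inter> ?B j))"
    unfolding quick_escape_def by (rule emeasure_subadditive_countably) (use EB in \<open>auto simp: sets_law\<close>)
  also have "\<dots> \<le> (\<Sum>j. ennreal (2 * \<epsilon>) * emeasure (Pr x) (?E j))"
  proof (rule suminf_le)
    show "emeasure (Pr x) (?E j \<inter> ?B j) \<le> ennreal (2 * \<epsilon>) * emeasure (Pr x) (?E j)" for j
      using bound[of j] \<epsilon> by (simp add: emeasure_eq_measure ennreal_mult[symmetric])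
  qed auto
  also have "\<dots> = ennreal (2 * \<epsilon>) * (\<Sum>j. emeasure (Pr x) (?E j))" by (rule ennreal_suminf_cmult)
  also have "(\<Sum>j. emeasure (Pr x) (?E j)) = emeasure (Pr x) (\<Union>j. ?E j)"
    by (rule suminf_emeasure[OF _ disj]) (use EA in \<open>auto simp: sets_law\<close>)
  also have "ennreal (2 * \<epsilon>) * \<dots> \<le> ennreal (2 * \<epsilon>) * 1"
    by (intro mult_left_mono emeasure_le_1) auto
  finally show ?thesis by simp
qed

text \<open>
  For neighbourhoods \<open>V n\<close> shrinking to a closed set \<open>F\<close> and \<open>f = 1\<close> near \<open>F\<close>, this event contains the
  paths whose entrance times into the \<open>V n\<close> converge to a time at which \<open>f\<close> vanishes, that is, the paths that
  approach \<open>F\<close> but jump away from it at the last moment. The limits are taken in this order: first the mesh of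
  the grid, which makes the grid times converge to the entrance time of \<open>V n\<close>, next \<open>n\<close>, and finally the time lag.
\<close>

definition slipping :: "(nat \<Rightarrow> 'a set) \<Rightarrow> ('a \<Rightarrow> real) \<Rightarrow> 'w set" where
  "slipping V f = event_liminf (\<lambda>i. event_liminf (\<lambda>n. event_liminf (\<lambda>k.
     quick_escape (V n) f (1 / Suc i) (1 / Suc k))))"

text \<open>
  This is quasi-left-continuity in disguise: by strong continuity of the semigroup, the bound of
  \<open>emeasure_quick_escape_le\<close> holds with arbitrarily small \<open>\<epsilon>\<close> once the time lag is small, uniformly in the mesh and in \<open>n\<close>.
\<close>

lemma slipping_null:
  assumes V: "\<And>n. open (V n)" and f: "f \<in> C0_on UNIV" "f \<in> bounded_borel" "\<And>y. f y \<le> 1"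
    and one: "\<And>n y. m \<le> n \<Longrightarrow> y \<in> V n \<Longrightarrow> f y = 1"
  shows "slipping V f \<in> sets \<A>" and "emeasure (Pr x) (slipping V f) = 0"
proof -
  have q: "quick_escape (V n) f (1 / Suc i) (1 / Suc k) \<in> sets \<A>" for n i k
    by (rule quick_escape_measurable(2)[OF V f(2)]) auto
  have q2: "event_liminf (\<lambda>k. quick_escape (V n) f (1 / Suc i) (1 / Suc k)) \<in> sets \<A>" for n i
    by (rule event_liminf_measurable[OF q])
  have q3: "event_liminf (\<lambda>n. event_liminf (\<lambda>k. quick_escape (V n) f (1 / Suc i) (1 / Suc k))) \<in> sets \<A>" for i
    by (rule event_liminf_measurable[OF q2])
  show "slipping V f \<in> sets \<A>" unfolding slipping_def by (rule event_liminf_measurable[OF q3])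
  have le: "emeasure (Pr x) (slipping V f) \<le> ennreal (2 * \<epsilon>)" if "0 < \<epsilon>" for \<epsilon>
    unfolding slipping_def
  proof (rule emeasure_event_liminf_le)
    have "\<forall>\<^sub>F s in at_right 0. \<forall>y\<in>UNIV. dist (kernel_op (P s) f y) (f y) < \<epsilon>"
      using strongly_continuous[OF f(1)] \<open>0 < \<epsilon>\<close> by (rule uniform_limitD)
    moreover have "filterlim (\<lambda>i. 1 / real (Suc i)) (at_right 0) sequentially"
      unfolding filterlim_at using LIMSEQ_Suc[OF lim_1_over_n] by (auto intro: always_eventually)
    ultimately have "\<forall>\<^sub>F i in sequentially. \<forall>y\<in>UNIV. dist (kernel_op (P (1 / real (Suc i))) f y) (f y) < \<epsilon>"
      by (rule eventually_compose_filterlim)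
    then show "\<forall>\<^sub>F i in sequentially. emeasure (Pr x) (event_liminf (\<lambda>n. event_liminf (\<lambda>k.
        quick_escape (V n) f (1 / Suc i) (1 / Suc k)))) \<le> ennreal (2 * \<epsilon>)"
    proof eventually_elim
      case (elim i)
      show ?case
      proof (rule emeasure_event_liminf_le)
        show "\<forall>\<^sub>F n in sequentially. emeasure (Pr x) (event_liminf (\<lambda>k.
            quick_escape (V n) f (1 / Suc i) (1 / Suc k))) \<le> ennreal (2 * \<epsilon>)"
          using eventually_ge_at_top[of m]
        proof eventually_elim
          case (elim n)
          have "emeasure (Pr x) (quick_escape (V n) f (1 / Suc i) (1 / Suc k)) \<le> ennreal (2 * \<epsilon>)" for k
            by (rule emeasure_quick_escape_le[OF V f(2,3) one[OF elim]])
              (use \<open>\<forall>y\<in>UNIV. dist (kernel_op (P (1 / real (Suc i))) f y) (f y) < \<epsilon>\<close> in \<open>auto simp: dist_real_def intro: less_imp_le\<close>)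
          then have "\<forall>\<^sub>F k in sequentially. emeasure (Pr x) (quick_escape (V n) f (1 / Suc i) (1 / Suc k)) \<le> ennreal (2 * \<epsilon>)"
            by (intro always_eventually allI)
          then show ?case
            by (rule emeasure_event_liminf_le[rotated]) (simp only: sets_law q)
        qed
      qed (unfold sets_law, rule q2)
    qed
  qed (unfold sets_law, rule q3)
  show "emeasure (Pr x) (slipping V f) = 0"
  proof (rule antisym)
    show "emeasure (Pr x) (slipping V f) \<le> 0"
    proof (rule ennreal_le_epsilon)
      fix e :: real assume "0 < e"
      then show "emeasure (Pr x) (slipping V f) \<le> 0 + ennreal e" using le[of "e / 2"] by simp
    qed
  qed simp
qed

end

section \<open>Exit time and exponential decay\<close>

lemma less_exit_time_iff:
  assumes "0 \<le> t"
  shows "ennreal t < exit_time X D \<omega> \<longleftrightarrow> (\<exists>e>0. \<forall>u. 0 \<le> u \<longrightarrow> u < t + e \<longrightarrow> X u \<omega> \<in> D)"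
proof
  assume "ennreal t < exit_time X D \<omega>"
  then obtain z where z: "ennreal t < z" "z < exit_time X D \<omega>" using dense by blast
  then obtain r where r: "z = ennreal r" "0 \<le> r" by (cases z) auto
  have "t < r" using z(1) assms r by (simp add: ennreal_less_iff)
  have "X u \<omega> \<in> D" if "0 \<le> u" "u < t + (r - t)" for u
  proof (rule ccontr)
    assume "X u \<omega> \<notin> D"
    then have "exit_time X D \<omega> \<le> ennreal u" unfolding exit_time_def using that by (intro Inf_lower) auto
    also have "\<dots> \<le> ennreal r" using that by (intro ennreal_leI) simp
    finally show False using z(2) r(1) by simp
  qed
  then show "\<exists>e>0. \<forall>u. 0 \<le> u \<longrightarrow> u < t + e \<longrightarrow> X u \<omega> \<in> D"
    using \<open>t < r\<close> by (intro exI[of _ "r - t"]) auto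
next
  assume "\<exists>e>0. \<forall>u. 0 \<le> u \<longrightarrow> u < t + e \<longrightarrow> X u \<omega> \<in> D"
  then obtain e where e: "0 < e" "\<And>u. 0 \<le> u \<Longrightarrow> u < t + e \<Longrightarrow> X u \<omega> \<in> D" by blast
  have "ennreal t < ennreal (t + e)" using assms e(1) by (simp add: ennreal_less_iff)
  also have "\<dots> \<le> exit_time X D \<omega>"
    unfolding exit_time_def
  proof (rule Inf_greatest)
    fix z assume "z \<in> ennreal ` {t. 0 \<le> t \<and> X t \<omega> \<notin> D}"
    then obtain u where u: "z = ennreal u" "0 \<le> u" "X u \<omega> \<notin> D" by auto
    then have "t + e \<le> u" using e(2)[of u] by force
    then show "ennreal (t + e) \<le> z" unfolding u(1) by (rule ennreal_leI)
  qed
  finally show "ennreal t < exit_time X D \<omega>" .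
qed

lemma eventually_inverse_Suc_less:
  assumes "(0::real) < e"
  shows "\<forall>\<^sub>F n in sequentially. 1 / real (Suc n) < e"
  by (rule order_tendstoD(2)[OF LIMSEQ_Suc[OF lim_1_over_n] assms])

lemma bump_abs: "\<bar>bump m C x\<bar> \<le> 1"
  using bump_range[of m C x] by simp

context killed_feller_process
begin

text \<open>
  Let \<open>\<tau> n\<close> be the entrance time into \<open>margin n\<close>, and \<open>T\<close> the limit of these increasing times. The path is in \<open>D\<close> at
  time \<open>T\<close>, hence at a positive distance from the relative boundary, and remains there for a short time
  by right continuity. For a small time lag, \<open>\<tau> n\<close> plus the lag falls into this short period as soon as \<open>n\<close> is large.
\<close>

lemma slipping_if_margin_reached:
  assumes \<omega>: "\<omega> \<in> space \<A>" and t: "0 \<le> t" and inD: "\<And>u. 0 \<le> u \<Longrightarrow> u \<le> t \<Longrightarrow> X u \<omega> \<in> D"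
    and reach: "\<And>n \<eta>. 0 < \<eta> \<Longrightarrow> \<exists>u\<ge>0. u < t + \<eta> \<and> X u \<omega> \<in> margin n"
    and F: "closed (closure D - D)" "closure D - D \<noteq> {}"
  shows "\<exists>m1. \<forall>m\<ge>m1. \<omega> \<in> slipping margin (bump m (closure D - D))"
proof -
  define S where "S n = {u. 0 \<le> u \<and> X u \<omega> \<in> margin n}" for n
  define \<tau> where "\<tau> n = Inf (S n)" for n
  have S_ne: "S n \<noteq> {}" for n using reach[of 1 n] by (auto simp: S_def)
  have S_bdd: "bdd_below (S n)" for n by (auto simp: S_def bdd_below_def)
  have \<tau>_le: "\<tau> n \<le> t" for n
  proof (rule field_le_epsilon)
    fix \<eta> :: real assume "0 < \<eta>"
    then obtain u where "u \<in> S n" "u < t + \<eta>" using reach[of \<eta> n] by (auto simp: S_def)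
    then show "\<tau> n \<le> t + \<eta>" unfolding \<tau>_def using cInf_lower[OF _ S_bdd] by fastforce
  qed
  have \<tau>_mono: "incseq \<tau>"
  proof (rule incseq_SucI)
    fix n
    have "S (Suc n) \<subseteq> S n" using margin_antimono[of n "Suc n"] by (auto simp: S_def)
    then show "\<tau> n \<le> \<tau> (Suc n)" unfolding \<tau>_def by (intro cInf_superset_mono S_ne S_bdd)
  qed
  have bdd: "bdd_above (range \<tau>)" using \<tau>_le by (auto simp: bdd_above_def)
  define T where "T = (SUP n. \<tau> n)"
  have lim: "\<tau> \<longlonglongrightarrow> T" unfolding T_def by (rule LIMSEQ_incseq_SUP[OF bdd \<tau>_mono])
  have \<tau>T: "\<tau> n \<le> T" for n unfolding T_def by (rule cSUP_upper[OF _ bdd]) simp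
  have "T \<le> t" unfolding T_def by (rule cSUP_least) (use \<tau>_le in auto)
  have "0 \<le> \<tau> 0" unfolding \<tau>_def by (rule cInf_greatest[OF S_ne]) (simp add: S_def)
  then have "0 \<le> T" using \<tau>T[of 0] by simp
  have "X T \<omega> \<in> D" by (rule inD[OF \<open>0 \<le> T\<close> \<open>T \<le> t\<close>])
  then have pos: "0 < infdist (X T \<omega>) (closure D - D)" by (intro infdist_pos_not_in_closed[OF F]) auto
  obtain m1 where m1: "1 / real (Suc m1) < infdist (X T \<omega>) (closure D - D) / 2"
    using nat_approx_posE[of "infdist (X T \<omega>) (closure D - D) / 2"] pos by auto
  have "\<omega> \<in> slipping margin (bump m (closure D - D))" if "m1 \<le> m" for m
  proof -
    let ?f = "bump m (closure D - D)"
    have "1 / real (Suc m) \<le> 1 / real (Suc m1)" using that by (simp add: frac_le)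
    then have f0: "?f (X T \<omega>) = 0" using m1 by (intro bump_eq_0) linarith
    have "open {y. ?f y < 1/2}"
      by (rule open_Collect_less[OF bump_continuous continuous_on_const])
    then obtain \<eta> where \<eta>: "0 < \<eta>" "\<And>v. T \<le> v \<Longrightarrow> v < T + \<eta> \<Longrightarrow> X v \<omega> \<in> {y. ?f y < 1/2}"
      by (rule right_continuous_open[OF \<omega> \<open>0 \<le> T\<close>]) (use f0 in auto)
    show ?thesis
      unfolding slipping_def
    proof (rule event_liminfI, rule eventually_mono[OF eventually_inverse_Suc_less[OF \<eta>(1)]], rule event_liminfI)
      fix i :: nat
      define s where "s = 1 / real (Suc i)"
      assume "1 / real (Suc i) < \<eta>"
      then have s: "0 < s" "s < \<eta>" by (simp_all add: s_def)
      have "\<forall>\<^sub>F n in sequentially. T - s < \<tau> n" by (rule order_tendstoD(1)[OF lim]) (use s in simp)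
      then show "\<forall>\<^sub>F n in sequentially. \<omega> \<in> event_liminf (\<lambda>k. quick_escape (margin n) ?f (1 / real (Suc i)) (1 / real (Suc k)))"
      proof (rule eventually_mono, intro event_liminfI)
        fix n assume n: "T - s < \<tau> n"
        obtain u where u: "u \<in> S n" "u < \<tau> n + (\<eta> - s)"
          using cInf_lessD[OF S_ne, of n "\<tau> n + (\<eta> - s)"] s by (auto simp: \<tau>_def)
        then have u0: "0 \<le> u" "X u \<omega> \<in> margin n" by (auto simp: S_def)
        obtain e where e: "0 < e" "\<And>v. u \<le> v \<Longrightarrow> v < u + e \<Longrightarrow> X v \<omega> \<in> margin n"
          by (rule right_continuous_open[OF \<omega> u0(1) open_margin u0(2)]) blast
        have "0 < min e (\<tau> n + (\<eta> - s) - u)" using e(1) u(2) by simp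
        then show "\<forall>\<^sub>F k in sequentially. \<omega> \<in> quick_escape (margin n) ?f (1 / real (Suc i)) (1 / real (Suc k))"
        proof (rule eventually_mono[OF eventually_inverse_Suc_less])
          fix k :: nat
          define \<delta> where "\<delta> = 1 / real (Suc k)"
          assume "1 / real (Suc k) < min e (\<tau> n + (\<eta> - s) - u)"
          then have \<delta>: "0 < \<delta>" "\<delta> < e" "u + \<delta> < \<tau> n + (\<eta> - s)" by (simp_all add: \<delta>_def)
          obtain j where j: "u \<le> real j * \<delta>" "real j * \<delta> < u + \<delta>" by (rule grid_point[OF u0(1) \<delta>(1)])
          define j' where "j' = (LEAST j. X (real j * \<delta>) \<omega> \<in> margin n)"
          have jm: "X (real j * \<delta>) \<omega> \<in> margin n" using j \<delta> by (intro e(2)) auto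
          have j': "X (real j' * \<delta>) \<omega> \<in> margin n" "j' \<le> j"
            unfolding j'_def using jm by (rule LeastI, rule Least_le)
          have before: "X (real i * \<delta>) \<omega> \<notin> margin n" if "i < j'" for i
            using not_less_Least[of i "\<lambda>j. X (real j * \<delta>) \<omega> \<in> margin n"] that by (simp add: j'_def)
          have fe: "\<omega> \<in> first_entrance (margin n) \<delta> j'"
            unfolding first_entrance_def using \<omega> j'(1) before by auto
          have "real j' * \<delta> \<in> S n" using j'(1) \<delta>(1) by (simp add: S_def)
          then have "\<tau> n \<le> real j' * \<delta>" unfolding \<tau>_def by (rule cInf_lower[OF _ S_bdd])
          moreover have "real j' * \<delta> \<le> real j * \<delta>" using j'(2) \<delta>(1) by (intro mult_right_mono) auto
          ultimately have "T \<le> real j' * \<delta> + s" "real j' * \<delta> + s < T + \<eta>"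
            using n j(2) \<delta>(3) \<tau>T[of n] by linarith+
          then have "?f (X (real j' * \<delta> + s) \<omega>) < 1/2" using \<eta>(2) by simp
          then show "\<omega> \<in> quick_escape (margin n) ?f (1 / real (Suc i)) (1 / real (Suc k))"
            unfolding quick_escape_def s_def[symmetric] \<delta>_def[symmetric] using fe \<omega> by blast
        qed
      qed
    qed
  qed
  then show ?thesis by blast
qed

lemma closed_boundary: "closed (closure D - D)"
proof -
  obtain W where W: "open W" "D = closure D \<inter> W" by (rule D_open_set)
  then have "closure D - D = closure D - W" by blast
  then show ?thesis using W(1) by (simp add: closed_Diff)
qed

text \<open>
  Paths that are still in \<open>D\<close> shortly after \<open>t\<close> but have left every core must have visited every margin before or immediately after \<open>t\<close>, hence
  they slip. The exceptional set is null under all laws simultaneously, which is what the completeness of the filtration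
  requires.
\<close>

theorem exit_time_survives:
  assumes lc: "locally compact (UNIV :: 'a set)" and K: "compact (closure D)" and t: "0 \<le> t"
  obtains N where "N \<in> sets \<A>" "\<And>x. emeasure (Pr x) N = 0"
    "\<And>\<omega>. \<omega> \<in> space \<A> \<Longrightarrow> \<omega> \<notin> N \<Longrightarrow> ennreal t < exit_time X D \<omega> \<longleftrightarrow> (\<lambda>u. X u \<omega>) \<in> survives t"
proof -
  have exit: "ennreal t < exit_time X D \<omega>" if sv: "(\<lambda>u. X u \<omega>) \<in> survives t" for \<omega>
  proof -
    obtain n where n: "(\<lambda>u. X u \<omega>) \<in> stays (core n) (t + 1 / Suc n)" using sv by (auto simp: survives_def)
    then have "X u \<omega> \<in> D" if "0 \<le> u" "u < t + 1 / Suc n" for u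
      using that core_subset[of n] by (auto simp: stays_def)
    then show ?thesis unfolding less_exit_time_iff[OF t] by (intro exI[of _ "1 / real (Suc n)"]) auto
  qed
  have reach: "\<exists>u\<ge>0. u < t + \<eta> \<and> X u \<omega> \<in> margin n"
    if ex: "ennreal t < exit_time X D \<omega>" "(\<lambda>u. X u \<omega>) \<notin> survives t" "0 < \<eta>" for \<omega> n \<eta>
  proof -
    obtain e where e: "0 < e" "\<And>u. 0 \<le> u \<Longrightarrow> u < t + e \<Longrightarrow> X u \<omega> \<in> D"
      using ex(1) unfolding less_exit_time_iff[OF t] by blast
    have "\<forall>\<^sub>F k in sequentially. 1 / real (Suc k) < min e \<eta> \<and> n \<le> k"
      using eventually_conj[OF eventually_inverse_Suc_less[of "min e \<eta>"] eventually_ge_at_top[of n]] e(1) ex(3) by simp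
    then obtain k where k: "1 / real (Suc k) < min e \<eta>" "n \<le> k"
      using eventually_happens[of _ sequentially] by auto
    have "(\<lambda>u. X u \<omega>) \<notin> stays (core k) (t + 1 / Suc k)" using ex(2) by (auto simp: survives_def)
    then obtain u where u: "0 \<le> u" "u < t + 1 / Suc k" "X u \<omega> \<notin> core k" by (auto simp: stays_def)
    have "X u \<omega> \<in> D" using u k(1) by (intro e(2)) auto
    then have "X u \<omega> \<in> margin k" using u(3) closure_subset[of D] by (auto simp: core_def)
    then have "X u \<omega> \<in> margin n" using margin_antimono[OF k(2)] by blast
    then show ?thesis using u k(1) by (intro exI[of _ u]) auto
  qed
  show ?thesis
  proof (cases "closure D - D = {}")
    case True
    have "margin n = {}" for n unfolding margin_def True by simp
    then show ?thesis
      using exit reach[of _ 1] by (intro that[of "{}"]) auto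
  next
    case False
    have cF: "compact (closure D - D)"
      using compact_Int_closed[OF K closed_boundary] by (simp add: Int_absorb1 Diff_subset)
    obtain m0 where m0: "\<And>m. m0 \<le> m \<Longrightarrow> bump m (closure D - D) \<in> C0_on UNIV"
      using bump_in_C0[OF lc cF False] by blast
    define Z where "Z m = slipping margin (bump (m0 + m) (closure D - D))" for m
    have Z: "Z m \<in> sets \<A>" "emeasure (Pr x) (Z m) = 0" for m x
    proof -
      have one: "bump (m0 + m) (closure D - D) y = 1" if nm: "m0 + m \<le> n" "y \<in> margin n" for n y
      proof (rule bump_eq_1)
        obtain z where "z \<in> closure D - D" "dist z y < 1 / Suc n" using nm(2) by (auto simp: margin_def)
        then have "infdist y (closure D - D) \<le> dist y z" by (intro infdist_le)
        also have "\<dots> \<le> 1 / Suc n" using \<open>dist z y < 1 / Suc n\<close> by (simp add: dist_commute)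
        also have "\<dots> \<le> 1 / Suc (m0 + m)" using nm(1) by (simp add: frac_le)
        finally show "infdist y (closure D - D) \<le> 1 / Suc (m0 + m)" .
      qed
      show "Z m \<in> sets \<A>" "emeasure (Pr x) (Z m) = 0"
        unfolding Z_def
        by (rule slipping_null[OF open_margin m0 bump_bounded_borel bump_range(2) one]; simp)+
    qed
    show ?thesis
    proof (rule that[of "\<Union>m. Z m"])
      show "(\<Union>m. Z m) \<in> sets \<A>" using Z(1) by auto
      show "emeasure (Pr x) (\<Union>m. Z m) = 0" for x
        by (rule emeasure_UN_eq_0) (use Z in \<open>auto simp: sets_law\<close>)
      fix \<omega> assume \<omega>: "\<omega> \<in> space \<A>" "\<omega> \<notin> (\<Union>m. Z m)"
      show "ennreal t < exit_time X D \<omega> \<longleftrightarrow> (\<lambda>u. X u \<omega>) \<in> survives t"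
      proof (rule iffI, rule ccontr)
        assume ex: "ennreal t < exit_time X D \<omega>" "(\<lambda>u. X u \<omega>) \<notin> survives t"
        have inD: "X u \<omega> \<in> D" if "0 \<le> u" "u \<le> t" for u
          using ex(1) that unfolding less_exit_time_iff[OF t] by force
        have "\<exists>m1. \<forall>m\<ge>m1. \<omega> \<in> slipping margin (bump m (closure D - D))"
          by (rule slipping_if_margin_reached[OF \<omega>(1) t inD reach[OF ex] closed_boundary False])
        then obtain m1 where "\<And>m. m1 \<le> m \<Longrightarrow> \<omega> \<in> slipping margin (bump m (closure D - D))" by blast
        then have "\<omega> \<in> Z m1" unfolding Z_def by simp
        then show False using \<omega>(2) by blast
      qed (rule exit)
    qed
  qed
qed

text \<open>
  The event \<open>\<tau>\<^sub>D > t\<close> is measurable only thanks to completeness: it differs from an event by a subset of a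
  set that is null under all laws.
\<close>

theorem killed_semigroup_eq_Q:
  assumes lc: "locally compact (UNIV :: 'a set)" and K: "compact (closure D)" and t: "0 \<le> t"
    and f: "(\<lambda>y. indicator D y * f y) \<in> bounded_borel"
  shows "killed_semigroup Pr X D t f x = Q t (\<lambda>y. indicator D y * f y) x"
proof -
  obtain N where N: "N \<in> sets \<A>" "\<And>x. emeasure (Pr x) N = 0"
    "\<And>\<omega>. \<omega> \<in> space \<A> \<Longrightarrow> \<omega> \<notin> N \<Longrightarrow> ennreal t < exit_time X D \<omega> \<longleftrightarrow> (\<lambda>u. X u \<omega>) \<in> survives t"
    by (rule exit_time_survives[OF lc K t]) blast
  let ?g = "\<lambda>y. indicator D y * f y"
  have inD: "X t \<omega> \<in> D" if "ennreal t < exit_time X D \<omega>" for \<omega>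
    using that t unfolding less_exit_time_iff[OF t] by force
  define E where "E = {\<omega> \<in> space \<A>. ennreal t < exit_time X D \<omega>}"
  have E_eq: "E = ({\<omega> \<in> space \<A>. (\<lambda>u. X u \<omega>) \<in> survives t} - N) \<union> (E \<inter> N)"
    unfolding E_def using N(3) by blast
  have sv: "{\<omega> \<in> space \<A>. (\<lambda>u. X u \<omega>) \<in> survives t} \<in> sets \<A>"
    by (rule sets_filtration[OF t survives_filtration[OF t]])
  have EN: "E \<inter> N \<in> sets \<A>"
    by (rule sets_filtration[OF order_refl filtration_complete[OF N(1)]]) (use N(2) in auto)
  have E: "E \<in> sets \<A>"
    by (subst E_eq) (rule sets.Un[OF sets.Diff[OF sv N(1)] EN])
  have gX: "(\<lambda>\<omega>. ?g (X t \<omega>)) \<in> borel_measurable \<A>"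
    by (rule measurable_compose[OF X_measurable[OF t]]) (use f in \<open>simp add: bounded_borel_iff\<close>)
  have "killed_semigroup Pr X D t f x = (\<integral>\<omega>. ?g (X t \<omega>) * indicator E \<omega> \<partial>Pr x)"
    unfolding killed_semigroup_def
    by (rule Bochner_Integration.integral_cong[OF refl]) (use inD in \<open>auto simp: E_def indicator_def\<close>)
  also have "\<dots> = (\<integral>\<omega>. ?g (X t \<omega>) * indicator (survives t) (\<lambda>u. X u \<omega>) \<partial>Pr x)"
  proof (rule integral_cong_AE)
    show "(\<lambda>\<omega>. ?g (X t \<omega>) * indicator E \<omega>) \<in> borel_measurable (Pr x)"
      unfolding measurable_Pr by (rule borel_measurable_times[OF gX borel_measurable_indicator[OF E]])
    show "(\<lambda>\<omega>. ?g (X t \<omega>) * indicator (survives t) (\<lambda>u. X u \<omega>)) \<in> borel_measurable (Pr x)"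
      unfolding measurable_Pr by (rule killed_measurable[OF f t])
    have "AE \<omega> in Pr x. \<omega> \<notin> N" by (rule AE_not_in) (use N in \<open>auto simp: null_sets_def sets_law\<close>)
    moreover have "AE \<omega> in Pr x. \<omega> \<in> space \<A>" using AE_space[of "Pr x"] by simp
    ultimately show "AE \<omega> in Pr x. ?g (X t \<omega>) * indicator E \<omega> = ?g (X t \<omega>) * indicator (survives t) (\<lambda>u. X u \<omega>)"
      by eventually_elim (use N(3) in \<open>auto simp: E_def indicator_def\<close>)
  qed
  finally show ?thesis unfolding Q_eq .
qed

lemma Q_antimono:
  assumes "0 \<le> s" "s \<le> t"
  shows "Q t (\<lambda>_. 1) x \<le> Q s (\<lambda>_. 1) x"
  unfolding Q_eq
proof (rule integral_mono)
  show "integrable (Pr x) (\<lambda>\<omega>. 1 * indicator (survives t) (\<lambda>u. X u \<omega>) :: real)"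
    by (rule integrable_bounded[where b=1]) (use killed_measurable[OF bounded_borel_const, of t 1] assms in \<open>auto simp: indicator_def\<close>)
  show "integrable (Pr x) (\<lambda>\<omega>. 1 * indicator (survives s) (\<lambda>u. X u \<omega>) :: real)"
    by (rule integrable_bounded[where b=1]) (use killed_measurable[OF bounded_borel_const, of s 1] assms in \<open>auto simp: indicator_def\<close>)
  show "1 * indicator (survives t) (\<lambda>u. X u \<omega>) \<le> (1 * indicator (survives s) (\<lambda>u. X u \<omega>) :: real)" for \<omega>
    using survives_antimono[OF assms(2)] by (auto simp: indicator_def)
qed

lemma Q_one_le_bump:
  assumes t: "0 \<le> t"
  shows "Q t (\<lambda>_. 1) x \<le> kernel_op (P t) (bump m (closure D)) x"
proof -
  have "Q t (\<lambda>_. 1) x \<le> (\<integral>\<omega>. bump m (closure D) (X t \<omega>) \<partial>Pr x)"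
    unfolding Q_eq
  proof (rule integral_mono)
    show "integrable (Pr x) (\<lambda>\<omega>. 1 * indicator (survives t) (\<lambda>u. X u \<omega>) :: real)"
      by (rule integrable_bounded[where b=1]) (use killed_measurable[OF bounded_borel_const t, of 1] in \<open>auto simp: indicator_def\<close>)
    show "integrable (Pr x) (\<lambda>\<omega>. bump m (closure D) (X t \<omega>))"
      by (rule integrable_bounded[where b=1, OF measurable_compose[OF X_measurable[OF t]]])
        (use bump_bounded_borel bump_abs in \<open>auto simp: bounded_borel_iff\<close>)
    fix \<omega>
    show "1 * indicator (survives t) (\<lambda>u. X u \<omega>) \<le> bump m (closure D) (X t \<omega>)"
    proof (cases "(\<lambda>u. X u \<omega>) \<in> survives t")
      case True
      then have "X t \<omega> \<in> closure D" using survives_in_D[of "\<lambda>u. X u \<omega>" t t] t closure_subset[of D] by auto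
      then show ?thesis using bump_eq_1[of "X t \<omega>" "closure D" m] by simp
    qed (simp add: bump_range)
  qed
  also have "\<dots> = kernel_op (P t) (bump m (closure D)) x" by (rule expectation_kernel[OF bump_bounded_borel t])
  finally show ?thesis .
qed

text \<open>
  The probability \<open>P\<^sub>t(x, K)\<close> is the decreasing limit of \<open>P\<^sub>t f x\<close> for bump functions \<open>f\<close> around \<open>K\<close>, and for one
  of them the value at \<open>x\<close> is already less than \<open>1\<close>. By the Feller property this persists near \<open>x\<close>.
\<close>

lemma local_escape:
  assumes lc: "locally compact (UNIV :: 'a set)" and K: "compact (closure D)" "D \<noteq> {}"
    and t: "0 \<le> t" and esc: "0 < measure (P t x) (- closure D)"
  shows "\<exists>V \<delta>. open V \<and> x \<in> V \<and> 0 < \<delta> \<and> (\<forall>y\<in>V. Q t (\<lambda>_. 1) y \<le> 1 - \<delta>)"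
proof -
  have "P t x \<in> space (prob_algebra borel)" by (rule measurable_space[OF markov_kernel[OF t]]) simp
  then have Ptx: "prob_space (P t x)" "sets (P t x) = sets borel" by (auto simp: space_prob_algebra)
  interpret prob_space "P t x" by (rule Ptx)
  have Kb: "closure D \<in> sets borel" by auto
  have sp: "space (P t x) = UNIV" using sets_eq_imp_space_eq[OF Ptx(2)] by simp
  have lt1: "measure (P t x) (closure D) < 1"
    using prob_compl[of "closure D"] Kb esc Ptx(2) by (simp add: sp Compl_eq_Diff_UNIV)
  have ne: "closure D \<noteq> {}" using K(2) by simp
  obtain m0 where m0: "\<And>m. m0 \<le> m \<Longrightarrow> bump m (closure D) \<in> C0_on UNIV"
    using bump_in_C0[OF lc K(1) ne] by blast
  have lim: "(\<lambda>m. bump m (closure D) y) \<longlonglongrightarrow> indicator (closure D) y" for y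
  proof (cases "y \<in> closure D")
    case True
    then show ?thesis by (simp add: bump_eq_1)
  next
    case False
    then have pos: "0 < infdist y (closure D)" by (intro infdist_pos_not_in_closed ne) auto
    have "\<forall>\<^sub>F m in sequentially. bump m (closure D) y = 0"
      using eventually_inverse_Suc_less[of "infdist y (closure D) / 2"] pos
      by (auto elim!: eventually_mono intro!: bump_eq_0)
    then show ?thesis using False by (simp add: tendsto_eventually)
  qed
  have "(\<lambda>m. kernel_op (P t) (bump m (closure D)) x) \<longlonglongrightarrow> (\<integral>y. indicator (closure D) y \<partial>P t x)"
    unfolding kernel_op_def
    by (rule daniell_limit[OF daniell_integral[OF finite_measure_axioms Ptx(2)] bump_bounded_borel bump_abs lim])
  then have "(\<lambda>m. kernel_op (P t) (bump m (closure D)) x) \<longlonglongrightarrow> measure (P t x) (closure D)"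
    using Kb Ptx(2) by simp
  then have "\<forall>\<^sub>F m in sequentially. kernel_op (P t) (bump m (closure D)) x < 1 \<and> m0 \<le> m"
    using order_tendstoD(2)[OF _ lt1] eventually_ge_at_top[of m0] by (intro eventually_conj)
  then obtain m where m: "kernel_op (P t) (bump m (closure D)) x < 1" "m0 \<le> m"
    using eventually_happens[of _ sequentially] by auto
  define g where "g = kernel_op (P t) (bump m (closure D))"
  have "g \<in> C0_on UNIV" unfolding g_def by (rule C0_invariant[OF t m0[OF m(2)]])
  then have gc: "continuous_on UNIV g" by (simp add: C0_on_def bounded_continuous_on_def)
  define \<delta> where "\<delta> = (1 - g x) / 2"
  have "0 < \<delta>" using m(1) by (simp add: \<delta>_def g_def)
  show ?thesis
  proof (intro exI conjI ballI)
    show "open {y. g y < 1 - \<delta>}" by (rule open_Collect_less[OF gc continuous_on_const])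
    show "x \<in> {y. g y < 1 - \<delta>}" using \<open>0 < \<delta>\<close> by (simp add: \<delta>_def field_simps)
    show "0 < \<delta>" by fact
    show "Q t (\<lambda>_. 1) y \<le> 1 - \<delta>" if "y \<in> {y. g y < 1 - \<delta>}" for y
      using Q_one_le_bump[OF t, of y m] that by (simp add: g_def)
  qed
qed

lemma Q_one_le_1: "0 \<le> t \<Longrightarrow> Q t (\<lambda>_. 1) x \<le> 1"
proof -
  assume t: "0 \<le> t"
  interpret prob_space "Pr x" by (rule prob_Pr)
  have "Q t (\<lambda>_. 1) x \<le> (\<integral>\<omega>. 1 \<partial>Pr x)"
    unfolding Q_eq
  proof (rule integral_mono)
    show "integrable (Pr x) (\<lambda>\<omega>. 1 * indicator (survives t) (\<lambda>u. X u \<omega>) :: real)"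
      by (rule integrable_bounded[where b=1]) (use killed_measurable[OF bounded_borel_const t, of 1] in \<open>auto simp: indicator_def\<close>)
  qed (auto simp: indicator_def)
  then show ?thesis using prob_space by simp
qed

text \<open>
  Compactness of \<open>K\<close> turns the local bounds into a uniform one: from everywhere, the survival probability up to
  some fixed time \<open>T\<close> is at most \<open>q < 1\<close>. The semigroup property iterates this bound.
\<close>

theorem exponential_decay:
  assumes lc: "locally compact (UNIV :: 'a set)" and K: "compact (closure D)" "D \<noteq> {}"
    and acc: "\<forall>x\<in>closure D. \<exists>t\<ge>0. measure (P t x) (- closure D) > 0"
  obtains C c where "0 \<le> C" "0 < c" "\<And>t x. 0 \<le> t \<Longrightarrow> Q t (\<lambda>_. 1) x \<le> C * exp (- c * t)"
proof -
  define G where "G n = \<Union>{V. open V \<and> (\<exists>t. 0 \<le> t \<and> t \<le> real n \<and> (\<forall>y\<in>V. Q t (\<lambda>_. 1) y \<le> 1 - 1 / real (Suc (Suc n))))}" for n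
  have "closure D \<subseteq> (\<Union>n\<in>UNIV. G n)"
  proof
    fix x assume "x \<in> closure D"
    then obtain t where t: "0 \<le> t" "0 < measure (P t x) (- closure D)" using acc by blast
    obtain V \<delta> where V: "open V" "x \<in> V" "0 < \<delta>" "\<And>y. y \<in> V \<Longrightarrow> Q t (\<lambda>_. 1) y \<le> 1 - \<delta>"
      using local_escape[OF lc K t] by blast
    obtain n1 where n1: "1 / real (Suc n1) < \<delta>" using nat_approx_posE[OF V(3)] by auto
    obtain n2 where n2: "t \<le> real n2" using real_arch_simple by blast
    define n where "n = max n1 n2"
    have "1 / real (Suc (Suc n)) \<le> 1 / real (Suc n1)" by (simp add: n_def frac_le)
    then have "\<forall>y\<in>V. Q t (\<lambda>_. 1) y \<le> 1 - 1 / real (Suc (Suc n))" using V(4) n1 by force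
    moreover have "t \<le> real n" using n2 by (simp add: n_def)
    ultimately have "x \<in> G n" unfolding G_def using V(1,2) t(1) by blast
    then show "x \<in> (\<Union>n\<in>UNIV. G n)" by blast
  qed
  then have "\<exists>I\<subseteq>UNIV. finite I \<and> closure D \<subseteq> (\<Union>n\<in>I. G n)"
    by (rule compactE_image[OF K(1), rotated]) (auto simp: G_def)
  then obtain I where I: "finite I" "closure D \<subseteq> (\<Union>n\<in>I. G n)" by blast
  obtain N where N: "\<And>n. n \<in> I \<Longrightarrow> n \<le> N" using I(1) by (auto simp: finite_nat_set_iff_bounded_le)
  \<comment> \<open>\<open>T > 0\<close> and \<open>q > 0\<close> are secured by the successors\<close>
  define T where "T = real (Suc N)"
  define q where "q = 1 - 1 / real (Suc (Suc N))"
  have "0 < T" by (simp add: T_def)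
  have q: "0 < q" "q < 1" by (simp_all add: q_def field_simps)
  have one_step: "Q T (\<lambda>_. 1) x \<le> q" for x
  proof (cases "x \<in> D")
    case False
    then show ?thesis using Q_start_zero[of T x] \<open>0 < T\<close> q by simp
  next
    case True
    then obtain n V t where n: "n \<in> I" "x \<in> V" "0 \<le> t" "t \<le> real n" "\<forall>y\<in>V. Q t (\<lambda>_. 1) y \<le> 1 - 1 / real (Suc (Suc n))"
      using I(2) closure_subset[of D] unfolding G_def by blast
    have "t \<le> T" using n(4) N[OF n(1)] by (simp add: T_def)
    then have "Q T (\<lambda>_. 1) x \<le> Q t (\<lambda>_. 1) x" by (rule Q_antimono[OF n(3)])
    also have "\<dots> \<le> 1 - 1 / real (Suc (Suc n))" using n(2,5) by blast
    also have "\<dots> \<le> q" unfolding q_def using N[OF n(1)] by (simp add: frac_le)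
    finally show ?thesis .
  qed
  have steps: "Q (real n * T) (\<lambda>_. 1) x \<le> q ^ n" for n x
  proof (induction n arbitrary: x)
    case 0
    then show ?case using Q_one_le_1[of 0 x] by simp
  next
    case (Suc n)
    have T0: "0 \<le> T" "0 \<le> real n * T" using \<open>0 < T\<close> by auto
    have bb: "Q (real n * T) (\<lambda>_. 1) \<in> bounded_borel"
      unfolding Q_def by (rule markov_functional_mean[OF markov_functional_killed[OF bounded_borel_const T0(2)]])
    have "Q (real (Suc n) * T) (\<lambda>_. 1) x = Q T (Q (real n * T) (\<lambda>_. 1)) x"
      using killed_semigroup_property[OF T0 bounded_borel_const, of 1 x] by (simp add: distrib_right)
    also have "\<dots> \<le> Q T (\<lambda>_. q ^ n) x"
      by (rule daniell_mono[OF daniell_Q[OF T0(1)] bb bounded_borel_const Suc])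
    also have "\<dots> = q ^ n * Q T (\<lambda>_. 1) x" by (rule daniell_const[OF daniell_Q[OF T0(1)]])
    also have "\<dots> \<le> q ^ n * q" using one_step q by (intro mult_left_mono) auto
    finally show ?case by (simp add: mult.commute)
  qed
  show ?thesis
  proof (rule that[of "1 / q" "- ln q / T"])
    show "0 \<le> 1 / q" using q by simp
    show "0 < - ln q / T" using q \<open>0 < T\<close> by (simp add: divide_neg_pos)
    fix t x assume "(0::real) \<le> t"
    define n where "n = nat \<lfloor>t / T\<rfloor>"
    have fl: "real n = of_int \<lfloor>t / T\<rfloor>" using \<open>0 \<le> t\<close> \<open>0 < T\<close> by (simp add: n_def)
    then have n: "real n \<le> t / T" "t / T - 1 \<le> real n" by linarith+
    have "Q t (\<lambda>_. 1) x \<le> Q (real n * T) (\<lambda>_. 1) x"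
      by (rule Q_antimono) (use n(1) \<open>0 < T\<close> in \<open>simp_all add: pos_le_divide_eq\<close>)
    also have "\<dots> \<le> q ^ n" by (rule steps)
    also have "q ^ n = exp (real n * ln q)" using q by (simp add: exp_of_nat_mult)
    also have "\<dots> \<le> exp ((t / T - 1) * ln q)"
      using n(2) q by (simp add: mult_right_mono_neg)
    also have "(t / T - 1) * ln q = - (- ln q / T) * t - ln q"
      by (simp add: algebra_simps)
    also have "exp (- (- ln q / T) * t - ln q) = 1 / q * exp (- (- ln q / T) * t)"
      using q by (simp add: exp_diff)
    finally show "Q t (\<lambda>_. 1) x \<le> 1 / q * exp (- (- ln q / T) * t)" .
  qed
qed

end

section \<open>Quasi-stationary distributions\<close>

lemma (in transient_semigroup) kernel_operator_Q:
  assumes "0 \<le> t"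
  shows "kernel_operator (Q t) D"
proof
  show "daniell (\<lambda>f. Q t f x)" for x by (rule Q_daniell[OF assms])
  show "Q t f \<in> bounded_borel" if "f \<in> bounded_borel" for f by (rule Q_bounded_borel[OF that assms])
  show "D \<in> sets borel" by (rule D_borel)
  show "Q t (indicator (- D)) x = 0" for x by (rule Q_outside[OF assms])
qed

text \<open>
  At a point of \<open>K - D\<close>: a compactly supported function close to \<open>g\<close> vanishes near that point, since its
  support is a closed set that misses the point. At a point of \<open>D\<close>: as \<open>D\<close> is open relative to \<open>K\<close>, continuity on \<open>D\<close> suffices.
\<close>

lemma continuous_on_zero_extension:
  fixes g g' :: "'a::t2_space \<Rightarrow> real"
  assumes K: "D \<subseteq> K" "openin (top_of_set K) D"
    and g: "g \<in> C0_on D" and eq: "\<And>x. x \<in> D \<Longrightarrow> g' x = g x" and zero: "\<And>x. x \<notin> D \<Longrightarrow> g' x = 0"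
  shows "continuous_on K g'"
  unfolding continuous_on_def
proof
  fix x assume "x \<in> K"
  show "(g' \<longlongrightarrow> g' x) (at x within K)"
  proof (cases "x \<in> D")
    case True
    obtain W where W: "open W" "D = K \<inter> W" using K(2) by (auto simp: openin_open)
    have "continuous_on D g'"
      using g eq continuous_on_cong[of D D g' g] by (simp add: C0_on_def bounded_continuous_on_def)
    then have "(g' \<longlongrightarrow> g' x) (at x within D)" using True by (simp add: continuous_on_def)
    moreover have "at x within D = at x within K"
      by (rule at_within_nhd[of x W]) (use W True in auto)
    ultimately show ?thesis by simp
  next
    case False
    show ?thesis
    proof (rule tendstoI)
      fix e :: real assume "0 < e"
      then obtain f where f: "f \<in> compactly_supported_on D" "\<And>y. y \<in> D \<Longrightarrow> \<bar>g y - f y\<bar> < e"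
        using g unfolding C0_on_def by blast
      define S where "S = D \<inter> closure {y \<in> D. f y \<noteq> 0}"
      have "closed S" using f(1) by (simp add: S_def compactly_supported_on_def compact_imp_closed)
      moreover have "x \<in> - S" using False by (simp add: S_def)
      moreover have "dist (g' y) (g' x) < e" if "y \<in> - S" for y
      proof (cases "y \<in> D")
        case True
        then have "f y = 0" using that closure_subset[of "{y \<in> D. f y \<noteq> 0}"] by (auto simp: S_def)
        then show ?thesis using f(2)[OF True] eq[OF True] zero[OF False] by (simp add: dist_real_def)
      next
        case y: False
        then show ?thesis using zero[OF y] zero[OF False] \<open>0 < e\<close> by simp
      qed
      ultimately show "\<forall>\<^sub>F y in at x within K. dist (g' y) (g' x) < e"
        unfolding eventually_at_topological by (intro exI[of _ "- S"]) auto
    qed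
  qed
qed

lemma bounded_measurable_on_extend:
  assumes "D \<in> sets borel" "f \<in> bounded_measurable_on D"
  shows "(\<lambda>x. indicator D x * f x) \<in> bounded_borel"
proof -
  have "(\<lambda>x. indicator D x *\<^sub>R f x) \<in> borel_measurable borel"
    using assms by (subst borel_measurable_restrict_space_iff[symmetric]) (auto simp: bounded_measurable_on_def)
  moreover obtain b where "\<And>x. x \<in> D \<Longrightarrow> \<bar>f x\<bar> \<le> b"
    using assms(2) by (auto simp: bounded_measurable_on_def bounded_iff)
  then have "\<bar>indicator D x * f x\<bar> \<le> max b 0" for x
    by (cases "x \<in> D") (auto simp: le_max_iff_disj)
  ultimately show ?thesis by (intro bounded_borelI[where b="max b 0"]) auto
qed

locale transient_killed_process = killed_feller_process P \<A> \<F> Pr X D + transient_semigroup Q D C c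
  for P :: "real \<Rightarrow> 'a::{metric_space, second_countable_topology} \<Rightarrow> 'a measure"
    and \<A> :: "'w measure" and \<F> :: "real \<Rightarrow> 'w measure" and Pr :: "'a \<Rightarrow> 'w measure"
    and X :: "real \<Rightarrow> 'w \<Rightarrow> 'a" and D :: "'a set" and C c :: real +
  assumes loc_compact: "locally compact (UNIV :: 'a set)" and compact_closure: "compact (closure D)"
begin

lemma green_operator_eq:
  assumes "f \<in> bounded_measurable_on D"
  shows "green_operator Pr X D f x = green (\<lambda>y. indicator D y * f y) x"
proof -
  have f: "(\<lambda>y. indicator D y * f y) \<in> bounded_borel" by (rule bounded_measurable_on_extend[OF D_borel assms])
  show ?thesis
    unfolding green_operator_def green_def set_lebesgue_integral_def
    by (rule Bochner_Integration.integral_cong[OF refl])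
      (auto simp: indicator_def[of "{0..}"] killed_semigroup_eq_Q[OF loc_compact compact_closure _ f])
qed

lemma killed_semigroup_indicator:
  assumes "A \<in> sets borel" "A \<subseteq> D" "0 \<le> t"
  shows "killed_semigroup Pr X D t (indicator A) x = Q t (indicator A) x"
proof -
  have eq: "(\<lambda>y. indicator D y * indicator A y) = (indicator A :: 'a \<Rightarrow> real)"
    using assms(2) by (auto simp: indicator_def fun_eq_iff)
  show ?thesis
    using killed_semigroup_eq_Q[OF loc_compact compact_closure assms(3), of "indicator A" x]
    by (simp add: eq bounded_borel_indicator assms(1))
qed

lemma quasi_stationary_functional:
  assumes "quasi_stationary Pr X D \<mu>"
  defines "L \<equiv> \<lambda>f. \<integral>x. f x \<partial>\<mu>"
  shows "daniell L" and "L (\<lambda>x. 1) = 1" and "L (indicator (- D)) = 0"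
    and "\<exists>lam>0. \<forall>f\<in>bounded_borel. L (green f) = 1 / lam * L f"
proof -
  have sets: "sets \<mu> = sets (restrict_space borel D)" and "prob_space \<mu>"
    and ex: "\<exists>lam>0. \<forall>t\<ge>0. \<forall>A\<in>sets \<mu>.
      (\<integral>x. killed_semigroup Pr X D t (indicator A) x \<partial>\<mu>) = exp (- lam * t) * measure \<mu> A"
    using assms(1) by (auto simp: quasi_stationary_def)
  interpret prob_space \<mu> by fact
  have sp: "space \<mu> = D" using sets_eq_imp_space_eq[OF sets] by (simp add: space_restrict_space)
  have ident: "(\<lambda>x. x) \<in> measurable \<mu> borel"
    unfolding measurable_cong_sets[OF sets refl] by (rule measurable_restrict_space1) simp
  define M where "M = distr \<mu> borel (\<lambda>x. x)"
  interpret M: prob_space M unfolding M_def by (rule prob_space_distr[OF ident])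
  have LM: "L f = (\<integral>x. f x \<partial>M)" if "f \<in> bounded_borel" for f
    unfolding L_def M_def by (rule integral_distr[OF ident, symmetric]) (use that in \<open>simp add: bounded_borel_iff\<close>)
  have dM: "daniell (\<lambda>f. \<integral>x. f x \<partial>M)"
    by (rule daniell_integral[OF M.finite_measure_axioms]) (simp add: M_def)
  show dL: "daniell L"
  proof (rule daniellI)
    fix F :: "nat \<Rightarrow> 'a \<Rightarrow> real" and g b
    assume F: "\<And>n. F n \<in> bounded_borel" "\<And>n x. \<bar>F n x\<bar> \<le> b" "\<And>x. (\<lambda>n. F n x) \<longlonglongrightarrow> g x"
    have "g \<in> bounded_borel" by (rule bounded_borel_limit[OF F])
    then show "(\<lambda>n. L (F n)) \<longlonglongrightarrow> L g" using daniell_limit[OF dM F] LM F(1) by simp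
  next
    fix f g :: "'a \<Rightarrow> real" assume fg: "f \<in> bounded_borel" "g \<in> bounded_borel"
    then show "L (\<lambda>x. f x + g x) = L f + L g"
      using daniell_add[OF dM fg] LM[OF bounded_borel_add[OF fg]] by (simp only: LM)
  next
    fix f :: "'a \<Rightarrow> real" and c
    show "L (\<lambda>x. c * f x) = c * L f" unfolding L_def by simp
  next
    fix f :: "'a \<Rightarrow> real" assume "\<And>x. 0 \<le> f x"
    then show "0 \<le> L f" unfolding L_def by simp
  qed
  show "L (\<lambda>x. 1) = 1" unfolding L_def using prob_space by simp
  have "L (indicator (- D)) = (\<integral>x. 0 \<partial>\<mu>)"
    unfolding L_def by (rule Bochner_Integration.integral_cong[OF refl]) (simp add: sp)
  then show "L (indicator (- D)) = 0" by simp
  obtain lam where lam: "0 < lam" and qs: "\<And>t A. 0 \<le> t \<Longrightarrow> A \<in> sets \<mu> \<Longrightarrow>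
      (\<integral>x. killed_semigroup Pr X D t (indicator A) x \<partial>\<mu>) = exp (- lam * t) * measure \<mu> A"
    using ex by blast
  have decay: "L (Q t f) = exp (- lam * t) * L f" if t: "0 \<le> t" and f: "f \<in> bounded_borel" for t f
  proof (rule daniell_eq_open[OF _ daniell_scale[OF dL] _ f])
    interpret K: kernel_operator "Q t" D by (rule kernel_operator_Q[OF t])
    show "daniell (\<lambda>f. L (Q t f))" by (rule K.daniell_comp_kernel[OF dL])
    fix U :: "'a set" assume "open U"
    then have UD: "U \<inter> D \<in> sets borel" "U \<in> sets borel" using D_borel by auto
    then have A: "U \<inter> D \<in> sets \<mu>" unfolding sets by (auto simp: sets_restrict_space)
    have "Q t (indicator U) x = Q t (indicator (U \<inter> D)) x" for x
      by (rule K.kernel_restrict) (use UD in \<open>auto simp: indicator_def[of _ "_::'a"] intro!: bounded_borel_indicator\<close>)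
    then have "L (Q t (indicator U)) = (\<integral>x. killed_semigroup Pr X D t (indicator (U \<inter> D)) x \<partial>\<mu>)"
      unfolding L_def using killed_semigroup_indicator[OF UD(1) _ t] by simp
    also have "\<dots> = exp (- lam * t) * measure \<mu> (U \<inter> D)" by (rule qs[OF t A])
    also have "measure \<mu> (U \<inter> D) = L (indicator U)"
    proof -
      have "L (indicator U) = (\<integral>x. indicator (U \<inter> D) x \<partial>\<mu>)"
        unfolding L_def by (rule Bochner_Integration.integral_cong[OF refl]) (simp add: sp indicator_def)
      then show ?thesis using A by simp
    qed
    finally show "L (Q t (indicator U)) = exp (- lam * t) * L (indicator U)" .
  qed simp
  then have "L (green f) = 1 / lam * L f" if "f \<in> bounded_borel" for f
    by (intro green_eigen_if_decay[OF dL that lam]) (use that in auto)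
  with lam show "\<exists>lam>0. \<forall>f\<in>bounded_borel. L (green f) = 1 / lam * L f" by blast
qed

lemma eigenfunctional_quasi_stationary:
  assumes L: "daniell L" "L (\<lambda>x. 1) = 1" "L (indicator (- D)) = 0"
    and r: "0 < r" "\<And>f. f \<in> bounded_borel \<Longrightarrow> L (green f) = r * L f"
  shows "\<exists>\<mu>. quasi_stationary Pr X D \<mu>"
proof -
  obtain M where M: "finite_measure M" "sets M = sets borel"
    "\<And>f. f \<in> bounded_borel \<Longrightarrow> L f = (\<integral>x. f x \<partial>M)" by (rule daniell_representation[OF L(1)]) (rule that; blast)
  interpret M: finite_measure M by fact
  have sp: "space M = UNIV" using sets_eq_imp_space_eq[OF M(2)] by simp
  have meas: "measure M A = L (indicator A)" if "A \<in> sets borel" for A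
    using M(3)[OF bounded_borel_indicator[OF that]] that M(2) by simp
  have "measure M D = 1"
  proof -
    have "L (\<lambda>x. indicator D x + indicator (- D) x) = L (indicator D) + L (indicator (- D))"
      using D_borel by (intro daniell_add[OF L(1)] bounded_borel_indicator) auto
    moreover have "(\<lambda>x. indicator D x + indicator (- D) x) = (\<lambda>x::'a. 1 :: real)"
      by (auto simp: indicator_def)
    ultimately show ?thesis using L meas[OF D_borel] by simp
  qed
  define \<mu> where "\<mu> = restrict_space M D"
  have DM: "D \<inter> space M \<in> sets M" using D_borel M(2) sp by simp
  have sets: "sets \<mu> = sets (restrict_space borel D)"
    unfolding \<mu>_def by (rule sets_restrict_space_cong[OF M(2)])
  have "prob_space \<mu>"
  proof
    show "emeasure \<mu> (space \<mu>) = 1"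
      using DM \<open>measure M D = 1\<close> by (simp add: \<mu>_def space_restrict_space emeasure_restrict_space sp M.emeasure_eq_measure)
  qed
  have "(\<integral>x. killed_semigroup Pr X D t (indicator A) x \<partial>\<mu>) = exp (- (1 / r) * t) * measure \<mu> A"
    if t: "0 \<le> t" and A: "A \<in> sets \<mu>" for t A
  proof -
    have A': "A \<in> sets borel" "A \<subseteq> D" using A D_borel unfolding sets by (auto simp: sets_restrict_space)
    have bA: "indicator A \<in> bounded_borel" by (rule bounded_borel_indicator[OF A'(1)])
    have "(\<integral>x. killed_semigroup Pr X D t (indicator A) x \<partial>\<mu>) = (\<integral>x. Q t (indicator A) x \<partial>\<mu>)"
      by (simp only: killed_semigroup_indicator[OF A' t])
    also have "\<dots> = (\<integral>x. indicator D x *\<^sub>R Q t (indicator A) x \<partial>M)"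
      unfolding \<mu>_def by (rule integral_restrict_space[OF DM])
    also have "\<dots> = (\<integral>x. Q t (indicator A) x \<partial>M)"
      by (rule Bochner_Integration.integral_cong[OF refl])
        (auto simp: indicator_def[of D] Q_vanish_outside[OF bA t])
    also have "\<dots> = exp (- t / r) * L (indicator A)"
      using decay_if_green_eigen[OF L(1) r bA t] M(3)[OF Q_bounded_borel[OF bA t]] by simp
    also have "L (indicator A) = measure \<mu> A"
      using meas[OF A'(1)] A' DM by (simp add: \<mu>_def measure_restrict_space)
    finally show ?thesis by simp
  qed
  then have "quasi_stationary Pr X D \<mu>"
    unfolding quasi_stationary_def using sets \<open>prob_space \<mu>\<close> r(1) by (intro conjI exI[of _ "1 / r"]) auto
  then show ?thesis by blast
qed

theorem quasi_stationary_ex1: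
  assumes ne: "D \<noteq> {}"
    and CbC0: "green_operator Pr X D ` bounded_continuous_on D \<subseteq> C0_on D"
    and eigenfunction: "positive_right_eigenfunction Pr X D h0"
    and irreducible: "killed_irreducible Pr X D"
  shows "\<exists>!\<mu>. quasi_stationary Pr X D \<mu>"
proof -
  obtain lam where h0: "h0 \<in> bounded_measurable_on D" "\<And>x. x \<in> D \<Longrightarrow> 0 < h0 x" and "0 < lam"
    and eig: "\<And>x. x \<in> D \<Longrightarrow> green_operator Pr X D h0 x = 1 / lam * h0 x"
    using eigenfunction by (auto simp: positive_right_eigenfunction_def)
  define h where "h = (\<lambda>x. indicator D x * h0 x)"
  have h: "h \<in> bounded_borel" unfolding h_def by (rule bounded_measurable_on_extend[OF D_borel h0(1)])
  have h_nonneg: "0 \<le> h x" for x using h0(2) by (cases "x \<in> D") (auto simp: h_def intro: less_imp_le)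
  have h_pos: "0 < h x" if "x \<in> D" for x using h0(2)[OF that] that by (simp add: h_def)
  have h_eig: "green h x = 1 / lam * h x" for x
  proof (cases "x \<in> D")
    case True
    then show ?thesis using eig[OF True] green_operator_eq[OF h0(1), of x] by (simp add: h_def)
  next
    case False
    then show ?thesis using green_outside[OF h False] by (simp add: h_def)
  qed
  have irred: "(\<forall>x\<in>D. 0 < green (indicator A) x) \<or> (\<forall>x\<in>D. 0 < green (indicator (- A)) x)"
    if A: "A \<in> sets borel" for A
  proof -
    obtain \<xi> where \<xi>: "sets \<xi> = sets (restrict_space borel D)" "0 < emeasure \<xi> (space \<xi>)"
      "\<And>x A. x \<in> D \<Longrightarrow> A \<in> sets \<xi> \<Longrightarrow> 0 < emeasure \<xi> A \<Longrightarrow> 0 < green_kernel Pr X D x A"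
      using irreducible unfolding killed_irreducible_def by blast
    have sp: "space \<xi> = D" using sets_eq_imp_space_eq[OF \<xi>(1)] by (simp add: space_restrict_space)
    have pos: "\<forall>x\<in>D. 0 < green (indicator B) x" if B: "B \<in> sets borel" "0 < emeasure \<xi> (B \<inter> D)" for B
    proof
      fix x assume "x \<in> D"
      have BD: "B \<inter> D \<in> sets \<xi>" unfolding \<xi>(1) using B(1) by (auto simp: sets_restrict_space)
      have bm: "indicator (B \<inter> D \<inter> D) \<in> bounded_measurable_on D"
      proof -
        have "(indicator (B \<inter> D \<inter> D) :: 'a \<Rightarrow> real) \<in> borel_measurable (restrict_space borel D)"
          by (rule measurable_restrict_space1) (use B(1) D_borel in simp)
        moreover have "bounded ((indicator (B \<inter> D \<inter> D) :: 'a \<Rightarrow> real) ` D)"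
          by (auto simp: bounded_iff indicator_def intro!: exI[of _ 1])
        ultimately show ?thesis by (simp add: bounded_measurable_on_def)
      qed
      have "0 < green_operator Pr X D (indicator (B \<inter> D \<inter> D)) x"
        using \<xi>(3)[OF \<open>x \<in> D\<close> BD B(2)] by (simp add: green_kernel_def)
      also have "\<dots> = green (\<lambda>y. indicator D y * indicator (B \<inter> D \<inter> D) y) x" by (rule green_operator_eq[OF bm])
      also have "\<dots> \<le> green (indicator B) x"
        by (rule daniell_mono[OF daniell_green bounded_measurable_on_extend[OF D_borel bm] bounded_borel_indicator[OF B(1)]])
          (auto simp: indicator_def)
      finally show "0 < green (indicator B) x" .
    qed
    have split: "emeasure \<xi> (space \<xi>) = emeasure \<xi> (A \<inter> D) + emeasure \<xi> (- A \<inter> D)"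
    proof -
      have "A \<inter> D \<in> sets \<xi>" "- A \<inter> D \<in> sets \<xi>" unfolding \<xi>(1) using A by (auto simp: sets_restrict_space)
      then have "emeasure \<xi> ((A \<inter> D) \<union> (- A \<inter> D)) = emeasure \<xi> (A \<inter> D) + emeasure \<xi> (- A \<inter> D)"
        by (intro plus_emeasure[symmetric]) auto
      moreover have "(A \<inter> D) \<union> (- A \<inter> D) = space \<xi>" unfolding sp by auto
      ultimately show ?thesis by simp
    qed
    have "- A \<in> sets borel" using A by auto
    have "0 < emeasure \<xi> (A \<inter> D) \<or> 0 < emeasure \<xi> (- A \<inter> D)"
    proof (rule ccontr)
      assume "\<not> ?thesis"
      then show False using \<xi>(2) split by (simp add: not_gr_zero)
    qed
    then show ?thesis using pos[OF A] pos[OF \<open>- A \<in> sets borel\<close>] by blast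
  qed
  have ex: "\<exists>\<mu>. quasi_stationary Pr X D \<mu>"
  proof -
    have cont: "continuous_on (closure D) (green f)" if f: "f \<in> bounded_borel" "continuous_on D f" for f
    proof -
      obtain b where b: "0 \<le> b" "\<And>x. \<bar>f x\<bar> \<le> b" by (rule bounded_borel_bound[OF f(1)]) (rule that; blast)
      have "f \<in> bounded_continuous_on D"
        using f(2) b(2) by (auto simp: bounded_continuous_on_def bounded_iff)
      then have C0: "green_operator Pr X D f \<in> C0_on D" using CbC0 by blast
      have bm: "f \<in> bounded_measurable_on D"
        using f(1) b(2) by (auto simp: bounded_measurable_on_def bounded_borel_iff bounded_iff intro!: measurable_restrict_space1)
      have eq: "green f x = green_operator Pr X D f x" for x
        unfolding green_operator_eq[OF bm]
        by (rule kernel_restrict[OF f(1) bounded_measurable_on_extend[OF D_borel bm]]) simp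
      show ?thesis
        by (rule continuous_on_zero_extension[OF closure_subset open_in_closure C0 eq green_outside[OF f(1)]])
    qed
    obtain x0 where "x0 \<in> D" using ne by blast
    have "\<exists>r>0. \<exists>L. daniell L \<and> L (\<lambda>x. 1) = 1 \<and> L (indicator (- D)) = 0 \<and>
        (\<forall>f\<in>bounded_borel. L (green f) = r * L f)"
    proof (rule eigenfunctional_exists[where h=h and ?r0.0="1 / lam" and ?x0.0=x0,
          OF kernel_operator_axioms compact_closure closure_subset open_in_closure])
      show "0 < 1 / lam" using \<open>0 < lam\<close> by simp
    qed (fact green_outside cont h h_nonneg h_pos[OF \<open>x0 \<in> D\<close>] h_eig)+
    then obtain r L where L: "daniell L" "L (\<lambda>x. 1) = 1" "L (indicator (- D)) = 0"
      and r: "0 < r" "\<And>f. f \<in> bounded_borel \<Longrightarrow> L (green f) = r * L f" by metis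
    show ?thesis by (rule eigenfunctional_quasi_stationary[OF L r])
  qed
  have unique: "\<mu> = \<nu>" if \<mu>: "quasi_stationary Pr X D \<mu>" and \<nu>: "quasi_stationary Pr X D \<nu>" for \<mu> \<nu>
  proof (rule measure_eqI)
    have sets: "sets \<mu> = sets (restrict_space borel D)" "sets \<nu> = sets (restrict_space borel D)"
      and prob: "prob_space \<mu>" "prob_space \<nu>"
      using \<mu> \<nu> by (auto simp: quasi_stationary_def)
    show "sets \<mu> = sets \<nu>" using sets by simp
    obtain l1 where l1: "\<And>f. f \<in> bounded_borel \<Longrightarrow> (\<integral>x. green f x \<partial>\<mu>) = 1 / l1 * (\<integral>x. f x \<partial>\<mu>)"
      using quasi_stationary_functional(4)[OF \<mu>] by blast
    obtain l2 where l2: "\<And>f. f \<in> bounded_borel \<Longrightarrow> (\<integral>x. green f x \<partial>\<nu>) = 1 / l2 * (\<integral>x. f x \<partial>\<nu>)"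
      using quasi_stationary_functional(4)[OF \<nu>] by blast
    fix A assume A: "A \<in> sets \<mu>"
    then have A': "A \<in> sets borel" "A \<in> sets \<nu>" using D_borel unfolding sets by (auto simp: sets_restrict_space)
    have "(\<integral>x. indicator A x \<partial>\<mu>) = (\<integral>x. indicator A x \<partial>\<nu> :: real)"
      by (rule eigenfunctional_unique[OF h h_nonneg h_pos h_eig irred
            quasi_stationary_functional(1-3)[OF \<mu>] l1 quasi_stationary_functional(1-3)[OF \<nu>] l2 bounded_borel_indicator[OF A'(1)]])
    then have "measure \<mu> A = measure \<nu> A" using A A'(2) by simp
    then show "emeasure \<mu> A = emeasure \<nu> A"
      using prob by (simp add: finite_measure.emeasure_eq_measure[OF prob_space.finite_measure])
  qed
  show ?thesis using ex unique by blast
qed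

end

theorem theorem2p13:
  fixes P :: "real \<Rightarrow> 'a::{metric_space, second_countable_topology} \<Rightarrow> 'a measure"
    and \<A> :: "'w measure"
    and \<F> :: "real \<Rightarrow> 'w measure"
    and Pr :: "'a \<Rightarrow> 'w measure"
    and X :: "real \<Rightarrow> 'w \<Rightarrow> 'a"
    and D :: "'a set"
  assumes "locally compact (UNIV :: 'a set)"
    and "D \<noteq> {}"
    and "compact (closure D)"
    and "openin (top_of_set (closure D)) D"
    and "markov_feller_semigroup P"
    and "cadlag_markov_process P \<A> \<F> Pr X"
    and accessible: "\<forall>x\<in>closure D. \<exists>t\<ge>0. measure (P t x) (- closure D) > 0"
    and C_b_to_C_0: "green_operator Pr X D ` bounded_continuous_on D \<subseteq> C0_on D"
    and eigenfunction: "\<exists>h. positive_right_eigenfunction Pr X D h"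
    and irreducible: "killed_irreducible Pr X D"
  shows "\<exists>!\<mu>. quasi_stationary Pr X D \<mu>"
proof -
  interpret markov_feller_semigroup P by fact
  interpret cadlag_markov_process P \<A> \<F> Pr X by fact
  interpret killed_feller_process P \<A> \<F> Pr X D by unfold_locales fact
  obtain C c where Cc: "0 \<le> C" "0 < c" "\<And>t x. 0 \<le> t \<Longrightarrow> Q t (\<lambda>_. 1) x \<le> C * exp (- c * t)"
    by (rule exponential_decay[OF assms(1) assms(3) assms(2) accessible]) (rule that; blast)
  interpret transient_killed_process P \<A> \<F> Pr X D C c
    by unfold_locales
      (fact daniell_Q Q_jointly_measurable killed_semigroup_property Cc D_in_borel Q_outside_zero Q_start_zero assms(1,3))+
  obtain h where "positive_right_eigenfunction Pr X D h" using eigenfunction by blast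
  from quasi_stationary_ex1[OF assms(2) C_b_to_C_0 this irreducible] show ?thesis .
qed

end
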